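(* Let $X$ be a Banach space and let $\Gamma:[0,1]\to cwk(X)$ be a variationally Henstock integrable multifunction. Then $\Gamma$ is the sum of a variationally Henstock integrable selection $f$ of $\Gamma$ and a Birkhoff integrable multifunction $G:[0,1]\to cwk(X)$ that is also variationally Henstock integrable; that is, $\Gamma(t)=G(t)+f(t)$ for all $t\in[0,1]$.
   Context: $X$ is an arbitrary (not necessarily separable) real Banach space and $cwk(X)$ is the family of all non-empty convex weakly compact subsets of $X$, with Minkowski addition, multiplication by positive scalars, and the Hausdorff distance $d_H$. A multifunction is a map $\Gamma:[0,1]\to cwk(X)$; a selection of $\Gamma$ is a function $f:[0,1]\to X$ with $f(t)\in\Gamma(t)$ for every $t\in[0,1]$. $\lambda$ is Lebesgue measure on $[0,1]$, $\mathcal{L}$ the family of Lebesgue measurable subsets of $[0,1]$, $\mathcal{I}$ the collection of closed subintervals of $[0,1]$, and $|I|$ the length of $I$. A gauge is any strictly positive function $\delta$ on $[0,1]$. A Perron partition of $[0,1]$ is a finite collection $\{(I_1,t_1),\dots,(I_p,t_p)\}$ of nonoverlapping intervals $I_j\in\mathcal{I}$ with union $[0,1]$ and points $t_j\in I_j$; it is $\delta$-fine if $I_j\subset(t_j-\delta(t_j),t_j+\delta(t_j))$ for all $j$. An interval multimeasure is a map $\Phi:\mathcal{I}\to cwk(X)$ with $\Phi(I_1\cup I_2)=\Phi(I_1)+\Phi(I_2)$ for all nonoverlapping $I_1,I_2\in\mathcal{I}$ with $I_1\cup I_2\in\mathcal{I}$. $\Gamma$ is variationally Henstock integrable if there is an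 interval multimeasure $\Phi_\Gamma:\mathcal{I}\to cwk(X)$ such that for every $\varepsilon>0$ there is a gauge $\delta$ on $[0,1]$ with $\sum_{j=1}^p d_H(\Phi_\Gamma(I_j),\Gamma(t_j)|I_j|)<\varepsilon$ for every $\delta$-fine Perron partition $\{(I_1,t_1),\dots,(I_p,t_p)\}$ of $[0,1]$. A function $f:[0,1]\to X$ is variationally Henstock integrable if the same holds with an additive $X$-valued interval function and the norm distance (equivalently, for $t\mapsto\{f(t)\}$). $G:[0,1]\to cwk(X)$ is Birkhoff integrable on $[0,1]$ if there is $\Phi_G([0,1])\in cwk(X)$ such that for every $\varepsilon>0$ there is a countable partition $\mathcal{P}_0$ of $[0,1]$ into sets of $\mathcal{L}$ such that for every countable partition $(A_n)_n$ of $[0,1]$ into sets of $\mathcal{L}$ finer than $\mathcal{P}_0$ and any choice of $t_n\in A_n$, the series $\sum_n\lambda(A_n)G(t_n)$ is unconditionally convergent (in the Hausdorff metric) and $d_H\big(\Phi_G([0,1]),\sum_n G(t_n)\lambda(A_n)\big)<\varepsilon$ (empty sets $A_n$ are allowed and contribute nothing). *)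

theory Defs
  imports "HOL-Analysis.Analysis" "HOL-Library.Set_Algebras" "HOL-Library.FuncSet"
begin

text \<open>Minkowski addition of sets (with unit the singleton of 0) is the operation \<open>+\<close> of
  \<open>Set_Algebras\<close>, so finite sums of sets are ordinary \<open>sum\<close>s.\<close>

definition weak_topology :: "'a::real_normed_vector topology" where
  "weak_topology =
     topology_generated_by {\<phi> -` U | (\<phi> :: 'a \<Rightarrow> real) U. bounded_linear \<phi> \<and> open U}"

definition cwk :: "'a::real_normed_vector set set" where
  "cwk = {K. K \<noteq> {} \<and> convex K \<and> compactin weak_topology K}"

text \<open>The suprema are meaningful for non-empty bounded sets, in particular on \<open>cwk\<close>.\<close>

definition hausdorff_dist :: "'a::metric_space set \<Rightarrow> 'a set \<Rightarrow> real" where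
  "hausdorff_dist A B = max (SUP a\<in>A. infdist a B) (SUP b\<in>B. infdist b A)"


text \<open>Degenerate intervals are admitted, in agreement with \<open>tagged_division_of\<close>. This makes no
  difference: additivity forces an interval function with values in a vector space, or in
  \<open>cwk\<close>, to be 0 (respectively the singleton of 0) on them, so they contribute nothing to the
  sums below.\<close>

definition closed_subintervals :: "real set set" where
  "closed_subintervals = {{a..b} | a b. 0 \<le> a \<and> a \<le> b \<and> b \<le> 1}"

definition interval_additive :: "(real set \<Rightarrow> 'b::plus) \<Rightarrow> bool" where
  "interval_additive \<Phi> \<longleftrightarrow>
     (\<forall>I\<in>closed_subintervals. \<forall>J\<in>closed_subintervals.
        interior I \<inter> interior J = {} \<longrightarrow> I \<union> J \<in> closed_subintervals \<longrightarrow> \<Phi> (I \<union> J) = \<Phi> I + \<Phi> J)"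

definition interval_multimeasure :: "(real set \<Rightarrow> 'a::real_normed_vector set) \<Rightarrow> bool" where
  "interval_multimeasure \<Phi> \<longleftrightarrow> \<Phi> \<in> closed_subintervals \<rightarrow> cwk \<and> interval_additive \<Phi>"

definition fine_perron_partition :: "(real \<Rightarrow> real) \<Rightarrow> (real \<times> real set) set \<Rightarrow> bool" where
  "fine_perron_partition \<delta> p \<longleftrightarrow>
     p tagged_division_of {0..1} \<and> (\<lambda>t. {t - \<delta> t<..<t + \<delta> t}) fine p"

definition vH_integrable_multi :: "(real \<Rightarrow> 'a::real_normed_vector set) \<Rightarrow> bool" where
  "vH_integrable_multi \<Gamma> \<longleftrightarrow>
     (\<exists>\<Phi>. interval_multimeasure \<Phi> \<and>
       (\<forall>\<epsilon>>0. \<exists>\<delta>. (\<forall>t\<in>{0..1}. \<delta> t > 0) \<and>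
         (\<forall>p. fine_perron_partition \<delta> p \<longrightarrow>
           (\<Sum>(t, I)\<in>p. hausdorff_dist (\<Phi> I) ((*\<^sub>R) (measure lborel I) ` \<Gamma> t)) < \<epsilon>)))"

definition vH_integrable :: "(real \<Rightarrow> 'a::real_normed_vector) \<Rightarrow> bool" where
  "vH_integrable f \<longleftrightarrow>
     (\<exists>\<phi> :: real set \<Rightarrow> 'a. interval_additive \<phi> \<and>
       (\<forall>\<epsilon>>0. \<exists>\<delta>. (\<forall>t\<in>{0..1}. \<delta> t > 0) \<and>
         (\<forall>p. fine_perron_partition \<delta> p \<longrightarrow>
           (\<Sum>(t, I)\<in>p. norm (\<phi> I - measure lborel I *\<^sub>R f t)) < \<epsilon>)))"


definition hausdorff_sums ::
    "(nat \<Rightarrow> 'a::real_normed_vector set) \<Rightarrow> 'a set \<Rightarrow> bool" where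
  "hausdorff_sums K S \<longleftrightarrow> (\<lambda>N. hausdorff_dist (\<Sum>n<N. K n) S) \<longlonglongrightarrow> 0"

definition unconditionally_convergent :: "(nat \<Rightarrow> 'a::real_normed_vector set) \<Rightarrow> bool" where
  "unconditionally_convergent K \<longleftrightarrow>
     (\<forall>\<pi>. bij \<pi> \<longrightarrow> (\<exists>S\<in>cwk. hausdorff_sums (K \<circ> \<pi>) S))"

text \<open>Finite partitions are the case where all but finitely many members are empty.\<close>

definition measurable_partition :: "(nat \<Rightarrow> real set) \<Rightarrow> bool" where
  "measurable_partition A \<longleftrightarrow>
     range A \<subseteq> sets lebesgue \<and> disjoint_family A \<and> (\<Union>n. A n) = {0..1}"

definition finer_than :: "(nat \<Rightarrow> real set) \<Rightarrow> (nat \<Rightarrow> real set) \<Rightarrow> bool" where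
  "finer_than A P \<longleftrightarrow> (\<forall>n. \<exists>m. A n \<subseteq> P m)"

definition birkhoff_term ::
    "(real \<Rightarrow> 'a::real_normed_vector set) \<Rightarrow> (nat \<Rightarrow> real set) \<Rightarrow> (nat \<Rightarrow> real) \<Rightarrow> nat \<Rightarrow> 'a set" where
  "birkhoff_term G A t n =
     (if A n = {} then {0} else (*\<^sub>R) (measure lebesgue (A n)) ` G (t n))"

definition birkhoff_integrable :: "(real \<Rightarrow> 'a::real_normed_vector set) \<Rightarrow> bool" where
  "birkhoff_integrable G \<longleftrightarrow>
     (\<exists>J\<in>cwk. \<forall>\<epsilon>>0. \<exists>P. measurable_partition P \<and>
       (\<forall>A t. measurable_partition A \<longrightarrow> finer_than A P \<longrightarrow> (\<forall>n. A n \<noteq> {} \<longrightarrow> t n \<in> A n) \<longrightarrow>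
         unconditionally_convergent (birkhoff_term G A t) \<and>
         (\<exists>S\<in>cwk. hausdorff_sums (birkhoff_term G A t) S \<and> hausdorff_dist J S < \<epsilon>)))"

end

theory Submission
  imports Defs
begin

text \<open>Differentiating the primitive \<open>\<Phi>\<close> almost everywhere shows that, up to a null set and for every
  \<open>\<epsilon>\<close>, the unit interval splits into countably many measurable pieces on which \<open>\<Gamma>\<close> varies by at most
  \<open>\<epsilon>\<close>; successive approximation yields a selection \<open>f\<close> of the same kind. For a fine tagged interval
  \<open>(t, I)\<close> and the piece \<open>E\<close> of \<open>t\<close>, both \<open>\<Phi> I\<close> and the part of a Riemann sum over \<open>I\<close> with tags in \<open>E\<close>
  are close to \<open>|I| \<Gamma> t\<close>. Comparing support functions, the tags outside \<open>E\<close> therefore contribute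
  little, whatever elements of \<open>\<Gamma>\<close> are chosen there. Hence the Riemann sums of \<open>f\<close> satisfy the Cauchy
  criterion and \<open>f\<close> is variationally Henstock integrable.

  The translate \<open>G = \<Gamma> - f\<close> is again variationally Henstock integrable and contains \<open>0\<close>. The same
  estimate now says that the values of \<open>G\<close> outside a set on which \<open>G\<close> is bounded contribute uniformly
  little, so that the tails of the Birkhoff sums are uniformly small. Their sum is the image of a
  product of weakly compact sets under a weakly continuous map (Tychonoff), hence lies in \<open>cwk\<close>, and it
  is compared with \<open>\<Phi>\<close> through Riemann sums in which the tags in each set of the partition have total
  length close to its measure.\<close>

section \<open>Functionals and the weak topology\<close>

text \<open>The integral is not absolute, so tags outside the good piece \<open>E\<close> cannot be
  discarded by size, however short their intervals. What replaces absoluteness is a one-sided bound.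
  For a functional \<phi> of norm at most 1, the support function of \<Phi> is additive and
  dominates, up to the variational error, the sum of \<phi> over any choice of values; the tags in
  \<open>E\<close> nearly exhaust it, so the other tags have only the remainder. Taking \<phi> to
  norm their sum gives a norm estimate, uniform in the choice. Subtracting a selection puts 0 in
  every value. Any family of tags may then be given the value 0, so the estimate passes to
  subfamilies; that is the unconditionality which \<Gamma> itself need not have. In a nonseparable
  space no measurability is given; it comes from \<Phi>, since almost every
  \<open>\<Gamma> t\<close> is a limit of rescaled values of \<Phi> on countably many intervals. The
  remaining null set may carry values of arbitrary size, so it is cut up by size, and each piece
  gets an open neighbourhood whose excess measure is small relative to the bound of the
  piece.\<close>

definition sublinear :: "('a::real_normed_vector \<Rightarrow> real) \<Rightarrow> bool" where
  "sublinear p \<longleftrightarrow> (\<forall>x y. p (x + y) \<le> p x + p y) \<and> (\<forall>c>0. \<forall>x. p (c *\<^sub>R x) \<le> c * p x)"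

text \<open>Homogeneity is asked only as an inequality, the form that passes to infima; the
  inequality for \<open>1/c\<close> turns it into an equality.\<close>

lemma sublinearD:
  assumes "sublinear p"
  shows "p (x + y) \<le> p x + p y" "c > 0 \<Longrightarrow> p (c *\<^sub>R x) = c * p x" "p 0 = 0" "- p (- x) \<le> p x"
proof -
  have le: "p (c *\<^sub>R x) \<le> c * p x" if "c > 0" for c x
    using assms that by (auto simp: sublinear_def)
  have eq: "p (c *\<^sub>R x) = c * p x" if "c > 0" for c x
  proof -
    have "p ((1/c) *\<^sub>R (c *\<^sub>R x)) \<le> (1/c) * p (c *\<^sub>R x)"
      using that by (intro le) auto
    with le[OF that, of x] that show ?thesis by (simp add: field_simps)
  qed
  then show "c > 0 \<Longrightarrow> p (c *\<^sub>R x) = c * p x" by blast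
  show sub: "p (x + y) \<le> p x + p y" for x y
    using assms by (auto simp: sublinear_def)
  show "p 0 = 0" using eq[of 2 0] by simp
  with sub[of x "- x"] show "- p (- x) \<le> p x" by simp
qed

text \<open>The competitor that shows a minimal functional to be odd: \<open>t = 0\<close> in the
  infimum gives \<open>q \<le> p\<close>, and \<open>t = 1\<close> at \<open>- y\<close> gives
  \<open>p 0 - p y\<close>. Subadditivity of \<open>p\<close> bounds the infimum below by
  \<open>- p (- x)\<close>.\<close>

lemma sublinear_shift:
  fixes p :: "'a::real_normed_vector \<Rightarrow> real"
  assumes "sublinear p"
  obtains q where "sublinear q" "q \<le> p" "q (- y) \<le> - p y"
proof -
  define q where "q x = (INF t\<in>{0..}. p (x + t *\<^sub>R y) - t * p y)" for x
  have bd: "bdd_below ((\<lambda>t. p (x + t *\<^sub>R y) - t * p y) ` {0..})" for x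
  proof (rule bdd_belowI2)
    fix t :: real assume t: "t \<in> {0..}"
    have "p (t *\<^sub>R y) = t * p y"
      using t sublinearD[OF assms] by (cases "t = 0") auto
    moreover have "p (t *\<^sub>R y) \<le> p (x + t *\<^sub>R y) + p (- x)"
      using sublinearD(1)[OF assms, of "x + t *\<^sub>R y" "- x"] by simp
    ultimately show "- p (- x) \<le> p (x + t *\<^sub>R y) - t * p y" by simp
  qed
  have up: "q x \<le> p (x + t *\<^sub>R y) - t * p y" if "t \<ge> 0" for x t
    unfolding q_def by (rule cINF_lower[OF bd]) (use that in auto)
  have lo: "q x \<ge> m" if "\<And>t. t \<ge> 0 \<Longrightarrow> m \<le> p (x + t *\<^sub>R y) - t * p y" for x m
    unfolding q_def by (rule cINF_greatest) (use that in auto)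
  have "q (x + z) \<le> q x + q z" for x z
  proof -
    have *: "q (x + z) - (p (z + t *\<^sub>R y) - t * p y) \<le> q x" if t: "t \<ge> 0" for t
    proof (rule lo)
      fix s :: real assume s: "s \<ge> 0"
      have "q (x + z) \<le> p (x + z + (s + t) *\<^sub>R y) - (s + t) * p y"
        by (rule up) (use s t in auto)
      also have "p (x + z + (s + t) *\<^sub>R y) \<le> p (x + s *\<^sub>R y) + p (z + t *\<^sub>R y)"
        using sublinearD(1)[OF assms, of "x + s *\<^sub>R y" "z + t *\<^sub>R y"] by (simp add: algebra_simps)
      finally show "q (x + z) - (p (z + t *\<^sub>R y) - t * p y) \<le> p (x + s *\<^sub>R y) - s * p y"
        by (simp add: algebra_simps)
    qed
    have "q (x + z) - q x \<le> q z"
      by (rule lo) (use * in \<open>auto simp: algebra_simps\<close>)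
    then show ?thesis by simp
  qed
  moreover have "q (c *\<^sub>R x) \<le> c * q x" if c: "c > 0" for c x
  proof -
    have "q (c *\<^sub>R x) / c \<le> q x"
    proof (rule lo)
      fix t :: real assume t: "t \<ge> 0"
      have "q (c *\<^sub>R x) \<le> p (c *\<^sub>R x + (c * t) *\<^sub>R y) - (c * t) * p y"
        by (rule up) (use c t in auto)
      also have "c *\<^sub>R x + (c * t) *\<^sub>R y = c *\<^sub>R (x + t *\<^sub>R y)" by (simp add: algebra_simps)
      also have "p \<dots> = c * p (x + t *\<^sub>R y)" using sublinearD(2)[OF assms c] .
      finally show "q (c *\<^sub>R x) / c \<le> p (x + t *\<^sub>R y) - t * p y"
        using c by (simp add: field_simps)
    qed
    with c show ?thesis by (simp add: field_simps)
  qed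
  ultimately have "sublinear q" by (auto simp: sublinear_def)
  moreover have "q \<le> p" using up[of 0] by (auto simp: le_fun_def)
  moreover have "q (- y) \<le> - p y" using up[of 1 "- y"] sublinearD(3)[OF assms] by simp
  ultimately show ?thesis using that by blast
qed

text \<open>The Hahn--Banach theorem in the following form: a minimal sublinear functional is linear.\<close>

lemma ex_linear_below_sublinear:
  fixes p :: "'a::real_normed_vector \<Rightarrow> real"
  assumes "sublinear p"
  obtains \<phi> where "linear \<phi>" "\<phi> \<le> p"
proof -
  define S where "S = {q. sublinear q \<and> q \<le> p}"
  let ?P = "\<lambda>q r :: 'a \<Rightarrow> real. r \<le> q"
  \<comment> \<open>The order is reversed: Zorn's lemma yields a minimal functional, and the bound
    of a chain is its pointwise infimum.\<close>
  have "\<exists>m\<in>S. \<forall>a\<in>S. ?P m a \<longrightarrow> a = m"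
  proof (rule predicate_Zorn)
    show "partial_order_on S (relation_of ?P S)"
      by (rule partial_order_on_relation_ofI) auto
    fix C assume C: "C \<in> Chains (relation_of ?P S)"
    then have CS: "C \<subseteq> S" by (rule Chains_relation_of)
    have tot: "q \<le> r \<or> r \<le> q" if "q \<in> C" "r \<in> C" for q r
      using C that by (force simp: Chains_def relation_of_def)
    show "\<exists>u\<in>S. \<forall>a\<in>C. u \<le> a"
    proof (cases "C = {}")
      case True
      then show ?thesis using assms by (auto simp: S_def)
    next
      case False
      define u where "u x = (INF q\<in>C. q x)" for x
      have sub: "sublinear q" "q \<le> p" if "q \<in> C" for q using CS that by (auto simp: S_def)
      have bd: "bdd_below ((\<lambda>q. q x) ` C)" for x
      proof (rule bdd_belowI2)
        fix q assume q: "q \<in> C"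
        show "- p (- x) \<le> q x"
          using sublinearD(4)[OF sub(1)[OF q], of x] le_funD[OF sub(2)[OF q], of "- x"] by linarith
      qed
      have up: "u x \<le> q x" if "q \<in> C" for q x
        unfolding u_def by (rule cINF_lower[OF bd that])
      have lo: "m \<le> u x" if "\<And>q. q \<in> C \<Longrightarrow> m \<le> q x" for m x
        unfolding u_def by (rule cINF_greatest) (use that False in auto)
      have "u (x + y) \<le> u x + u y" for x y
      proof -
        have *: "u (x + y) - r y \<le> u x" if r: "r \<in> C" for r
        proof (rule lo)
          fix q assume q: "q \<in> C"
          \<comment> \<open>The smaller of the two members lies below both, so a single subadditive
            function gives the mixed bound.\<close>
          from tot[OF q r] obtain s where s: "s \<in> C" "s \<le> q" "s \<le> r"
            using q r by blast
          have "u (x + y) \<le> s (x + y)" by (rule up[OF s(1)])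
          also have "\<dots> \<le> s x + s y" by (rule sublinearD(1)[OF sub(1)[OF s(1)]])
          also have "\<dots> \<le> q x + r y" using s(2,3) by (intro add_mono) (auto simp: le_fun_def)
          finally show "u (x + y) - r y \<le> q x" by simp
        qed
        have "u (x + y) - u x \<le> u y"
          by (rule lo) (use * in \<open>auto simp: algebra_simps\<close>)
        then show ?thesis by simp
      qed
      moreover have "u (c *\<^sub>R x) \<le> c * u x" if c: "c > 0" for c x
      proof -
        have "u (c *\<^sub>R x) / c \<le> u x"
        proof (rule lo)
          fix q assume q: "q \<in> C"
          show "u (c *\<^sub>R x) / c \<le> q x"
            using up[OF q, of "c *\<^sub>R x"] sublinearD(2)[OF sub(1)[OF q] c, of x] c
            by (simp add: field_simps)
        qed
        with c show ?thesis by (simp add: field_simps)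
      qed
      ultimately have "sublinear u" by (auto simp: sublinear_def)
      moreover obtain q where "q \<in> C" using False by blast
      then have "u \<le> p" using up[of q] sub(2)[of q] by (force simp: le_fun_def intro: order_trans)
      ultimately show ?thesis using up by (auto simp: S_def le_fun_def intro!: bexI[of _ u])
    qed
  qed
  then obtain m where m: "sublinear m" "m \<le> p"
    and min: "\<And>a. sublinear a \<Longrightarrow> a \<le> p \<Longrightarrow> a \<le> m \<Longrightarrow> a = m"
    unfolding S_def by blast
  have odd: "m (- y) = - m y" for y
  proof -
    obtain q where q: "sublinear q" "q \<le> m" "q (- y) \<le> - m y" using sublinear_shift[OF m(1)] .
    have "q = m" by (rule min) (use q m(2) in auto)
    then show ?thesis using q(3) sublinearD(4)[OF m(1), of "- y"] by simp
  qed
  have "m (x + y) = m x + m y" for x y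
    using sublinearD(1)[OF m(1), of x y] sublinearD(1)[OF m(1), of "x + y" "- y"] odd[of y] by simp
  moreover have "m (c *\<^sub>R x) = c *\<^sub>R m x" for c x
    using sublinearD(2)[OF m(1), of c x] sublinearD(2)[OF m(1), of "- c" x] sublinearD(3)[OF m(1)]
      odd[of "c *\<^sub>R x"]
    by (cases c "0::real" rule: linorder_cases) auto
  ultimately have "linear m" by (intro linearI)
  with m(2) show ?thesis using that by blast
qed

text \<open>Lowering the norm by \<open>sublinear_shift\<close> before taking a linear minorant
  forces \<open>\<phi> (- x) \<le> - norm x\<close>; this takes the place of extending a functional
  from the line through \<open>x\<close>.\<close>

lemma ex_norming_functional:
  fixes x :: "'a::real_normed_vector"
  obtains \<phi> :: "'a \<Rightarrow> real" where "bounded_linear \<phi>" "\<And>y. \<bar>\<phi> y\<bar> \<le> norm y" "\<phi> x = norm x"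
proof -
  have "sublinear (norm :: 'a \<Rightarrow> real)" by (auto simp: sublinear_def norm_triangle_ineq)
  then obtain q where q: "sublinear q" "q \<le> norm" "q (- x) \<le> - norm x"
    by (rule sublinear_shift)
  from ex_linear_below_sublinear[OF q(1)] obtain \<phi> where \<phi>: "linear \<phi>" "\<phi> \<le> q" .
  have le: "\<phi> y \<le> norm y" for y
    using \<phi>(2) q(2) by (meson le_funD order_trans)
  have abs: "\<bar>\<phi> y\<bar> \<le> norm y" for y
    using le[of y] le[of "- y"] linear_neg[OF \<phi>(1), of y] by auto
  have "- \<phi> x \<le> - norm x"
    using le_funD[OF \<phi>(2), of "- x"] q(3) linear_neg[OF \<phi>(1), of x] by simp
  with le[of x] have "\<phi> x = norm x" by simp
  moreover have "bounded_linear \<phi>"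
    using \<phi>(1) abs by (intro bounded_linear_intro[where K = 1])
      (auto simp: linear_add linear_scale)
  ultimately show ?thesis using abs that by blast
qed

text \<open>The uniform boundedness principle, through Baire's theorem in the dual, which is
  complete. The sets \<open>F n\<close> exhaust it, so one of them contains a ball around some
  \<psi>; moving \<psi> by \<open>e/2\<close> times a functional norming \<open>x\<close> shows
  \<open>e/2 * norm x \<le> 2 * n\<close>.\<close>

lemma weakly_bounded_imp_bounded:
  fixes K :: "'a::real_normed_vector set"
  assumes "\<And>\<phi> :: 'a \<Rightarrow> real. bounded_linear \<phi> \<Longrightarrow> bounded (\<phi> ` K)"
  shows "bounded K"
proof -
  define F where "F n = {\<psi> :: 'a \<Rightarrow>\<^sub>L real. \<forall>x\<in>K. \<bar>\<psi> x\<bar> \<le> real n}" for n :: nat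
  have "closed (F n)" for n
  proof -
    have "F n = (\<Inter>x\<in>K. {\<psi>. \<bar>blinfun_apply \<psi> x\<bar> \<le> real n})" by (auto simp: F_def)
    also have "closed \<dots>"
      by (intro closed_INT ballI closed_Collect_le continuous_intros)
    finally show ?thesis .
  qed
  moreover have "(\<Union>n. F n) = UNIV"
  proof -
    have "\<exists>n. \<psi> \<in> F n" for \<psi> :: "'a \<Rightarrow>\<^sub>L real"
    proof -
      obtain B where B: "\<And>x. x \<in> K \<Longrightarrow> \<bar>\<psi> x\<bar> \<le> B"
        using assms[OF blinfun.bounded_linear_right[of \<psi>]] by (auto simp: bounded_iff)
      obtain n where "B \<le> real n" using real_arch_simple by blast
      then have "\<psi> \<in> F n" using B unfolding F_def by (blast intro: order_trans)
      then show ?thesis ..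
    qed
    then show ?thesis by blast
  qed
  ultimately obtain n where "interior (F n) \<noteq> {}"
    using Baire_category_alt[of "euclidean :: ('a \<Rightarrow>\<^sub>L real) topology" "range F"]
      completely_metrizable_space_euclidean
    by force
  then obtain \<psi> e where e: "e > 0" "ball \<psi> e \<subseteq> F n"
    by (metis all_not_in_conv mem_interior)
  have "norm x \<le> 4 * real n / e" if x: "x \<in> K" for x
  proof -
    obtain \<phi> :: "'a \<Rightarrow> real" where \<phi>: "bounded_linear \<phi>" "\<And>y. \<bar>\<phi> y\<bar> \<le> norm y" "\<phi> x = norm x"
      using ex_norming_functional[of x] by blast
    define \<kappa> where "\<kappa> = Blinfun \<phi>"
    have app: "blinfun_apply \<kappa> = \<phi>" unfolding \<kappa>_def by (rule bounded_linear_Blinfun_apply[OF \<phi>(1)])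
    have "norm \<kappa> \<le> 1" by (rule norm_blinfun_bound) (use \<phi>(2) in \<open>auto simp: app\<close>)
    then have "norm ((e/2) *\<^sub>R \<kappa>) < e" using e(1) by simp
    then have "\<psi> + (e/2) *\<^sub>R \<kappa> \<in> F n" "\<psi> \<in> F n"
      using e by (auto simp: dist_norm subset_iff)
    then have "\<bar>\<psi> x + e/2 * norm x\<bar> \<le> n" "\<bar>\<psi> x\<bar> \<le> n"
      using x by (auto simp: F_def blinfun.add_left blinfun.scaleR_left app \<phi>(3))
    then have "e/2 * norm x \<le> 2 * real n" by linarith
    then show ?thesis using e(1) by (simp add: field_simps)
  qed
  then show ?thesis by (auto simp: bounded_iff)
qed

section \<open>The weak topology and convex weakly compact sets\<close>

lemma topspace_weak [simp]: "topspace (weak_topology :: 'a::real_normed_vector topology) = UNIV"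
proof -
  have "UNIV \<in> {\<phi> -` U | (\<phi> :: 'a \<Rightarrow> real) U. bounded_linear \<phi> \<and> open U}"
    by (rule CollectI, rule exI[of _ "\<lambda>_. 0"], rule exI[of _ UNIV]) auto
  then show ?thesis
    unfolding weak_topology_def topology_generated_by_topspace by blast
qed

lemma continuous_map_weak_functional:
  fixes \<phi> :: "'a::real_normed_vector \<Rightarrow> real"
  assumes "bounded_linear \<phi>"
  shows "continuous_map weak_topology euclidean \<phi>"
proof -
  have "openin weak_topology (\<phi> -` U)" if "open U" for U
    unfolding weak_topology_def by (rule topology_generated_by_Basis) (use assms that in auto)
  then show ?thesis by (auto simp: continuous_map_alt)
qed

lemma continuous_map_into_weak:
  fixes f :: "'b \<Rightarrow> 'a::real_normed_vector"
  assumes "\<And>\<phi> :: 'a \<Rightarrow> real. bounded_linear \<phi> \<Longrightarrow> continuous_map T euclidean (\<phi> \<circ> f)"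
  shows "continuous_map T weak_topology f"
  unfolding weak_topology_def
proof (rule continuous_on_generated_topo)
  show "openin T (f -` W \<inter> topspace T)"
    if "W \<in> {\<phi> -` U | (\<phi> :: 'a \<Rightarrow> real) U. bounded_linear \<phi> \<and> open U}" for W
  proof -
    from that obtain \<phi> :: "'a \<Rightarrow> real" and U where W: "W = \<phi> -` U" "bounded_linear \<phi>" "open U" by blast
    from assms[OF W(2)] W(3) have "openin T ((\<phi> \<circ> f) -` U \<inter> topspace T)"
      by (auto simp: continuous_map_alt)
    then show ?thesis by (simp add: W(1) vimage_comp)
  qed
qed (use topspace_weak[where 'a = 'a] in \<open>simp add: weak_topology_def topology_generated_by_topspace\<close>)

lemma Hausdorff_weak: "Hausdorff_space (weak_topology :: 'a::real_normed_vector topology)"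
  unfolding Hausdorff_space_def
proof (intro allI impI)
  fix x y :: 'a assume xy: "x \<in> topspace weak_topology \<and> y \<in> topspace weak_topology \<and> x \<noteq> y"
  obtain \<phi> :: "'a \<Rightarrow> real" where \<phi>: "bounded_linear \<phi>" "\<phi> (x - y) = norm (x - y)"
    using ex_norming_functional[of "x - y"] by metis
  have ne: "\<phi> x \<noteq> \<phi> y"
    using xy \<phi> linear_diff[OF bounded_linear.linear[OF \<phi>(1)], of x y] by auto
  then obtain U V where UV: "open U" "open V" "\<phi> x \<in> U" "\<phi> y \<in> V" "U \<inter> V = {}"
    by (meson separation_t2)
  have op: "openin weak_topology (\<phi> -` W)" if "open W" for W
    unfolding weak_topology_def by (rule topology_generated_by_Basis) (use \<phi>(1) that in auto)
  show "\<exists>U V. openin weak_topology U \<and> openin weak_topology V \<and> x \<in> U \<and> y \<in> V \<and> disjnt U V"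
    using UV op[OF UV(1)] op[OF UV(2)]
    by (intro exI[of _ "\<phi> -` U"] exI[of _ "\<phi> -` V"]) (auto simp: disjnt_iff)
qed

lemma openin_weak_imp_open:
  fixes U :: "'a::real_normed_vector set"
  assumes "openin weak_topology U"
  shows "open U"
proof -
  have "generate_topology_on {\<phi> -` U | (\<phi> :: 'a \<Rightarrow> real) U. bounded_linear \<phi> \<and> open U} U"
    using assms unfolding weak_topology_def by (rule openin_topology_generated_by)
  then show ?thesis
  proof induction
    case (Basis s)
    then show ?case
      by (auto intro!: open_vimage linear_continuous_on)
  qed auto
qed

text \<open>Weakly compact sets are weakly closed because the weak topology is Hausdorff, and hence
  norm closed; they are bounded because every functional maps them to compact sets of reals.\<close>

lemma cwkD:
  fixes K :: "'a::real_normed_vector set"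
  assumes "K \<in> cwk"
  shows "K \<noteq> {}" "convex K" "compactin weak_topology K" "closed K" "bounded K"
proof -
  show *: "K \<noteq> {}" "convex K" "compactin weak_topology K" using assms by (auto simp: cwk_def)
  have "closedin weak_topology K"
    using Hausdorff_weak *(3) by (rule compactin_imp_closedin)
  then show "closed K"
    using openin_weak_imp_open[of "UNIV - K"] by (auto simp: closedin_def closed_def Compl_eq_Diff_UNIV)
  show "bounded K"
  proof (rule weakly_bounded_imp_bounded)
    fix \<phi> :: "'a \<Rightarrow> real" assume "bounded_linear \<phi>"
    then have "compactin euclidean (\<phi> ` K)"
      using *(3) continuous_map_weak_functional image_compactin by blast
    then show "bounded (\<phi> ` K)" by (auto intro: compact_imp_bounded)
  qed
qed

lemma cwk_affine_image:
  fixes K :: "'a::real_normed_vector set"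
  assumes "K \<in> cwk"
  shows "(\<lambda>x. a + c *\<^sub>R x) ` K \<in> cwk"
proof -
  have "continuous_map weak_topology weak_topology (\<lambda>x :: 'a. a + c *\<^sub>R x)"
  proof (rule continuous_map_into_weak)
    fix \<phi> :: "'a \<Rightarrow> real" assume \<phi>: "bounded_linear \<phi>"
    then interpret bounded_linear \<phi> .
    have "\<phi> \<circ> (\<lambda>x. a + c *\<^sub>R x) = (\<lambda>x. \<phi> a + c * \<phi> x)" by (auto simp: add scale)
    moreover have "continuous_map weak_topology euclidean (\<lambda>x. \<phi> a + c * \<phi> x)"
      by (intro continuous_map_add continuous_map_real_mult
          continuous_map_weak_functional[OF \<phi>] continuous_map_const[THEN iffD2]) auto
    ultimately show "continuous_map weak_topology euclidean (\<phi> \<circ> (\<lambda>x. a + c *\<^sub>R x))" by simp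
  qed
  then have "compactin weak_topology ((\<lambda>x. a + c *\<^sub>R x) ` K)"
    using cwkD(3)[OF assms] image_compactin by blast
  moreover have "convex ((\<lambda>x. a + c *\<^sub>R x) ` K)"
    using cwkD(2)[OF assms] by (rule convex_affinity)
  ultimately show ?thesis using cwkD(1)[OF assms] by (auto simp: cwk_def)
qed

lemma singleton_cwk: "{x} \<in> cwk"
  by (auto simp: cwk_def)

section \<open>Hausdorff distance, support functions and additive interval functions\<close>

abbreviation len :: "real set \<Rightarrow> real" where
  "len \<equiv> measure lborel"

abbreviation rsum :: "(real \<times> real set) set \<Rightarrow> (real \<Rightarrow> 'a) \<Rightarrow> 'a::real_normed_vector" where
  "rsum q f \<equiv> \<Sum>(s, K)\<in>q. measure lborel K *\<^sub>R f s"

text \<open>The value may depend on the interval as well as on the tag: one tag can belong to two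
  intervals, and choices derived from points of \<open>\<Phi> K\<close> may differ between
  them.\<close>

abbreviation rsum_off :: "real set \<Rightarrow> (real \<times> real set) set \<Rightarrow> (real \<Rightarrow> real set \<Rightarrow> 'a) \<Rightarrow> 'a::real_normed_vector" where
  "rsum_off B q g \<equiv> \<Sum>(s, K)\<in>q. if s \<in> B then 0 else measure lborel K *\<^sub>R g s K"

lemma ex_small_factor:
  fixes c e :: real
  assumes "e > 0"
  obtains \<tau> where "\<tau> > 0" "c * \<tau> \<le> e"
proof
  show "e / (\<bar>c\<bar> + 1) > 0" using assms by simp
  have "c * (e / (\<bar>c\<bar> + 1)) = e * (c / (\<bar>c\<bar> + 1))" by simp
  also have "\<dots> \<le> e * 1" using assms by (intro mult_left_mono) (auto simp: divide_le_eq)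
  finally show "c * (e / (\<bar>c\<bar> + 1)) \<le> e" by simp
qed

text \<open>The sets for which the suprema in \<open>hausdorff_dist\<close> are finite, so that it
  is nonnegative and satisfies the triangle inequality.\<close>

definition nebd :: "'a::metric_space set \<Rightarrow> bool" where
  "nebd A \<longleftrightarrow> A \<noteq> {} \<and> bounded A"

lemma cwk_nebd: "K \<in> cwk \<Longrightarrow> nebd K"
  by (simp add: nebd_def cwkD)

lemma nebd_scaleR: "nebd A \<Longrightarrow> nebd ((*\<^sub>R) c ` A)"
  for A :: "'a::real_normed_vector set"
  by (auto simp: nebd_def bounded_scaling)

lemma hausdorff_dist_commute: "hausdorff_dist A B = hausdorff_dist B A"
  by (simp add: hausdorff_dist_def max.commute)

lemma infdist_le_hausdorff_dist:
  assumes "nebd A" "nebd B" "a \<in> A"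
  shows "infdist a B \<le> hausdorff_dist A B"
proof -
  obtain b where b: "b \<in> B" using assms by (auto simp: nebd_def)
  obtain e where e: "\<And>x. x \<in> A \<Longrightarrow> dist b x \<le> e"
    using assms(1) bounded_any_center[of A b] by (auto simp: nebd_def)
  have "bdd_above ((\<lambda>a. infdist a B) ` A)"
    by (rule bdd_aboveI2[where M = e]) (use b e infdist_le2 in \<open>metis dist_commute\<close>)
  then have "infdist a B \<le> (SUP a\<in>A. infdist a B)"
    using assms(3) by (intro cSUP_upper)
  then show ?thesis by (simp add: hausdorff_dist_def)
qed

lemma ex_dist_less_infdist:
  assumes "B \<noteq> {}" "infdist a B < e"
  shows "\<exists>b\<in>B. dist a b < e"
proof -
  have "bdd_below (dist a ` B)" by (rule bdd_belowI2[where m = 0]) auto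
  then show ?thesis using assms by (simp add: infdist_notempty cINF_less_iff)
qed

lemma hausdorff_dist_ex:
  assumes "nebd A" "nebd B" "a \<in> A" "hausdorff_dist A B < e"
  shows "\<exists>b\<in>B. dist a b < e"
  using infdist_le_hausdorff_dist[OF assms(1-3)] assms by (intro ex_dist_less_infdist) (auto simp: nebd_def)

lemma hausdorff_dist_leI:
  assumes "A \<noteq> {}" "B \<noteq> {}" "\<And>a. a \<in> A \<Longrightarrow> infdist a B \<le> e" "\<And>b. b \<in> B \<Longrightarrow> infdist b A \<le> e"
  shows "hausdorff_dist A B \<le> e"
  unfolding hausdorff_dist_def by (intro max.boundedI cSUP_least assms)

lemma hausdorff_dist_leI_ex:
  assumes "A \<noteq> {}" "B \<noteq> {}" "\<And>a. a \<in> A \<Longrightarrow> \<exists>b\<in>B. dist a b \<le> e" "\<And>b. b \<in> B \<Longrightarrow> \<exists>a\<in>A. dist a b \<le> e"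
  shows "hausdorff_dist A B \<le> e"
  using assms by (intro hausdorff_dist_leI) (metis infdist_le2 dist_commute)+

lemma hausdorff_dist_nonneg: "nebd A \<Longrightarrow> nebd B \<Longrightarrow> 0 \<le> hausdorff_dist A B"
  using infdist_le_hausdorff_dist[of A B] infdist_nonneg by (metis all_not_in_conv nebd_def order_trans)

lemma hausdorff_dist_triangle:
  assumes "nebd A" "nebd B" "nebd C"
  shows "hausdorff_dist A C \<le> hausdorff_dist A B + hausdorff_dist B C"
proof -
  have *: "infdist a C \<le> hausdorff_dist A B + hausdorff_dist B C"
    if prem: "nebd A" "nebd B" "nebd C" "a \<in> A" for a and A B C :: "'a set"
  proof (rule field_le_epsilon)
    fix e :: real assume "e > 0"
    with hausdorff_dist_ex[OF prem(1,2,4), of "hausdorff_dist A B + e"]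
    obtain b where b: "b \<in> B" "dist a b < hausdorff_dist A B + e"
      by auto
    then show "infdist a C \<le> hausdorff_dist A B + hausdorff_dist B C + e"
      using infdist_triangle[of a C b] infdist_le_hausdorff_dist[OF prem(2,3) b(1)] by linarith
  qed
  show ?thesis
    using assms *[OF assms] *[of C B A]
    by (intro hausdorff_dist_leI) (auto simp: nebd_def hausdorff_dist_commute add.commute)
qed

lemma infdist_scaleR_le:
  fixes a :: "'a::real_normed_vector"
  assumes "c > 0" "B \<noteq> {}"
  shows "infdist (c *\<^sub>R a) ((*\<^sub>R) c ` B) \<le> c * infdist a B"
proof -
  have "infdist (c *\<^sub>R a) ((*\<^sub>R) c ` B) / c \<le> infdist a B"
    unfolding infdist_notempty[OF assms(2)]
  proof (rule cINF_greatest[OF assms(2)])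
    fix b assume "b \<in> B"
    then have "infdist (c *\<^sub>R a) ((*\<^sub>R) c ` B) \<le> dist (c *\<^sub>R a) (c *\<^sub>R b)"
      by (intro infdist_le) auto
    then show "infdist (c *\<^sub>R a) ((*\<^sub>R) c ` B) / c \<le> dist a b"
      using assms(1) by (simp add: dist_norm pos_divide_le_eq mult.commute flip: scaleR_diff_right)
  qed
  with assms(1) show ?thesis by (simp add: field_simps)
qed

lemma hausdorff_dist_scaleR_le:
  fixes A B :: "'a::real_normed_vector set"
  assumes "c > 0" "nebd A" "nebd B"
  shows "hausdorff_dist ((*\<^sub>R) c ` A) ((*\<^sub>R) c ` B) \<le> c * hausdorff_dist A B"
proof -
  have *: "infdist (c *\<^sub>R a) ((*\<^sub>R) c ` B) \<le> c * hausdorff_dist A B"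
    if "nebd A" "nebd B" "a \<in> A" for a and A B :: "'a set"
  proof -
    have "B \<noteq> {}" using that by (simp add: nebd_def)
    then have "infdist (c *\<^sub>R a) ((*\<^sub>R) c ` B) \<le> c * infdist a B"
      by (rule infdist_scaleR_le[OF assms(1)])
    also have "\<dots> \<le> c * hausdorff_dist A B"
      using assms(1) infdist_le_hausdorff_dist[OF that] by (intro mult_left_mono) auto
    finally show ?thesis .
  qed
  have "A \<noteq> {}" "B \<noteq> {}" using assms by (auto simp: nebd_def)
  then show ?thesis
    using *[OF assms(2,3)] *[OF assms(3,2)]
    by (intro hausdorff_dist_leI) (auto simp: hausdorff_dist_commute[of B])
qed

lemma hausdorff_dist_translate:
  fixes A B :: "'a::real_normed_vector set"
  assumes "nebd A" "nebd B"
  shows "hausdorff_dist ((\<lambda>x. x - a) ` A) ((\<lambda>x. x - b) ` B) \<le> hausdorff_dist A B + norm (a - b)"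
proof -
  have *: "infdist (x - a) ((\<lambda>x. x - b) ` B) \<le> hausdorff_dist A B + norm (a - b)"
    if prem: "nebd A" "nebd B" "x \<in> A" for x a b and A B :: "'a set"
  proof (rule field_le_epsilon)
    fix e :: real assume "e > 0"
    with hausdorff_dist_ex[OF prem, of "hausdorff_dist A B + e"]
    obtain y where y: "y \<in> B" "dist x y < hausdorff_dist A B + e" by auto
    have "infdist (x - a) ((\<lambda>x. x - b) ` B) \<le> dist (x - a) (y - b)"
      using y(1) by (intro infdist_le) auto
    also have "\<dots> \<le> dist x y + norm (a - b)"
      unfolding dist_norm by (rule order_trans[OF eq_refl norm_triangle_ineq4[of "x - y" "a - b"]]) (simp add: algebra_simps)
    finally show "infdist (x - a) ((\<lambda>x. x - b) ` B) \<le> hausdorff_dist A B + norm (a - b) + e"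
      using y(2) by simp
  qed
  have ne: "A \<noteq> {}" "B \<noteq> {}" using assms by (auto simp: nebd_def)
  show ?thesis
  proof (rule hausdorff_dist_leI)
    fix y assume "y \<in> (\<lambda>x. x - b) ` B"
    then obtain x where "x \<in> B" "y = x - b" by blast
    then show "infdist y ((\<lambda>x. x - a) ` A) \<le> hausdorff_dist A B + norm (a - b)"
      using *[OF assms(2,1), of x b a] by (simp add: hausdorff_dist_commute norm_minus_commute)
  qed (use ne *[OF assms] in auto)
qed

section \<open>Support functions\<close>

definition supp :: "('a \<Rightarrow> real) \<Rightarrow> 'a set \<Rightarrow> real" where
  "supp \<phi> A = (SUP x\<in>A. \<phi> x)"

lemma bdd_above_functional:
  fixes \<phi> :: "'a::real_normed_vector \<Rightarrow> real"
  assumes "\<And>y. \<bar>\<phi> y\<bar> \<le> norm y" "bounded A"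
  shows "bdd_above (\<phi> ` A)"
proof -
  obtain M where "\<And>x. x \<in> A \<Longrightarrow> norm x \<le> M" using assms(2) by (auto simp: bounded_iff)
  then show ?thesis using assms(1) by (intro bdd_aboveI2[where M = M]) (meson abs_le_D1 order_trans)
qed

lemma le_supp:
  fixes \<phi> :: "'a::real_normed_vector \<Rightarrow> real"
  assumes "\<And>y. \<bar>\<phi> y\<bar> \<le> norm y" "bounded A" "x \<in> A"
  shows "\<phi> x \<le> supp \<phi> A"
  unfolding supp_def using assms(3) by (intro cSUP_upper bdd_above_functional assms)

text \<open>The constant is 1 for all functionals with this bound, so the functional may be chosen
  after the tagged division, as one that norms a given sum.\<close>

lemma supp_le_add_hausdorff_dist:
  fixes \<phi> :: "'a::real_normed_vector \<Rightarrow> real"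
  assumes \<phi>: "linear \<phi>" "\<And>y. \<bar>\<phi> y\<bar> \<le> norm y" and "nebd A" "nebd B"
  shows "supp \<phi> A \<le> supp \<phi> B + hausdorff_dist A B"
  unfolding supp_def[of \<phi> A]
proof (rule cSUP_least)
  show "A \<noteq> {}" using assms by (simp add: nebd_def)
  fix a assume a: "a \<in> A"
  show "\<phi> a \<le> supp \<phi> B + hausdorff_dist A B"
  proof (rule field_le_epsilon)
    fix e :: real assume "e > 0"
    then obtain b where b: "b \<in> B" "dist a b < hausdorff_dist A B + e"
      using hausdorff_dist_ex[OF assms(3,4) a, of "hausdorff_dist A B + e"] by auto
    have "\<phi> a - \<phi> b \<le> dist a b"
      using \<phi>(2)[of "a - b"] by (simp add: dist_norm linear_diff[OF \<phi>(1)])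
    moreover have "\<phi> b \<le> supp \<phi> B"
      using le_supp[OF \<phi>(2) _ b(1)] assms(4) by (simp add: nebd_def)
    ultimately show "\<phi> a \<le> supp \<phi> B + hausdorff_dist A B + e" using b(2) by linarith
  qed
qed

lemma supp_scaleR:
  fixes \<phi> :: "'a::real_normed_vector \<Rightarrow> real"
  assumes "linear \<phi>" "\<And>y. \<bar>\<phi> y\<bar> \<le> norm y" "c \<ge> 0" "nebd A"
  shows "supp \<phi> ((*\<^sub>R) c ` A) = c * supp \<phi> A"
proof (rule antisym)
  have bd: "bounded A" "A \<noteq> {}" "bounded ((*\<^sub>R) c ` A)" using nebd_scaleR[OF assms(4)] assms(4) by (auto simp: nebd_def)
  show "supp \<phi> ((*\<^sub>R) c ` A) \<le> c * supp \<phi> A"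
    unfolding supp_def[of \<phi> "_ ` _"]
    by (rule cSUP_least) (use bd assms(1,3) le_supp[OF assms(2) bd(1)] in \<open>auto simp: linear_scale intro!: mult_left_mono\<close>)
  show "c * supp \<phi> A \<le> supp \<phi> ((*\<^sub>R) c ` A)"
  proof (cases "c = 0")
    case True
    then have "(*\<^sub>R) c ` A = {0}" using bd(2) by auto
    then show ?thesis using True linear_0[OF assms(1)] by (simp add: supp_def)
  next
    case False
    have "supp \<phi> A \<le> supp \<phi> ((*\<^sub>R) c ` A) / c"
      unfolding supp_def[of \<phi> A]
    proof (rule cSUP_least[OF bd(2)])
      fix x assume "x \<in> A"
      then have "\<phi> (c *\<^sub>R x) \<le> supp \<phi> ((*\<^sub>R) c ` A)"
        by (intro le_supp[OF assms(2) bd(3)]) auto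
      then show "\<phi> x \<le> supp \<phi> ((*\<^sub>R) c ` A) / c"
        using False assms(1,3) by (simp add: linear_scale field_simps)
    qed
    then show ?thesis using False assms(3) by (simp add: field_simps)
  qed
qed

lemma supp_plus:
  fixes \<phi> :: "'a::real_normed_vector \<Rightarrow> real"
  assumes "linear \<phi>" "\<And>y. \<bar>\<phi> y\<bar> \<le> norm y" "nebd A" "nebd B"
  shows "supp \<phi> (A + B) = supp \<phi> A + supp \<phi> B"
proof (rule antisym)
  have bd: "bounded A" "A \<noteq> {}" "bounded B" "B \<noteq> {}" using assms by (auto simp: nebd_def)
  have AB: "bounded (A + B)" using bounded_plus[OF bd(1,3)] by (simp add: set_plus_image)
  show "supp \<phi> (A + B) \<le> supp \<phi> A + supp \<phi> B"
    unfolding supp_def[of \<phi> "A + B"]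
  proof (rule cSUP_least)
    show "A + B \<noteq> {}" using bd by (auto simp: set_plus_def)
    fix z assume "z \<in> A + B"
    then obtain x y where "z = x + y" "x \<in> A" "y \<in> B" by (auto elim: set_plus_elim)
    then show "\<phi> z \<le> supp \<phi> A + supp \<phi> B"
      using le_supp[OF assms(2) bd(1), of x] le_supp[OF assms(2) bd(3), of y]
      by (auto simp: linear_add[OF assms(1)])
  qed
  have "supp \<phi> A \<le> supp \<phi> (A + B) - \<phi> y" if "y \<in> B" for y
    unfolding supp_def[of \<phi> A]
  proof (rule cSUP_least[OF bd(2)])
    fix x assume "x \<in> A"
    then show "\<phi> x \<le> supp \<phi> (A + B) - \<phi> y"
      using le_supp[OF assms(2) AB, of "x + y"] that set_plus_intro[of x A y B]
      by (auto simp: linear_add[OF assms(1)])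
  qed
  then have "supp \<phi> B \<le> supp \<phi> (A + B) - supp \<phi> A"
    unfolding supp_def[of \<phi> B] by (intro cSUP_least[OF bd(4)]) (auto simp: algebra_simps)
  then show "supp \<phi> A + supp \<phi> B \<le> supp \<phi> (A + B)" by simp
qed

section \<open>Additive interval functions\<close>

lemma closed_subintervals_iff: "{a..b} \<in> closed_subintervals \<longleftrightarrow> 0 \<le> a \<and> a \<le> b \<and> b \<le> (1::real)"
  by (auto simp: closed_subintervals_def Icc_eq_Icc)

lemma interval_additiveD:
  assumes "interval_additive m" "0 \<le> a" "a \<le> b" "b \<le> c" "c \<le> 1"
  shows "m {a..c} = m {a..b} + m {b..c}"
proof -
  have "{a..b} \<union> {b..c} = {a..c}" using assms by (auto simp: ivl_disj_un)
  moreover have "m ({a..b} \<union> {b..c}) = m {a..b} + m {b..c}"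
    using assms(1)[unfolded interval_additive_def, rule_format, of "{a..b}" "{b..c}"] assms calculation
    by (auto simp: closed_subintervals_iff)
  ultimately show ?thesis by simp
qed

lemma negligible_Int_intervals:
  assumes "interior {a..b} \<inter> interior {c..d} = {}"
  shows "negligible ({a..b} \<inter> {c..d::real})"
proof -
  have "{max a c<..<min b d} = {}"
    using assms by (simp add: Int_greaterThanLessThan)
  then have "{a..b} \<inter> {c..d} \<subseteq> {max a c}" by auto
  then show ?thesis by (rule negligible_subset[rotated]) simp
qed

lemma interval_additiveI:
  assumes "\<And>I J. I \<in> closed_subintervals \<Longrightarrow> J \<in> closed_subintervals \<Longrightarrow> interior I \<inter> interior J = {} \<Longrightarrow>
    negligible (I \<inter> J) \<Longrightarrow> I \<union> J \<in> closed_subintervals \<Longrightarrow> m (I \<union> J) = m I + m J"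
  shows "interval_additive m"
  unfolding interval_additive_def
proof (intro ballI impI)
  fix I J assume IJ: "I \<in> closed_subintervals" "J \<in> closed_subintervals" "interior I \<inter> interior J = {}"
    "I \<union> J \<in> closed_subintervals"
  then obtain a b c d where "I = {a..b}" "J = {c..d}" unfolding closed_subintervals_def by blast
  then have "negligible (I \<inter> J)" using IJ(3) negligible_Int_intervals by blast
  with IJ show "m (I \<union> J) = m I + m J" by (intro assms)
qed

text \<open>\<open>g\<close> extends \<open>m\<close> to all real intervals by intersection with the
  unit interval, which makes it operative; \<open>m0\<close> covers intersections that shrink to a
  point. Commutative monoids are general enough for Minkowski sums, whose zero is the singleton of
  0.\<close>

lemma interval_additive_sum_tagged_division:
  fixes m :: "real set \<Rightarrow> 'b::comm_monoid_add"
  assumes m: "interval_additive m" and m0: "\<And>a. a \<in> {0..1} \<Longrightarrow> m {a} = 0"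
    and ab: "0 \<le> a" "a \<le> b" "b \<le> 1" and p: "p tagged_division_of {a..b}"
  shows "(\<Sum>(x, K)\<in>p. m K) = m {a..b}"
proof -
  define g where "g S = (if S \<inter> {0..1} = {} then 0 else m (S \<inter> {0..1}))" for S
  have g: "operative_real (+) 0 g"
  proof
    show "g {u..v} = 0" if "v \<le> u" for u v
    proof (cases "{u..v} \<inter> {0..1} = {}")
      case False
      then have eq: "{u..v} \<inter> {0..1} = {u}" "u \<in> {0..1}" using that by auto
      have "g {u..v} = m ({u..v} \<inter> {0..1})" unfolding g_def using False by (rule if_not_P)
      also have "\<dots> = 0" unfolding eq(1) using eq(2) by (rule m0)
      finally show ?thesis .
    qed (simp add: g_def)
    show "g {u..w} + g {w..v} = g {u..v}" if "u < w" "w < v" for u v w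
    proof -
      have gI: "g {c..d} = (if max c 0 \<le> min d 1 then m {max c 0..min d 1} else 0)" for c d
        by (simp add: g_def Int_atLeastAtMost)
      consider "w < 0" | "w > 1" | "0 \<le> w" "w \<le> 1" by linarith
      then show ?thesis
      proof cases
        case 3
        then have "max u 0 \<le> w" "w \<le> min v 1" "max w 0 = w" "min w 1 = w" using that by auto
        then show ?thesis
          using interval_additiveD[OF m, of "max u 0" w "min v 1"] by (simp add: gI)
      next
        case 1
        then have "max w 0 = max u 0" "\<not> max u 0 \<le> min w 1" using that by auto
        then show ?thesis unfolding gI by (simp only: if_False add_0_left)
      next
        case 2
        then have "min w 1 = min v 1" "\<not> max w 0 \<le> min v 1" using that by auto
        then show ?thesis unfolding gI by (simp only: if_False add_0_right)
      qed
    qed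
  qed
  interpret operative_real "(+)" 0 g
    rewrites "comm_monoid_set.F (+) 0 = sum"
    by (rule g) (simp add: sum_def)
  have "(\<Sum>(x, K)\<in>p. m K) = (\<Sum>(x, K)\<in>p. g K)"
  proof (rule sum.cong[OF refl], clarify)
    fix x K assume "(x, K) \<in> p"
    from tagged_division_ofD(2,3)[OF p this] ab have "K \<inter> {0..1} = K" "K \<noteq> {}" by auto
    then show "m K = g K" by (simp add: g_def)
  qed
  also have "\<dots> = g {a..b}" using p by (rule tagged_division)
  also have "\<dots> = m {a..b}" using ab by (simp add: g_def Int_atLeastAtMost)
  finally show ?thesis .
qed

text \<open>The degenerate interval abuts itself, so its value satisfies \<open>K = K + K\<close>;
  doubling keeps points in \<open>K\<close>, and a nonzero point would make \<open>K\<close>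
  unbounded.\<close>

lemma multimeasure_singleton:
  fixes \<Phi> :: "real set \<Rightarrow> 'a::real_normed_vector set"
  assumes "interval_multimeasure \<Phi>" "a \<in> {0..1}"
  shows "\<Phi> {a} = {0}"
proof -
  let ?K = "\<Phi> {a}"
  have "{a..a} \<in> closed_subintervals" using assms(2) by (subst closed_subintervals_iff) auto
  then have K: "?K \<in> cwk" using assms(1) by (auto simp: interval_multimeasure_def)
  have KK: "?K = ?K + ?K"
    using interval_additiveD[of \<Phi> a a a] assms by (auto simp: interval_multimeasure_def)
  obtain M where M: "\<And>x. x \<in> ?K \<Longrightarrow> norm x \<le> M" using cwkD(5)[OF K] by (auto simp: bounded_iff)
  have "x = 0" if x: "x \<in> ?K" for x
  proof (rule ccontr)
    assume "x \<noteq> 0"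
    have *: "(2 ^ n) *\<^sub>R x \<in> ?K" for n
    proof (induction n)
      case (Suc n)
      have "(2 ^ Suc n) *\<^sub>R x = (2 ^ n) *\<^sub>R x + (2 ^ n) *\<^sub>R x" by (simp flip: scaleR_add_left)
      then show ?case using KK set_plus_intro[OF Suc Suc] by simp
    qed (use x in simp)
    obtain n where "M / norm x < 2 ^ n" using real_arch_pow[of 2 "M / norm x"] by auto
    then show False using M[OF *[of n]] \<open>x \<noteq> 0\<close> by (simp add: field_simps)
  qed
  then show ?thesis using cwkD(1)[OF K] by blast
qed

section \<open>Differentiation of variationally integrable multifunctions\<close>

text \<open>Passing between radii and open neighbourhoods gives access to the gauge integral. All
  tags lie in the unit interval, so the neighbourhood elsewhere can be \<open>UNIV\<close>.\<close>

lemma ex_fine_perron_iff: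
  "(\<exists>\<delta>. (\<forall>t\<in>{0..1}. \<delta> t > 0) \<and> (\<forall>p. fine_perron_partition \<delta> p \<longrightarrow> Q p)) \<longleftrightarrow>
   (\<exists>\<gamma>. gauge \<gamma> \<and> (\<forall>p. p tagged_division_of {0..1} \<longrightarrow> \<gamma> fine p \<longrightarrow> Q p))"
proof
  assume "\<exists>\<delta>. (\<forall>t\<in>{0..1}. \<delta> t > 0) \<and> (\<forall>p. fine_perron_partition \<delta> p \<longrightarrow> Q p)"
  then obtain \<delta> :: "real \<Rightarrow> real" where \<delta>: "\<And>t. t \<in> {0..1} \<Longrightarrow> \<delta> t > 0"
    and Q: "\<And>p. fine_perron_partition \<delta> p \<Longrightarrow> Q p" by blast
  define \<gamma> where "\<gamma> t = (if t \<in> {0..1} then {t - \<delta> t<..<t + \<delta> t} else UNIV)" for t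
  have "gauge \<gamma>" unfolding gauge_def \<gamma>_def using \<delta> by auto
  moreover have "Q p" if p: "p tagged_division_of {0..1}" "\<gamma> fine p" for p
  proof (rule Q)
    show "fine_perron_partition \<delta> p"
      unfolding fine_perron_partition_def fine_def
      using p tag_in_interval[OF p(1)] fineD[OF p(2)] by (fastforce simp: \<gamma>_def split: if_splits)
  qed
  ultimately show "\<exists>\<gamma>. gauge \<gamma> \<and> (\<forall>p. p tagged_division_of {0..1} \<longrightarrow> \<gamma> fine p \<longrightarrow> Q p)" by blast
next
  assume "\<exists>\<gamma>. gauge \<gamma> \<and> (\<forall>p. p tagged_division_of {0..1} \<longrightarrow> \<gamma> fine p \<longrightarrow> Q p)"
  then obtain \<gamma> where \<gamma>: "gauge \<gamma>"
    and Q: "\<And>p. p tagged_division_of {0..1} \<Longrightarrow> \<gamma> fine p \<Longrightarrow> Q p" by blast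
  have "\<exists>d>0. ball t d \<subseteq> \<gamma> t" for t
    using \<gamma> by (auto simp: gauge_def open_contains_ball)
  then obtain \<delta> where \<delta>: "\<And>t. \<delta> t > 0" "\<And>t. ball t (\<delta> t) \<subseteq> \<gamma> t" by metis
  have "Q p" if "fine_perron_partition \<delta> p" for p
  proof (rule Q)
    show "p tagged_division_of {0..1}" using that by (simp add: fine_perron_partition_def)
    show "\<gamma> fine p"
    proof (rule fineI)
      fix t K assume "(t, K) \<in> p"
      then have "K \<subseteq> {t - \<delta> t<..<t + \<delta> t}"
        using that by (auto simp: fine_perron_partition_def fine_def)
      also have "\<dots> = ball t (\<delta> t)" by (auto simp: ball_def dist_real_def)
      finally show "K \<subseteq> \<gamma> t" using \<delta>(2) by blast
    qed
  qed
  then show "\<exists>\<delta>. (\<forall>t\<in>{0..1}. \<delta> t > 0) \<and> (\<forall>p. fine_perron_partition \<delta> p \<longrightarrow> Q p)"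
    using \<delta>(1) by blast
qed

lemma tagged_divisionD01:
  assumes "p tagged_division_of {a..b}" "{a..b} \<subseteq> {0..1::real}" "(x, K) \<in> p"
  obtains c d where "K = {c..d}" "0 \<le> c" "c \<le> x" "x \<le> d" "d \<le> 1" "a \<le> c" "d \<le> b"
    "K \<in> closed_subintervals" "len K = d - c"
proof -
  from tagged_division_ofD(4)[OF assms(1,3)] obtain c d where K: "K = {c..d}" by (auto simp: box_real)
  have x: "x \<in> K" "K \<subseteq> {a..b}" using tagged_division_ofD(2,3)[OF assms(1,3)] by auto
  then have "c \<le> x" "x \<le> d" "a \<le> c" "d \<le> b" using K by auto
  moreover have "0 \<le> c" "d \<le> 1" using x K assms(2) by auto
  moreover from calculation have "K \<in> closed_subintervals" "len K = d - c"
    unfolding K closed_subintervals_iff by auto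
  ultimately show ?thesis by (intro that[OF K])
qed

text \<open>The rest of the unit interval is filled with fine tagged divisions, and nonnegative
  terms only increase the sum. This makes the variational bound available for the disjoint families
  of Vitali's theorem and for divisions of subintervals.\<close>

lemma sum_partial_division_less:
  fixes e :: "real \<Rightarrow> real set \<Rightarrow> real"
  assumes \<gamma>: "gauge \<gamma>"
    and less: "\<And>p. p tagged_division_of {0..1} \<Longrightarrow> \<gamma> fine p \<Longrightarrow> (\<Sum>(t, K)\<in>p. e t K) < \<epsilon>"
    and nonneg: "\<And>t K. t \<in> {0..1} \<Longrightarrow> K \<in> closed_subintervals \<Longrightarrow> 0 \<le> e t K"
    and p: "p tagged_partial_division_of {0..1}" "\<gamma> fine p"
  shows "(\<Sum>(t, K)\<in>p. e t K) < \<epsilon>"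
proof -
  note p' = tagged_partial_division_ofD[OF p(1)]
  have pd: "snd ` p division_of \<Union>(snd ` p)"
    using p(1) by (rule partial_division_of_tagged_division)
  have "\<Union>(snd ` p) \<subseteq> cbox 0 1" using p'(3) by fastforce
  then obtain q where q: "snd ` p \<subseteq> q" "q division_of cbox 0 (1::real)"
    using partial_division_extend_interval[OF pd] by blast
  note q' = division_ofD[OF q(2)]
  define r where "r = q - snd ` p"
  have fr: "finite r" using q'(1) by (simp add: r_def)
  have "\<forall>i\<in>r. \<exists>p. p tagged_division_of i \<and> \<gamma> fine p"
    using fine_division_exists[OF \<gamma>] q'(4) unfolding r_def by (metis DiffD1)
  moreover have "\<forall>i1\<in>r. \<forall>i2\<in>r. i1 \<noteq> i2 \<longrightarrow> interior i1 \<inter> interior i2 = {}"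
    using q'(5) by (auto simp: r_def)
  ultimately obtain p2 where p2: "p2 tagged_division_of (\<Union>r)" "\<gamma> fine p2"
    by (rule tagged_division_Union_exists[OF fr _ _ refl])
  have "p \<union> p2 tagged_division_of (\<Union>(snd ` p) \<union> \<Union>r)"
  proof (rule tagged_division_Un[OF tagged_partial_division_of_Union_self[OF p(1)] p2(1)])
    show "interior (\<Union>(snd ` p)) \<inter> interior (\<Union>r) = {}"
    proof (rule Int_interior_Union_intervals)
      show "finite r" "open (interior (\<Union>(snd ` p)))" "\<And>T. T \<in> r \<Longrightarrow> \<exists>a b. T = cbox a b"
        using fr q'(4) by (auto simp: r_def)
      fix T assume T: "T \<in> r"
      have "interior T \<inter> interior (\<Union>(snd ` p)) = {}"
      proof (rule Int_interior_Union_intervals)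
        show "finite (snd ` p)" using p'(1) by simp
        show "\<And>T. T \<in> snd ` p \<Longrightarrow> \<exists>a b. T = cbox a b" using p'(4) by auto
        fix S assume "S \<in> snd ` p"
        then show "interior T \<inter> interior S = {}" using T q(1) q'(5)[of T S] by (auto simp: r_def)
      qed simp
      then show "interior (\<Union>(snd ` p)) \<inter> interior T = {}" by blast
    qed
  qed
  moreover have "\<Union>(snd ` p) \<union> \<Union>r = \<Union>q" using q(1) unfolding r_def by blast
  then have "\<Union>(snd ` p) \<union> \<Union>r = {0..1}" using q'(6) by simp
  ultimately have un: "p \<union> p2 tagged_division_of {0..1}" by simp
  have "(\<Sum>(t, K)\<in>p. e t K) \<le> (\<Sum>(t, K)\<in>p \<union> p2. e t K)"
  proof (rule sum_mono2)
    show "finite (p \<union> p2)" using un by blast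
    fix z assume "z \<in> p \<union> p2 - p"
    then obtain t K where z: "z = (t, K)" "(t, K) \<in> p \<union> p2" by (cases z) auto
    obtain c d where "0 \<le> c" "c \<le> t" "t \<le> d" "d \<le> 1" "K \<in> closed_subintervals"
      using tagged_divisionD01[OF un _ z(2)] by blast
    then show "0 \<le> (case z of (t, K) \<Rightarrow> e t K)"
      using nonneg[of t K] z(1) by simp
  qed auto
  also have "\<dots> < \<epsilon>" using un fine_Un[OF p(2) p2(2)] by (rule less)
  finally show ?thesis .
qed

locale vH_multifunction =
  fixes \<Gamma> :: "real \<Rightarrow> 'a::banach set" and \<Phi> :: "real set \<Rightarrow> 'a set"
  assumes cwk: "t \<in> {0..1} \<Longrightarrow> \<Gamma> t \<in> cwk"
    and multimeasure: "interval_multimeasure \<Phi>"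
    and variational: "\<epsilon> > 0 \<Longrightarrow> \<exists>\<gamma>. gauge \<gamma> \<and> (\<forall>p. p tagged_division_of {0..1} \<longrightarrow> \<gamma> fine p \<longrightarrow>
      (\<Sum>(t, I)\<in>p. hausdorff_dist (\<Phi> I) ((*\<^sub>R) (len I) ` \<Gamma> t)) < \<epsilon>)"
begin

definition err :: "real \<Rightarrow> real set \<Rightarrow> real" where
  "err t I = hausdorff_dist (\<Phi> I) ((*\<^sub>R) (len I) ` \<Gamma> t)"

lemma nebd_\<Gamma>: "t \<in> {0..1} \<Longrightarrow> nebd (\<Gamma> t)"
  using cwk cwk_nebd by blast

lemma \<Phi>_cwk: "I \<in> closed_subintervals \<Longrightarrow> \<Phi> I \<in> cwk"
  using multimeasure by (auto simp: interval_multimeasure_def)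

lemma nebd_\<Phi>: "I \<in> closed_subintervals \<Longrightarrow> nebd (\<Phi> I)"
  using \<Phi>_cwk cwk_nebd by blast

lemma err_nonneg: "t \<in> {0..1} \<Longrightarrow> I \<in> closed_subintervals \<Longrightarrow> 0 \<le> err t I"
  unfolding err_def by (intro hausdorff_dist_nonneg nebd_scaleR nebd_\<Phi> nebd_\<Gamma>)

lemma variational_partial:
  assumes "\<epsilon> > 0"
  obtains \<gamma> where "gauge \<gamma>"
    "\<And>p. p tagged_partial_division_of {0..1} \<Longrightarrow> \<gamma> fine p \<Longrightarrow> (\<Sum>(t, I)\<in>p. err t I) < \<epsilon>"
proof -
  obtain \<gamma> where \<gamma>: "gauge \<gamma>"
    "\<And>p. p tagged_division_of {0..1} \<Longrightarrow> \<gamma> fine p \<Longrightarrow> (\<Sum>(t, I)\<in>p. err t I) < \<epsilon>"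
    using variational[OF assms] unfolding err_def by blast
  then show ?thesis
    using that[OF \<gamma>(1)] sum_partial_division_less[OF \<gamma> err_nonneg] by blast
qed

text \<open>A point of \<open>B \<eta>\<close> lies in arbitrarily short intervals whose error
  exceeds \<eta> times their length. By Vitali's theorem disjoint fine ones cover almost all of
  \<open>B \<eta>\<close>; finitely many of them have total error below \<open>\<eta> * e\<close>,
  so the total length is at most \<open>e\<close>.\<close>

lemma ae_derivative:
  obtains N where "negligible N"
    "\<And>t \<eta>. t \<in> {0..1} - N \<Longrightarrow> \<eta> > 0 \<Longrightarrow> \<exists>r>0. \<forall>a b. 0 \<le> a \<longrightarrow> a \<le> t \<longrightarrow> t \<le> b \<longrightarrow> b \<le> 1 \<longrightarrow>
       a < b \<longrightarrow> b - a < r \<longrightarrow> err t {a..b} \<le> \<eta> * (b - a)"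
proof -
  define B where "B \<eta> = {t \<in> {0..1}. \<forall>r>0. \<exists>a b. 0 \<le> a \<and> a \<le> t \<and> t \<le> b \<and> b \<le> 1 \<and>
       a < b \<and> b - a < r \<and> err t {a..b} > \<eta> * (b - a)}" for \<eta>
  have neg: "negligible (B \<eta>)" if \<eta>: "\<eta> > 0" for \<eta>
    unfolding negligible_outer_le
  proof (intro allI impI)
    fix e :: real assume e: "e > 0"
    obtain \<gamma> where \<gamma>: "gauge \<gamma>"
      "\<And>p. p tagged_partial_division_of {0..1} \<Longrightarrow> \<gamma> fine p \<Longrightarrow> (\<Sum>(t, I)\<in>p. err t I) < \<eta> * e"
      using variational_partial[of "\<eta> * e"] \<eta> e by auto
    \<comment> \<open>The tag is stored besides the end points, since it need not be the centre of
      the interval that the covering theorem sees as a ball.\<close>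
    define K where "K = {(t, a, b). 0 \<le> a \<and> a \<le> t \<and> t \<le> b \<and> b \<le> 1 \<and> a < b \<and>
      {a..b} \<subseteq> \<gamma> t \<and> err t {a..b} > \<eta> * (b - a)}"
    define mid where "mid = (\<lambda>(t::real, a, b). (a + b) / 2 :: real)"
    define rad where "rad = (\<lambda>(t::real, a, b). (b - a) / 2 :: real)"
    have cb: "cball (mid (t, a, b)) (rad (t, a, b)) = {a..b}" for t a b
      unfolding mid_def rad_def cball_eq_atLeastAtMost by (simp add: field_simps)
    obtain C where C: "countable C" "C \<subseteq> K"
      "pairwise (\<lambda>i j. disjnt (cball (mid i) (rad i)) (cball (mid j) (rad j))) C"
      "negligible (B \<eta> - (\<Union>i\<in>C. cball (mid i) (rad i)))"
    proof (rule Vitali_covering_theorem_cballs[of K rad "B \<eta>" mid])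
      show "0 < rad i" if "i \<in> K" for i using that by (auto simp: K_def rad_def)
      fix x d :: real assume x: "x \<in> B \<eta>" and d: "0 < d"
      obtain r where r: "r > 0" "ball x r \<subseteq> \<gamma> x"
        using \<gamma>(1) unfolding gauge_def open_contains_ball by blast
      have "min r d > 0" using r(1) d by simp
      then obtain a b where ab: "0 \<le> a" "a \<le> x" "x \<le> b" "b \<le> 1" "a < b" "b - a < min r d"
        "err x {a..b} > \<eta> * (b - a)" using x unfolding B_def by blast
      have "{a..b} \<subseteq> ball x r" using ab by (auto simp: dist_real_def)
      then have "(x, a, b) \<in> K" using ab r(2) by (auto simp: K_def)
      moreover have "x \<in> cball (mid (x, a, b)) (rad (x, a, b))" unfolding cb using ab by auto
      moreover have "rad (x, a, b) < d" using ab by (auto simp: rad_def)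
      ultimately show "\<exists>i. i \<in> K \<and> x \<in> cball (mid i) (rad i) \<and> rad i < d" by blast
    qed
    let ?I = "\<lambda>i. cball (mid i) (rad i)"
    have bound: "measure lebesgue (\<Union>i\<in>F. ?I i) \<le> e" if F: "F \<subseteq> C" "finite F" for F
    proof -
      define p where "p = (\<lambda>i. (fst i, ?I i)) ` F"
      have FK: "i \<in> K" if "i \<in> F" for i using that F C(2) by blast
      have dis: "?I i \<inter> ?I j = {}" if "i \<in> F" "j \<in> F" "i \<noteq> j" for i j
        using pairwiseD[OF C(3)] that F(1) unfolding disjnt_def by blast
      have ne: "?I i \<noteq> {}" if "i \<in> F" for i using FK[OF that] by (auto simp: K_def rad_def)
      have inj: "inj_on (\<lambda>i. (fst i, ?I i)) F"
        using dis ne by (intro inj_onI) (metis Int_absorb prod.inject)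
      have part: "p tagged_partial_division_of {0..1}"
        unfolding tagged_partial_division_of_def
      proof (intro conjI allI impI)
        show "finite p" using F(2) by (simp add: p_def)
      next
        fix x k assume "(x, k) \<in> p"
        then obtain a b where i: "(x, a, b) \<in> F" "k = {a..b}" by (auto simp: p_def cb)
        show "x \<in> k" "k \<subseteq> {0..1}" "\<exists>a b. k = cbox a b"
          using FK[OF i(1)] i(2) by (auto simp: K_def)
      next
        fix x1 k1 x2 k2 assume "(x1, k1) \<in> p \<and> (x2, k2) \<in> p \<and> (x1, k1) \<noteq> (x2, k2)"
        then obtain i j where "i \<in> F" "j \<in> F" "(x1, k1) = (fst i, ?I i)" "(x2, k2) = (fst j, ?I j)" "i \<noteq> j"
          unfolding p_def by blast
        then have ij: "i \<in> F" "j \<in> F" "k1 = ?I i" "k2 = ?I j" "i \<noteq> j" by simp_all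
        then show "interior k1 \<inter> interior k2 = {}"
          using dis[OF ij(1,2,5)] interior_subset by blast
      qed
      have fine: "\<gamma> fine p"
        by (rule fineI) (use FK in \<open>force simp: p_def K_def cb\<close>)
      have "\<eta> * measure lebesgue (\<Union>i\<in>F. ?I i) \<le> \<eta> * (\<Sum>i\<in>F. measure lebesgue (?I i))"
        using \<eta> F(2) by (intro mult_left_mono measure_UNION_le) auto
      also have "\<dots> \<le> (\<Sum>i\<in>F. err (fst i) (?I i))"
        unfolding sum_distrib_left
      proof (rule sum_mono)
        fix i assume i: "i \<in> F"
        obtain t a b where tab: "i = (t, a, b)" by (cases i) auto
        then show "\<eta> * measure lebesgue (?I i) \<le> err (fst i) (?I i)"
          using FK[OF i] by (auto simp: tab cb K_def)
      qed
      also have "\<dots> = (\<Sum>(t, I)\<in>p. err t I)"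
        unfolding p_def by (simp add: sum.reindex[OF inj])
      also have "\<dots> < \<eta> * e" using part fine by (rule \<gamma>(2))
      finally show ?thesis using \<eta> by simp
    qed
    have lm: "(\<Union>i\<in>C. ?I i) \<in> lmeasurable"
      by (rule fmeasurable_UN_bound[OF C(1) _ bound]) auto
    have le: "measure lebesgue (\<Union>i\<in>C. ?I i) \<le> e"
      by (rule measure_UN_bound[OF C(1) _ bound]) auto
    let ?T = "(\<Union>i\<in>C. ?I i) \<union> (B \<eta> - (\<Union>i\<in>C. ?I i))"
    have "?T \<in> lmeasurable"
      by (rule fmeasurable.Un[OF lm negligible_imp_measurable[OF C(4)]])
    moreover have "measure lebesgue ?T = measure lebesgue (\<Union>i\<in>C. ?I i)"
      by (rule measure_Un_null_set[OF fmeasurableD[OF lm] C(4)[unfolded negligible_iff_null_sets]])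
    ultimately show "\<exists>T. B \<eta> \<subseteq> T \<and> T \<in> lmeasurable \<and> measure lebesgue T \<le> e"
      using le by (intro exI[of _ ?T]) auto
  qed
  show ?thesis
  proof
    show "negligible (\<Union>n. B (1 / real (Suc n)))" by (intro negligible_Union_nat neg) simp
    fix t \<eta> :: real assume t: "t \<in> {0..1} - (\<Union>n. B (1 / real (Suc n)))" and \<eta>: "\<eta> > 0"
    then obtain n where n: "1 / real (Suc n) < \<eta>" using nat_approx_posE by blast
    from t have "t \<notin> B (1 / real (Suc n))" "t \<in> {0..1}" by blast+
    then have "\<exists>r>0. \<forall>a b. \<not> (0 \<le> a \<and> a \<le> t \<and> t \<le> b \<and> b \<le> 1 \<and>
       a < b \<and> b - a < r \<and> err t {a..b} > 1 / real (Suc n) * (b - a))"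
      unfolding B_def by blast
    then obtain r where r: "r > 0" "\<And>a b. 0 \<le> a \<Longrightarrow> a \<le> t \<Longrightarrow> t \<le> b \<Longrightarrow> b \<le> 1 \<Longrightarrow>
       a < b \<Longrightarrow> b - a < r \<Longrightarrow> err t {a..b} \<le> 1 / real (Suc n) * (b - a)"
      by (meson not_less)
    show "\<exists>r>0. \<forall>a b. 0 \<le> a \<longrightarrow> a \<le> t \<longrightarrow> t \<le> b \<longrightarrow> b \<le> 1 \<longrightarrow>
       a < b \<longrightarrow> b - a < r \<longrightarrow> err t {a..b} \<le> \<eta> * (b - a)"
    proof (intro exI[of _ r] conjI allI impI r(1))
      fix a b assume "0 \<le> a" "a \<le> t" "t \<le> b" "b \<le> 1" "a < b" "b - a < r"
      then have "err t {a..b} \<le> 1 / real (Suc n) * (b - a)" by (rule r(2))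
      also have "\<dots> \<le> \<eta> * (b - a)" using n \<open>a < b\<close> by (intro mult_right_mono) auto
      finally show "err t {a..b} \<le> \<eta> * (b - a)" .
    qed
  qed
qed

text \<open>Where \<Phi> has derivative \<open>\<Gamma> t\<close>, the sets \<open>C M k\<close>,
  rescaled values of \<Phi> on intervals of length \<open>1 / Suc M\<close>, approach
  \<open>\<Gamma> t\<close> along the intervals that contain \<open>t\<close>. There are only
  countably many of them, so \<open>i t\<close> can be the code of the first one within
  \<open>e/2\<close>; points with the same code have values within \<open>e\<close>.\<close>

lemma essentially_separable:
  assumes e: "e > 0"
  obtains N and i :: "real \<Rightarrow> nat" where "negligible N" "\<And>n. {t \<in> {0..1} - N. i t = n} \<in> sets lebesgue"
    "\<And>s t. s \<in> {0..1} - N \<Longrightarrow> t \<in> {0..1} - N \<Longrightarrow> i s = i t \<Longrightarrow> hausdorff_dist (\<Gamma> s) (\<Gamma> t) \<le> e"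
proof -
  obtain N0 where N0: "negligible N0"
    "\<And>t \<eta>. t \<in> {0..1} - N0 \<Longrightarrow> \<eta> > 0 \<Longrightarrow> \<exists>r>0. \<forall>a b. 0 \<le> a \<longrightarrow> a \<le> t \<longrightarrow> t \<le> b \<longrightarrow> b \<le> 1 \<longrightarrow>
       a < b \<longrightarrow> b - a < r \<longrightarrow> err t {a..b} \<le> \<eta> * (b - a)" using ae_derivative by blast
  \<comment> \<open>Excluding 1 keeps the index \<open>kk M t\<close> of the interval that contains
    \<open>t\<close> at most \<open>M\<close>.\<close>
  define N where "N = insert 1 N0"
  define D where "D = {0..1} - N"
  have negN: "negligible N" using N0(1) by (simp add: N_def)
  have D: "D \<in> sets lebesgue" unfolding D_def using negligible_imp_sets[OF negN] by auto
  have D01: "t \<in> {0..1}" "t < 1" "t \<in> {0..1} - N0" if "t \<in> D" for t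
    using that by (auto simp: D_def N_def less_le)
  define J where "J M k = {real k / real (Suc M) .. (real k + 1) / real (Suc M)}" for M k
  define C where "C M k = (*\<^sub>R) (real (Suc M)) ` \<Phi> (J M k)" for M k
  define kk where "kk M t = nat \<lfloor>real (Suc M) * t\<rfloor>" for M t
  have J: "J M k \<in> closed_subintervals" if "k \<le> M" for M k
    unfolding J_def closed_subintervals_iff using that by (auto simp: field_simps)
  have nebdC: "nebd (C M k)" if "k \<le> M" for M k
    unfolding C_def using J[OF that] nebd_\<Phi> nebd_scaleR by blast
  have kk: "kk M t \<le> M" "real (kk M t) \<le> real (Suc M) * t" "real (Suc M) * t \<le> real (kk M t) + 1"
    if t: "t \<in> D" for M t
  proof -
    have t0: "0 \<le> real (Suc M) * t" using D01[OF t] by auto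
    then have kr: "real (kk M t) = of_int \<lfloor>real (Suc M) * t\<rfloor>" unfolding kk_def by simp
    then show 1: "real (kk M t) \<le> real (Suc M) * t" "real (Suc M) * t \<le> real (kk M t) + 1" by linarith+
    have "real (Suc M) * t < real (Suc M)" using D01[OF t] by simp
    with 1 have "real (kk M t) < real (Suc M)" by linarith
    then show "kk M t \<le> M" by linarith
  qed
  have lim: "(\<lambda>M. hausdorff_dist (C M (kk M t)) (\<Gamma> t)) \<longlonglongrightarrow> 0" if t: "t \<in> D" for t
  proof (rule LIMSEQ_I)
    fix \<eta> :: real assume \<eta>: "\<eta> > 0"
    then obtain r where r: "r > 0" "\<And>a b. 0 \<le> a \<Longrightarrow> a \<le> t \<Longrightarrow> t \<le> b \<Longrightarrow> b \<le> 1 \<Longrightarrow>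
       a < b \<Longrightarrow> b - a < r \<Longrightarrow> err t {a..b} \<le> \<eta>/2 * (b - a)"
      using N0(2)[OF D01(3)[OF t], of "\<eta>/2"] by auto
    obtain M0 where M0: "1 / real (Suc M0) < r" using nat_approx_posE[OF r(1)] by blast
    have "norm (hausdorff_dist (C M (kk M t)) (\<Gamma> t) - 0) < \<eta>" if "M \<ge> M0" for M
    proof -
      let ?a = "real (kk M t) / real (Suc M)" and ?b = "(real (kk M t) + 1) / real (Suc M)"
      have ba: "?b - ?a = 1 / real (Suc M)" by (simp add: diff_divide_distrib[symmetric])
      have "1 / real (Suc M) \<le> 1 / real (Suc M0)" using that by (intro divide_left_mono) auto
      then have sm: "?b - ?a < r" using M0 ba by linarith
      have b1: "?b \<le> 1" using kk(1)[OF t, of M] by (simp add: field_simps)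
      have tt: "?a \<le> t" "t \<le> ?b" using kk(2,3)[OF t, of M] by (simp_all add: field_simps)
      have errJ: "err t {?a..?b} \<le> \<eta>/2 * (?b - ?a)"
        using sm b1 tt ba by (intro r(2)) (auto simp: divide_strict_right_mono)
      have mJ: "len (J M (kk M t)) = 1 / real (Suc M)"
        unfolding J_def using ba by (simp add: divide_right_mono)
      have le: "hausdorff_dist (\<Phi> (J M (kk M t))) ((*\<^sub>R) (1 / real (Suc M)) ` \<Gamma> t) \<le> \<eta>/2 * (1 / real (Suc M))"
        using errJ unfolding J_def[symmetric] err_def mJ ba .
      have G: "\<Gamma> t = (*\<^sub>R) (real (Suc M)) ` (*\<^sub>R) (1 / real (Suc M)) ` \<Gamma> t" by (simp add: image_image)
      have "hausdorff_dist (C M (kk M t)) (\<Gamma> t) \<le>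
          real (Suc M) * hausdorff_dist (\<Phi> (J M (kk M t))) ((*\<^sub>R) (1 / real (Suc M)) ` \<Gamma> t)"
        unfolding C_def
        by (subst G, rule hausdorff_dist_scaleR_le)
          (use D01[OF t] J[OF kk(1)[OF t]] in \<open>auto intro!: nebd_\<Phi> nebd_scaleR nebd_\<Gamma>\<close>)
      also have "\<dots> \<le> real (Suc M) * (\<eta>/2 * (1 / real (Suc M)))" by (rule mult_left_mono[OF le]) simp
      also have "\<dots> = \<eta>/2" by (simp del: of_nat_Suc)
      also have "\<dots> < \<eta>" using \<eta> by simp
      finally show ?thesis
        using hausdorff_dist_nonneg[OF nebdC[OF kk(1)[OF t]] nebd_\<Gamma>[OF D01(1)[OF t]], of M] by simp
    qed
    then show "\<exists>no. \<forall>n\<ge>no. norm (hausdorff_dist (C n (kk n t)) (\<Gamma> t) - 0) < \<eta>" by blast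
  qed
  have meas: "{t \<in> D. hausdorff_dist (\<Gamma> t) A < c} \<in> sets lebesgue" if A: "nebd A" for A c
  proof -
    have "(\<lambda>t. indicator D t * hausdorff_dist (\<Gamma> t) A) \<in> borel_measurable lebesgue"
    proof (rule borel_measurable_LIMSEQ_real)
      fix t show "(\<lambda>M. indicator D t * hausdorff_dist (C M (kk M t)) A)
         \<longlonglongrightarrow> indicator D t * hausdorff_dist (\<Gamma> t) A"
      proof (cases "t \<in> D")
        case True
        have "(\<lambda>M. hausdorff_dist (C M (kk M t)) A - hausdorff_dist (\<Gamma> t) A) \<longlonglongrightarrow> 0"
        proof (rule Lim_null_comparison[OF _ lim[OF True]], intro always_eventually allI)
          fix M
          have "nebd (C M (kk M t))" "nebd (\<Gamma> t)" using nebdC kk(1) True nebd_\<Gamma> D01 by blast+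
          then show "norm (hausdorff_dist (C M (kk M t)) A - hausdorff_dist (\<Gamma> t) A)
              \<le> hausdorff_dist (C M (kk M t)) (\<Gamma> t)"
            using hausdorff_dist_triangle[of "C M (kk M t)" "\<Gamma> t" A]
              hausdorff_dist_triangle[of "\<Gamma> t" "C M (kk M t)" A] A
            by (auto simp: hausdorff_dist_commute)
        qed
        then show ?thesis using True by (simp add: LIM_zero_iff)
      qed simp
    next
      fix M
      \<comment> \<open>A function of the integer \<open>kk M t\<close> alone is measurable,
        whatever its values; the distances to \<open>\<Gamma> t\<close> are limits of such
        functions.\<close>
      have "(\<lambda>t. kk M t) \<in> measurable borel (count_space UNIV)" unfolding kk_def by measurable
      then have "(\<lambda>t. kk M t) \<in> measurable lebesgue (count_space UNIV)"
        by (simp add: measurable_completion)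
      then have "(\<lambda>t. hausdorff_dist (C M (kk M t)) A) \<in> borel_measurable lebesgue"
        by (rule measurable_compose) simp
      then show "(\<lambda>t. indicator D t * hausdorff_dist (C M (kk M t)) A) \<in> borel_measurable lebesgue"
        using D by (intro borel_measurable_times borel_measurable_indicator) auto
    qed
    then have "{t \<in> space lebesgue. indicator D t * hausdorff_dist (\<Gamma> t) A < c} \<in> sets lebesgue"
      by (rule borel_measurable_less) simp
    then have "D \<inter> {t \<in> space lebesgue. indicator D t * hausdorff_dist (\<Gamma> t) A < c} \<in> sets lebesgue"
      using D by blast
    moreover have "D \<inter> {t \<in> space lebesgue. indicator D t * hausdorff_dist (\<Gamma> t) A < c} =
        {t \<in> D. hausdorff_dist (\<Gamma> t) A < c}" by auto
    ultimately show ?thesis by simp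
  qed
  define P where "P n t = (case prod_decode n of (M, k) \<Rightarrow> k \<le> M \<and> hausdorff_dist (\<Gamma> t) (C M k) < e/2)" for n t
  have exP: "\<exists>n. P n t" if t: "t \<in> D" for t
  proof -
    have "eventually (\<lambda>M. hausdorff_dist (C M (kk M t)) (\<Gamma> t) < e/2) sequentially"
      using order_tendstoD(2)[OF lim[OF t], of "e/2"] e by simp
    then obtain M where "hausdorff_dist (C M (kk M t)) (\<Gamma> t) < e/2"
      using eventually_happens by fastforce
    then have "P (prod_encode (M, kk M t)) t"
      using kk(1)[OF t] by (simp add: P_def hausdorff_dist_commute)
    then show ?thesis ..
  qed
  have measP: "{t \<in> D. P n t} \<in> sets lebesgue" for n
  proof -
    obtain M k where Mk: "prod_decode n = (M, k)" by (cases "prod_decode n")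
    show ?thesis
    proof (cases "k \<le> M")
      case True
      then have "{t \<in> D. P n t} = {t \<in> D. hausdorff_dist (\<Gamma> t) (C M k) < e/2}" by (simp add: P_def Mk)
      then show ?thesis using meas[OF nebdC[OF True], of "e/2"] by (simp only:)
    qed (simp add: P_def Mk)
  qed
  define i where "i t = (LEAST n. P n t)" for t
  show ?thesis
  proof (rule that[of N i])
    show "negligible N" by (rule negN)
    fix n
    have "{t \<in> {0..1} - N. i t = n} = {t \<in> D. P n t} - (\<Union>m<n. {t \<in> D. P m t})"
      unfolding D_def[symmetric]
    proof (intro set_eqI iffI)
      show "t \<in> {t \<in> D. P n t} - (\<Union>m<n. {t \<in> D. P m t})" if "t \<in> {t \<in> D. i t = n}" for t
      proof -
        from that have t: "t \<in> D" "n = (LEAST n. P n t)" by (simp_all add: i_def)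
        have "P n t" unfolding t(2) by (rule LeastI_ex[OF exP[OF t(1)]])
        moreover have "\<not> P m t" if "m < n" for m using that unfolding t(2) by (rule not_less_Least)
        ultimately show ?thesis using t(1) by simp
      qed
    next
      fix t assume "t \<in> {t \<in> D. P n t} - (\<Union>m<n. {t \<in> D. P m t})"
      then have "t \<in> D" "P n t" and "\<And>m. P m t \<Longrightarrow> n \<le> m"
        by (auto simp flip: not_less)
      then have "i t = n" unfolding i_def by (intro Least_equality) auto
      then show "t \<in> {t \<in> D. i t = n}" using \<open>t \<in> D\<close> by simp
    qed
    then show "{t \<in> {0..1} - N. i t = n} \<in> sets lebesgue" using measP by auto
  next
    fix s t assume s: "s \<in> {0..1} - N" and t: "t \<in> {0..1} - N" and eq: "i s = i t"
    show "hausdorff_dist (\<Gamma> s) (\<Gamma> t) \<le> e"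
    proof -
      have st: "s \<in> D" "t \<in> D" using s t by (auto simp: D_def)
      obtain M k where Mk: "prod_decode (i t) = (M, k)" by (cases "prod_decode (i t)")
      have "P (i t) s" "P (i t) t"
        using LeastI_ex[OF exP[OF st(1)]] LeastI_ex[OF exP[OF st(2)]] eq by (auto simp: i_def)
      then have *: "k \<le> M" "hausdorff_dist (\<Gamma> s) (C M k) < e/2" "hausdorff_dist (\<Gamma> t) (C M k) < e/2"
        by (auto simp: P_def Mk)
      then show ?thesis
        using hausdorff_dist_triangle[OF nebd_\<Gamma>[OF D01(1)[OF st(1)]] nebdC[OF *(1)] nebd_\<Gamma>[OF D01(1)[OF st(2)]]]
        by (simp add: hausdorff_dist_commute)
    qed
  qed
qed

end

section \<open>A selection nearly constant on countably many measurable pieces\<close>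

text \<open>For all \<open>e > 0\<close> this is approximation, off a null set, by functions with
  countably many values on measurable sets. It refers to \<open>d\<close> only, so set-valued maps
  are covered, and a maximum of two distances makes one partition serve both.\<close>

definition ess_const :: "real \<Rightarrow> (real \<Rightarrow> real \<Rightarrow> real) \<Rightarrow> bool" where
  "ess_const e d \<longleftrightarrow> (\<exists>N (i :: real \<Rightarrow> nat). negligible N \<and> (\<forall>n. {t \<in> {0..1} - N. i t = n} \<in> sets lebesgue) \<and>
     (\<forall>s\<in>{0..1} - N. \<forall>t\<in>{0..1} - N. i s = i t \<longrightarrow> d s t \<le> e))"

context vH_multifunction
begin

text \<open>An arbitrary selection need not respect the pieces of \<Gamma>. Here the approximation
  \<open>x k\<close> is constant on the classes of \<open>eqv k\<close>, because it is chosen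
  through representatives only; as the classes shrink, consecutive values differ by less than
  \<open>2 * h k\<close>, and the limit lies in \<open>\<Gamma> t\<close> because that set is
  closed.\<close>

lemma ex_separable_selection:
  obtains f where "\<And>t. t \<in> {0..1} \<Longrightarrow> f t \<in> \<Gamma> t"
    "\<And>e. e > 0 \<Longrightarrow> ess_const e (\<lambda>s t. max (hausdorff_dist (\<Gamma> s) (\<Gamma> t)) (norm (f s - f t)))"
proof -
  define h where "h k = (1/2 :: real) ^ k" for k :: nat
  have h0: "h k > 0" and hS: "h (Suc k) = h k / 2" for k by (auto simp: h_def)
  define Q where "Q k N i \<longleftrightarrow> negligible N \<and> (\<forall>n. {t \<in> {0..1} - N. i t = n} \<in> sets lebesgue) \<and>
    (\<forall>s\<in>{0..1} - N. \<forall>t\<in>{0..1} - N. i s = i t \<longrightarrow> hausdorff_dist (\<Gamma> s) (\<Gamma> t) \<le> h k)"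
    for k N and i :: "real \<Rightarrow> nat"
  have "\<exists>N i. Q k N i" for k
    unfolding Q_def by (rule essentially_separable[OF h0[of k]]) blast
  then obtain N i where Q: "\<And>k. Q k (N k) (i k)" by metis
  have N: "negligible (N k)" and im: "{t \<in> {0..1} - N k. i k t = n} \<in> sets lebesgue" for k n
    using Q[of k] by (simp_all add: Q_def)
  have id: "hausdorff_dist (\<Gamma> s) (\<Gamma> t) \<le> h k"
    if "s \<in> {0..1} - N k" "t \<in> {0..1} - N k" "i k s = i k t" for k s t
    using Q[of k] that unfolding Q_def by blast
  define D where "D = {0..1} - (\<Union>k. N k)"
  have D: "t \<in> {0..1} - N k" "t \<in> {0..1}" if "t \<in> D" for t k using that by (auto simp: D_def)
  have negN: "negligible (\<Union>k. N k)" by (intro negligible_Union_nat N)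
  have Dm: "D \<in> sets lebesgue" unfolding D_def using negligible_imp_sets[OF negN] by auto
  define eqv where "eqv k s t \<longleftrightarrow> (\<forall>j\<le>k. i j s = i j t)" for k s t
  have eqvS: "eqv k s t" if "eqv (Suc k) s t" for k s t using that by (auto simp: eqv_def)
  define r where "r k t = (SOME s. s \<in> D \<and> eqv k s t)" for k t
  have r: "r k t \<in> D" "eqv k (r k t) t" if "t \<in> D" for k t
    using someI[of "\<lambda>s. s \<in> D \<and> eqv k s t" t] that by (auto simp: r_def eqv_def)
  have r_eq: "r k s = r k t" if "eqv k s t" for k s t
  proof -
    have "(\<lambda>u. u \<in> D \<and> eqv k u s) = (\<lambda>u. u \<in> D \<and> eqv k u t)" using that by (auto simp: eqv_def)
    then show ?thesis by (simp add: r_def)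
  qed
  \<comment> \<open>Successive values come from sets at Hausdorff distance at most
    \<open>h k\<close>; asking for \<open>2 * h k\<close> leaves room for the strict
    inequality.\<close>
  define x where "x k t = rec_nat (SOME y. y \<in> \<Gamma> (r 0 t))
      (\<lambda>k y. SOME z. z \<in> \<Gamma> (r (Suc k) t) \<and> dist y z < 2 * h k) k" for k t
  have x_Suc: "x (Suc k) t = (SOME z. z \<in> \<Gamma> (r (Suc k) t) \<and> dist (x k t) z < 2 * h k)" for k t
    by (simp add: x_def)
  have hr: "hausdorff_dist (\<Gamma> (r k t)) (\<Gamma> (r (Suc k) t)) \<le> h k" if "t \<in> D" for k t
    using r[OF that, of k] r[OF that, of "Suc k"] by (intro id D) (auto simp: eqv_def)
  have nb: "nebd (\<Gamma> (r k t))" if "t \<in> D" for k t using nebd_\<Gamma> D(2) r(1) that by blast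
  have ex: "\<exists>z. z \<in> \<Gamma> (r (Suc k) t) \<and> dist y z < 2 * h k" if "t \<in> D" "y \<in> \<Gamma> (r k t)" for k t y
    using hausdorff_dist_ex[OF nb[OF that(1), of k] nb[OF that(1), of "Suc k"] that(2), of "2 * h k"]
      hr[OF that(1), of k] h0[of k] by auto
  have xr: "x k t \<in> \<Gamma> (r k t)" if t: "t \<in> D" for k t
  proof (induction k)
    case 0
    have "\<exists>y. y \<in> \<Gamma> (r 0 t)" using nb[OF t, of 0] by (auto simp: nebd_def)
    then show ?case using someI_ex by (simp add: x_def)
  next
    case (Suc k)
    show ?case unfolding x_Suc using someI_ex[OF ex[OF t Suc]] by simp
  qed
  have xd: "dist (x k t) (x (Suc k) t) < 2 * h k" if t: "t \<in> D" for k t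
    unfolding x_Suc using someI_ex[OF ex[OF t xr[OF t, of k]]] by simp
  have x_eq: "x k s = x k t" if "eqv k s t" for k s t
    using that
  proof (induction k)
    case 0
    then show ?case by (simp add: x_def r_eq)
  next
    case (Suc k)
    then show ?case by (simp add: x_Suc r_eq eqvS)
  qed
  \<comment> \<open>The geometric series in closed form:
    \<open>2 * h k = 4 * h k - 4 * h (Suc k)\<close>.\<close>
  have xx: "dist (x k t) (x (k + m) t) \<le> 4 * h k - 4 * h (k + m)" if t: "t \<in> D" for k m t
  proof (induction m)
    case (Suc m)
    have "dist (x k t) (x (k + Suc m) t) \<le> dist (x k t) (x (k + m) t) + dist (x (k + m) t) (x (Suc (k + m)) t)"
      by (simp add: dist_triangle)
    also have "\<dots> \<le> 4 * h k - 4 * h (k + m) + 2 * h (k + m)"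
      using Suc xd[OF t, of "k + m"] by simp
    finally show ?case by (simp add: hS)
  qed simp
  have xx': "dist (x k t) (x n t) \<le> 4 * h k" if "t \<in> D" "k \<le> n" for k n t
    using xx[OF that(1), of k "n - k"] that(2) h0[of n] by simp
  have small: "\<exists>k. c * h k < e" if "e > 0" "c > 0" for c e :: real
  proof -
    have "0 < e / c" using that by simp
    then obtain k where "(1/2 :: real) ^ k < e / c" using real_arch_pow_inv[of "e / c" "1/2"] by auto
    then show ?thesis using that by (auto simp: h_def field_simps)
  qed
  have conv: "convergent (\<lambda>k. x k t)" if t: "t \<in> D" for t
    unfolding convergent_eq_Cauchy[symmetric, unfolded convergent_def[symmetric]]
  proof (rule Cauchy_convergent, rule metric_CauchyI)
    fix e :: real assume "e > 0"
    then obtain k where k: "8 * h k < e" using small[of e 8] by auto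
    have "dist (x m t) (x n t) < e" if "m \<ge> k" "n \<ge> k" for m n
      using xx'[OF t that(1)] xx'[OF t that(2)] dist_triangle3[of "x m t" "x n t" "x k t"] k by simp
    then show "\<exists>M. \<forall>m\<ge>M. \<forall>n\<ge>M. dist (x m t) (x n t) < e" by blast
  qed
  define f where "f t = (if t \<in> D then lim (\<lambda>k. x k t) else SOME y. y \<in> \<Gamma> t)" for t
  have fx: "dist (x k t) (f t) \<le> 4 * h k" if t: "t \<in> D" for k t
  proof -
    have "(\<lambda>n. x n t) \<longlonglongrightarrow> f t" using conv[OF t] t by (simp add: f_def convergent_LIMSEQ_iff)
    then have "(\<lambda>n. dist (x k t) (x n t)) \<longlonglongrightarrow> dist (x k t) (f t)" by (intro tendsto_intros)
    then show ?thesis by (rule LIMSEQ_le_const2) (use xx'[OF t] in blast)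
  qed
  have f: "f t \<in> \<Gamma> t" if t01: "t \<in> {0..1}" for t
  proof (cases "t \<in> D")
    case True
    have "infdist (f t) (\<Gamma> t) \<le> 5 * h k" for k
    proof -
      have "infdist (x k t) (\<Gamma> t) \<le> hausdorff_dist (\<Gamma> (r k t)) (\<Gamma> t)"
        by (rule infdist_le_hausdorff_dist[OF nb[OF True] nebd_\<Gamma>[OF t01] xr[OF True]])
      also have "\<dots> \<le> h k" using r[OF True, of k] True by (intro id D) (auto simp: eqv_def)
      finally show ?thesis
        using infdist_triangle[of "f t" "\<Gamma> t" "x k t"] fx[OF True, of k] by (simp add: dist_commute)
    qed
    then have "\<not> infdist (f t) (\<Gamma> t) > 0" using small[of "infdist (f t) (\<Gamma> t)" 5] by (auto simp: not_le[symmetric])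
    then have "infdist (f t) (\<Gamma> t) = 0" using infdist_nonneg[of "f t" "\<Gamma> t"] by simp
    then show ?thesis
      using in_closed_iff_infdist_zero[of "\<Gamma> t" "f t"] cwkD(1,4)[OF cwk[OF t01]] by simp
  next
    case False
    have "\<exists>y. y \<in> \<Gamma> t" using nebd_\<Gamma>[OF t01] by (auto simp: nebd_def)
    then show ?thesis using False someI_ex by (simp add: f_def)
  qed
  show ?thesis
  proof (rule that[OF f])
    fix e :: real assume "e > 0"
    then obtain k where k: "8 * h k < e" using small[of e 8] by auto
    \<comment> \<open>Up to index \<open>k\<close> inclusive, as in \<open>eqv k\<close>. On such a
      class \<open>f\<close> stays within \<open>4 * h k\<close> of the common value of
      \<open>x k\<close>, whence \<open>8 * h k\<close>.\<close>
    define c where "c t = to_nat (map (\<lambda>j. i j t) [0..<Suc k])" for t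
    have c: "c s = c t \<longleftrightarrow> eqv k s t" for s t
      unfolding c_def eqv_def by (auto simp: map_eq_conv simp del: upt_Suc)
    show "ess_const e (\<lambda>s t. max (hausdorff_dist (\<Gamma> s) (\<Gamma> t)) (norm (f s - f t)))"
      unfolding ess_const_def D_def[symmetric]
    proof (intro exI[of _ "\<Union>k. N k"] exI[of _ c] conjI allI ballI impI negN, unfold D_def[symmetric])
      fix n
      show "{t \<in> D. c t = n} \<in> sets lebesgue"
      proof (cases "\<exists>t0\<in>D. c t0 = n")
        case True
        then obtain t0 where t0: "t0 \<in> D" "c t0 = n" by blast
        have "{t \<in> D. c t = n} = D \<inter> (\<Inter>j\<in>{..k}. {t \<in> {0..1} - N j. i j t = i j t0})"
          unfolding t0(2)[symmetric] c by (auto simp: eqv_def D_def)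
        also have "\<dots> \<in> sets lebesgue"
          using Dm im by (intro sets.Int sets.finite_INT) auto
        finally show ?thesis .
      next
        case False
        then have "{t \<in> D. c t = n} = {}" by blast
        then show ?thesis by (simp only: sets.empty_sets)
      qed
    next
      fix s t assume st: "s \<in> D" "t \<in> D" "c s = c t"
      then have eq: "eqv k s t" by (simp add: c)
      have "hausdorff_dist (\<Gamma> s) (\<Gamma> t) \<le> h k" using st eq by (intro id D) (auto simp: eqv_def)
      moreover have "norm (f s - f t) \<le> 8 * h k"
        using fx[OF st(1), of k] fx[OF st(2), of k] dist_triangle3[of "f s" "f t" "x k t"] x_eq[OF eq]
        by (simp add: dist_norm)
      ultimately show "max (hausdorff_dist (\<Gamma> s) (\<Gamma> t)) (norm (f s - f t)) \<le> e"
        using k h0[of k] by simp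
    qed
  qed
qed

end

section \<open>Riemann sums over tags outside a piece\<close>

text \<open>Nonoverlapping intervals carry parts of \<open>S\<close> that are disjoint up to null
  sets.\<close>

lemma sum_measure_Int_tagged_division_le:
  assumes p: "p tagged_division_of {0..1::real}" and S: "S \<in> lmeasurable"
    and sub: "q \<subseteq> p" "\<And>t I. (t, I) \<in> q \<Longrightarrow> A I \<in> sets lebesgue \<and> A I \<subseteq> I \<inter> S"
  shows "(\<Sum>(t, I)\<in>q. measure lebesgue (A I)) \<le> measure lebesgue S"
proof -
  have fq: "finite q" using sub(1) p by (meson finite_subset tagged_division_of_finite)
  have lm: "A (snd z) \<in> lmeasurable" if "z \<in> q" for z
  proof -
    obtain t I where z: "z = (t, I)" by (cases z)
    then have *: "A I \<in> sets lebesgue" "A I \<subseteq> I \<inter> S" using sub(2)[of t I] that by auto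
    then show ?thesis unfolding z using fmeasurable_Int_fmeasurable[OF S *(1)]
      by (metis inf.absorb_iff1 inf.boundedE snd_conv inf_commute)
  qed
  have "(\<Sum>(t, I)\<in>q. measure lebesgue (A I)) = (\<Sum>z\<in>q. measure lebesgue (A (snd z)))"
    by (simp add: case_prod_beta)
  also have "\<dots> = measure lebesgue (\<Union>((\<lambda>z. A (snd z)) ` q))"
  proof (rule measure_negligible_finite_Union_image[symmetric, OF fq lm])
    show "pairwise (\<lambda>y z. negligible (A (snd y) \<inter> A (snd z))) q"
    proof (rule pairwiseI)
      fix y z assume yz: "y \<in> q" "z \<in> q" "y \<noteq> z"
      obtain s J t I where eq: "y = (s, J)" "z = (t, I)" by (cases y, cases z)
      have mem: "(s, J) \<in> p" "(t, I) \<in> p" "(s, J) \<noteq> (t, I)" using yz sub(1) eq by auto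
      obtain a b c d where "J = {a..b}" "I = {c..d}"
        using tagged_divisionD01[OF p _ mem(1)] tagged_divisionD01[OF p _ mem(2)] by (metis order_refl)
      moreover have "interior J \<inter> interior I = {}" using tagged_division_ofD(5)[OF p mem] .
      ultimately have "negligible (J \<inter> I)" using negligible_Int_intervals by blast
      then show "negligible (A (snd y) \<inter> A (snd z))"
        using sub(2)[of s J] sub(2)[of t I] yz eq by (elim negligible_subset) auto
    qed
  qed
  also have "\<dots> \<le> measure lebesgue S"
  proof (rule measure_mono_fmeasurable)
    show "(\<Union>z\<in>q. A (snd z)) \<subseteq> S" using sub(2) by fastforce
    show "(\<Union>z\<in>q. A (snd z)) \<in> sets lebesgue" using lm fq by (intro sets.finite_UN) auto
  qed (rule S)
  finally show ?thesis .
qed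

text \<open>These are the Riemann sums of the indicator of \<open>E\<close>, whose gauge integral is
  the measure.\<close>

lemma ex_gauge_tags:
  assumes E: "E \<in> sets lebesgue" and "\<tau> > 0"
  obtains \<gamma> where "gauge \<gamma>" "\<And>q. q tagged_division_of {a..b::real} \<Longrightarrow> \<gamma> fine q \<Longrightarrow>
    \<bar>(\<Sum>(s, K)\<in>q. if s \<in> E then len K else 0) - measure lebesgue (E \<inter> {a..b})\<bar> < \<tau>"
proof -
  have "E \<inter> {a..b} \<in> lmeasurable"
    using fmeasurable_Int_fmeasurable[of "{a..b}" lebesgue E] E by (simp add: Int_commute)
  then have "(indicat_real (E \<inter> {a..b}) has_integral measure lebesgue (E \<inter> {a..b})) UNIV"
    by (simp add: lmeasurable_iff_has_integral)
  also have "indicat_real (E \<inter> {a..b}) = (\<lambda>x. if x \<in> {a..b} then indicat_real E x else 0)"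
    by (auto simp: indicator_def)
  finally have "(indicat_real E has_integral measure lebesgue (E \<inter> {a..b})) {a..b}"
    by (simp only: has_integral_restrict_UNIV)
  then have "(indicat_real E has_integral measure lebesgue (E \<inter> {a..b})) (cbox a b)" by simp
  from this[unfolded has_integral, rule_format, OF \<open>\<tau> > 0\<close>]
  obtain \<gamma> where \<gamma>: "gauge \<gamma>" "\<And>q. q tagged_division_of {a..b} \<Longrightarrow> \<gamma> fine q \<Longrightarrow>
     norm ((\<Sum>(s, K)\<in>q. len K *\<^sub>R indicat_real E s) - measure lebesgue (E \<inter> {a..b})) < \<tau>"
    by auto
  have eq: "(\<Sum>(s, K)\<in>q. len K *\<^sub>R indicat_real E s) =
      (\<Sum>(s, K)\<in>q. if s \<in> E then len K else 0)" for q :: "(real \<times> real set) set"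
    by (intro sum.cong) auto
  show ?thesis using that[OF \<gamma>(1)] \<gamma>(2) unfolding eq by simp
qed

lemma sum_if_neg:
  fixes F :: "'a \<Rightarrow> 'b \<Rightarrow> 'c::ab_group_add"
  shows "(\<Sum>(s, K)\<in>q. if P s then 0 else F s K) = (\<Sum>(s, K)\<in>q. F s K) - (\<Sum>(s, K)\<in>q. if P s then F s K else 0)"
  unfolding sum_subtractf[symmetric] by (intro sum.cong) auto

lemma sum_content_tagged_division:
  assumes "q tagged_division_of {a..b::real}" "a \<le> b"
  shows "(\<Sum>(s, K)\<in>q. len K) = b - a"
  using additive_content_tagged_division[of q a b] assms by (simp add: box_real)

context vH_multifunction
begin

lemma supp_additive:
  assumes \<phi>: "linear \<phi>" "\<And>y. \<bar>\<phi> y\<bar> \<le> norm y"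
    and "0 \<le> a" "a \<le> b" "b \<le> 1" "q tagged_division_of {a..b}"
  shows "(\<Sum>(s, K)\<in>q. supp \<phi> (\<Phi> K)) = supp \<phi> (\<Phi> {a..b})"
proof (rule interval_additive_sum_tagged_division)
  show "interval_additive (\<lambda>K. supp \<phi> (\<Phi> K))"
  proof (rule interval_additiveI)
    fix I J assume *: "I \<in> closed_subintervals" "J \<in> closed_subintervals"
      "interior I \<inter> interior J = {}" "I \<union> J \<in> closed_subintervals"
    then have "\<Phi> (I \<union> J) = \<Phi> I + \<Phi> J"
      using multimeasure by (auto simp: interval_multimeasure_def interval_additive_def)
    then show "supp \<phi> (\<Phi> (I \<union> J)) = supp \<phi> (\<Phi> I) + supp \<phi> (\<Phi> J)"
      using supp_plus[OF \<phi> nebd_\<Phi>[OF *(1)] nebd_\<Phi>[OF *(2)]] by simp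
  qed
  show "supp \<phi> (\<Phi> {x}) = 0" if "x \<in> {0..1}" for x
    using multimeasure_singleton[OF multimeasure that] linear_0[OF \<phi>(1)] by (simp add: supp_def)
qed (use assms in auto)

text \<open>The values of a selection whose tags lie outside \<open>E\<close> contribute little: a norming functional
  compares their sum with the support function of \<open>\<Phi> {a..b}\<close>, most of which is accounted for by the
  tags in \<open>E\<close>.\<close>

lemma norm_sum_outside_le:
  assumes I: "0 \<le> a" "a \<le> b" "b \<le> 1" and t: "t \<in> {0..1}" and q: "q tagged_division_of {a..b}"
    and E: "\<And>s. s \<in> {a..b} \<Longrightarrow> s \<in> E \<Longrightarrow> hausdorff_dist (\<Gamma> s) (\<Gamma> t) \<le> e" and e: "e \<ge> 0"
    and M: "\<And>x. x \<in> \<Gamma> t \<Longrightarrow> norm x \<le> M"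
    and g: "\<And>s K. (s, K) \<in> q \<Longrightarrow> g s K \<in> \<Gamma> s"
  shows "norm (rsum_off E q g)
    \<le> M * (\<Sum>(s, K)\<in>q. if s \<in> E then 0 else len K) + err t {a..b} + (\<Sum>(s, K)\<in>q. err s K) + e * (b - a)"
    (is "norm ?w \<le> M * ?\<beta> + _ + _ + _")
proof -
  obtain \<phi> where \<phi>': "bounded_linear \<phi>" and \<phi>b: "\<And>y. \<bar>\<phi> y\<bar> \<le> norm y" and \<phi>w: "\<phi> ?w = norm ?w"
    using ex_norming_functional[of ?w] by blast
  have \<phi>l: "linear \<phi>" using \<phi>' by (rule bounded_linear.linear)
  note \<phi> = \<phi>l \<phi>b
  define S where "S = supp \<phi> (\<Gamma> t)"
  define \<alpha> where "\<alpha> = (\<Sum>(s, K)\<in>q. if s \<in> E then len K else 0)"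
  have sumc: "(\<Sum>(s, K)\<in>q. len K) = b - a" by (rule sum_content_tagged_division[OF q I(2)])
  have \<beta>: "?\<beta> = b - a - \<alpha>" unfolding sum_if_neg sumc \<alpha>_def ..
  have \<alpha>0: "\<alpha> \<ge> 0" unfolding \<alpha>_def by (intro sum_nonneg) auto
  have \<beta>0: "?\<beta> \<ge> 0" by (intro sum_nonneg) auto
  have sub: "{a..b} \<subseteq> {0..1}" using I by auto
  have ab: "{a..b} \<in> closed_subintervals" using I by (simp add: closed_subintervals_iff)
  have "norm ?w = (\<Sum>(s, K)\<in>q. if s \<in> E then 0 else len K * \<phi> (g s K))"
    unfolding \<phi>w[symmetric] linear_sum[OF \<phi>(1)]
    by (intro sum.cong) (auto simp: linear_0[OF \<phi>(1)] linear_scale[OF \<phi>(1)])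
  \<comment> \<open>A tag outside \<open>E\<close> uses the upper bound
    \<open>supp \<phi> (\<Phi> K) + err s K\<close> for its value; a tag in \<open>E\<close> uses
    that the same quantity is at least \<open>(S - e) * len K\<close>. Thus the support functions
    can be summed over all of \<open>q\<close> by additivity.\<close>
  also have "\<dots> \<le> (\<Sum>(s, K)\<in>q. supp \<phi> (\<Phi> K) + err s K - (S - e) * (if s \<in> E then len K else 0))"
  proof (rule sum_mono, clarify)
    fix s K assume sK: "(s, K) \<in> q"
    obtain c d where cd: "K = {c..d}" "K \<in> closed_subintervals" "a \<le> c" "c \<le> s" "s \<le> d" "d \<le> b"
      using tagged_divisionD01[OF q sub sK] by metis
    then have s: "s \<in> {a..b}" "s \<in> {0..1}" using I by auto
    have c0: "len K \<ge> 0" by simp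
    have "len K * supp \<phi> (\<Gamma> s) \<le> supp \<phi> (\<Phi> K) + err s K"
      using supp_le_add_hausdorff_dist[OF \<phi> nebd_scaleR[OF nebd_\<Gamma>[OF s(2)]] nebd_\<Phi>[OF cd(2)], of "len K"]
        supp_scaleR[OF \<phi> c0 nebd_\<Gamma>[OF s(2)]]
      unfolding err_def by (simp add: hausdorff_dist_commute)
    moreover have "\<phi> (g s K) \<le> supp \<phi> (\<Gamma> s)"
      using le_supp[OF \<phi>(2) _ g[OF sK]] nebd_\<Gamma>[OF s(2)] by (simp add: nebd_def)
    then have "len K * \<phi> (g s K) \<le> len K * supp \<phi> (\<Gamma> s)"
      by (rule mult_left_mono) simp
    moreover have "(S - e) * len K \<le> len K * supp \<phi> (\<Gamma> s)" if "s \<in> E"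
    proof -
      have "S - e \<le> supp \<phi> (\<Gamma> s)"
        using supp_le_add_hausdorff_dist[OF \<phi> nebd_\<Gamma>[OF t] nebd_\<Gamma>[OF s(2)]] E[OF s(1) that]
        unfolding S_def by (simp add: hausdorff_dist_commute)
      then have "len K * (S - e) \<le> len K * supp \<phi> (\<Gamma> s)"
        by (rule mult_left_mono) simp
      then show ?thesis by (simp add: mult.commute)
    qed
    ultimately show "(if s \<in> E then 0 else len K * \<phi> (g s K))
        \<le> supp \<phi> (\<Phi> K) + err s K - (S - e) * (if s \<in> E then len K else 0)"
      by auto
  qed
  also have "\<dots> = supp \<phi> (\<Phi> {a..b}) + (\<Sum>(s, K)\<in>q. err s K) - (S - e) * \<alpha>"
    unfolding \<alpha>_def supp_additive[OF \<phi> I q, symmetric] sum_distrib_left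
    by (simp add: case_prod_beta sum.distrib sum_subtractf)
  also have "\<dots> \<le> (b - a) * S + err t {a..b} + (\<Sum>(s, K)\<in>q. err s K) - (S - e) * \<alpha>"
    using supp_le_add_hausdorff_dist[OF \<phi> nebd_\<Phi>[OF ab] nebd_scaleR[OF nebd_\<Gamma>[OF t]], of "b - a"]
      supp_scaleR[OF \<phi> _ nebd_\<Gamma>[OF t], of "b - a"] I
    unfolding err_def S_def by simp
  \<comment> \<open>Of \<open>S * (b - a)\<close> the tags in \<open>E\<close> have used
    \<open>S * \<alpha>\<close>; the rest is \<open>S\<close> times the length tagged
    outside.\<close>
  also have "\<dots> = S * ?\<beta> + err t {a..b} + (\<Sum>(s, K)\<in>q. err s K) + e * \<alpha>"
    unfolding \<beta> by (simp add: algebra_simps)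
  also have "\<dots> \<le> M * ?\<beta> + err t {a..b} + (\<Sum>(s, K)\<in>q. err s K) + e * (b - a)"
  proof -
    have "S \<le> M" unfolding S_def supp_def
      using nebd_\<Gamma>[OF t] M \<phi>(2) by (intro cSUP_least) (auto simp: nebd_def, meson abs_le_D1 order_trans)
    then have "S * ?\<beta> \<le> M * ?\<beta>" using \<beta>0 by (rule mult_right_mono)
    moreover have "e * \<alpha> \<le> e * (b - a)" using \<beta>0 \<beta> e by (intro mult_left_mono) auto
    ultimately show ?thesis by simp
  qed
  finally show ?thesis .
qed

end

text \<open>Instantiated twice: with the constructed selection of \<Gamma>, and with the selection 0
  of the translate \<open>G\<close>, where \<open>selection\<close> says that 0 lies in every
  value.\<close>

locale vH_selection = vH_multifunction +
  fixes f
  assumes selection: "t \<in> {0..1} \<Longrightarrow> f t \<in> \<Gamma> t"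
    and ess_const: "e > 0 \<Longrightarrow> ess_const e (\<lambda>s t. max (hausdorff_dist (\<Gamma> s) (\<Gamma> t)) (norm (f s - f t)))"
begin

text \<open>On the null set \<Gamma> has no regularity, yet every tag must belong to a class with a
  bound on the norms. The points of \<open>N\<close> are therefore sorted by their own bound,
  rounded up, and given odd indices, with \<open>E n\<close> empty. The other points keep their
  piece under an even index, where the bound at one point \<open>t0\<close> and the oscillation
  suffice.\<close>

lemma ex_pieces:
  assumes e: "e > 0"
  obtains k :: "real \<Rightarrow> nat" and E M where
    "\<And>n. E n \<in> sets lebesgue" "\<And>n. E n \<subseteq> {t \<in> {0..1}. k t = n}"
    "\<And>n. negligible ({t \<in> {0..1}. k t = n} - E n)"
    "\<And>t x. t \<in> {0..1} \<Longrightarrow> x \<in> \<Gamma> t \<Longrightarrow> norm x \<le> M (k t)" "\<And>n. M n \<ge> (0::real)"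
    "\<And>s t. t \<in> {0..1} \<Longrightarrow> s \<in> E (k t) \<Longrightarrow> hausdorff_dist (\<Gamma> s) (\<Gamma> t) \<le> e \<and> norm (f s - f t) \<le> e"
proof -
  obtain N and i :: "real \<Rightarrow> nat" where N: "negligible N" and im: "\<And>n. {t \<in> {0..1} - N. i t = n} \<in> sets lebesgue"
    and id: "\<And>s t. s \<in> {0..1} - N \<Longrightarrow> t \<in> {0..1} - N \<Longrightarrow> i s = i t \<Longrightarrow>
      hausdorff_dist (\<Gamma> s) (\<Gamma> t) \<le> e \<and> norm (f s - f t) \<le> e"
    using ess_const[OF e] unfolding ess_const_def max.bounded_iff by blast
  have "\<exists>B. \<forall>x\<in>\<Gamma> t. norm x \<le> B" if "t \<in> {0..1}" for t
    using nebd_\<Gamma>[OF that] by (auto simp: nebd_def bounded_iff)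
  then obtain B where B: "\<And>t x. t \<in> {0..1} \<Longrightarrow> x \<in> \<Gamma> t \<Longrightarrow> norm x \<le> B t" by metis
  define k where "k t = (if t \<in> N then 2 * nat \<lceil>B t\<rceil> + 1 else 2 * i t)" for t
  define E where "E n = (if even n then {t \<in> {0..1} - N. i t = n div 2} else {})" for n
  have k_odd: "odd (k t) \<longleftrightarrow> t \<in> N" for t by (simp add: k_def)
  have bd: "\<exists>M\<ge>0. \<forall>t\<in>{0..1}. k t = n \<longrightarrow> (\<forall>x\<in>\<Gamma> t. norm x \<le> M)" for n
  proof (cases "\<exists>t0\<in>{0..1}. k t0 = n")
    case True
    then obtain t0 where t0: "t0 \<in> {0..1}" "k t0 = n" by blast
    have "norm x \<le> max 0 (max (real n) (B t0 + e + 1))" if t: "t \<in> {0..1}" "k t = n" "x \<in> \<Gamma> t" for t x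
    proof (cases "t \<in> N")
      case True
      then have "B t \<le> real n" unfolding t(2)[symmetric] k_def by auto linarith
      then show ?thesis using B[OF t(1,3)] by simp
    next
      case False
      then have "t0 \<notin> N" "i t = i t0" using t(2) t0(2) k_odd[of t] k_odd[of t0] by (auto simp: k_def)
      then have "hausdorff_dist (\<Gamma> t) (\<Gamma> t0) < e + 1" using id[of t t0] t t0 False by force
      then obtain y where "y \<in> \<Gamma> t0" "dist x y < e + 1"
        using hausdorff_dist_ex[OF nebd_\<Gamma>[OF t(1)] nebd_\<Gamma>[OF t0(1)] t(3)] by blast
      then show ?thesis
        using B[OF t0(1)] norm_triangle_sub[of x y] unfolding dist_norm by force
    qed
    then show ?thesis by (intro exI[of _ "max 0 (max (real n) (B t0 + e + 1))"]) auto
  qed auto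
  then obtain M where M: "\<And>n. M n \<ge> 0" "\<And>n t x. t \<in> {0..1} \<Longrightarrow> k t = n \<Longrightarrow> x \<in> \<Gamma> t \<Longrightarrow> norm x \<le> M n"
    by metis
  show ?thesis
  proof (rule that[of E k M])
    show "E n \<in> sets lebesgue" for n using im by (auto simp: E_def)
    show "E n \<subseteq> {t \<in> {0..1}. k t = n}" for n by (auto simp: E_def k_def)
    have "{t \<in> {0..1}. k t = n} - E n \<subseteq> N" for n by (auto simp: E_def k_def)
    then show "negligible ({t \<in> {0..1}. k t = n} - E n)" for n using N negligible_subset by blast
    show "norm x \<le> M (k t)" if "t \<in> {0..1}" "x \<in> \<Gamma> t" for t x using M(2)[OF that(1) refl that(2)] .
    show "M n \<ge> 0" for n by (rule M(1))
    fix s t assume t: "t \<in> {0..1}" and s: "s \<in> E (k t)"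
    then have "s \<in> {0..1} - N" "t \<in> {0..1} - N" "i s = i t"
      by (auto simp: E_def k_def split: if_splits)
    then show "hausdorff_dist (\<Gamma> s) (\<Gamma> t) \<le> e \<and> norm (f s - f t) \<le> e" by (rule id)
  qed
qed

end

lemma tagged_division_imp_partial_superset:
  assumes "q tagged_division_of S" "S \<subseteq> T"
  shows "q tagged_partial_division_of T"
  using assms unfolding tagged_division_of_def tagged_partial_division_of_def by blast

context vH_selection
begin

text \<open>A limit statement at a fixed tagged interval: \<tau> absorbs the errors of the finer
  division \<open>q\<close>, so that \<beta> can depend on \<open>t\<close>, \<open>a\<close> and
  \<open>b\<close> only. In the second bound one \<beta> is meant for the tags outside
  \<open>F\<close>, the other for the oscillation of \<open>f\<close> on \<open>F\<close> together
  with the multiple of \<open>f t\<close> that belongs to the length tagged outside.\<close>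

definition osc_le :: "real set \<Rightarrow> real \<Rightarrow> real \<Rightarrow> real \<Rightarrow> real \<Rightarrow> bool" where
  "osc_le F \<beta> t a b \<longleftrightarrow> (\<forall>\<tau>>0. \<exists>\<rho>. gauge \<rho> \<and>
      (\<forall>q. q tagged_division_of {a..b} \<longrightarrow> \<rho> fine q \<longrightarrow>
        (\<forall>g. (\<forall>(s, K)\<in>q. g s K \<in> \<Gamma> s) \<longrightarrow>
          norm (rsum_off F q g) \<le> \<beta> + \<tau>) \<and>
        norm ((rsum q f) - (b - a) *\<^sub>R f t) \<le> 2 * \<beta> + \<tau>))"

lemma osc_le_outsideD:
  assumes "osc_le F \<beta> t a b" "\<tau> > 0"
  obtains \<rho> where "gauge \<rho>" "\<And>q g. q tagged_division_of {a..b} \<Longrightarrow> \<rho> fine q \<Longrightarrow> \<forall>(s, K)\<in>q. g s K \<in> \<Gamma> s \<Longrightarrow>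
          norm (rsum_off F q g) \<le> \<beta> + \<tau>"
  using assms unfolding osc_le_def by meson

lemma osc_le_selectionD:
  assumes "osc_le F \<beta> t a b" "\<tau> > 0"
  obtains \<rho> where "gauge \<rho>" "\<And>q. q tagged_division_of {a..b} \<Longrightarrow> \<rho> fine q \<Longrightarrow>
        norm ((rsum q f) - (b - a) *\<^sub>R f t) \<le> 2 * \<beta> + \<tau>"
  using assms unfolding osc_le_def by meson

text \<open>\<open>bnd\<close> collects what \<open>norm_sum_outside_le\<close> costs in the limit
  of fine divisions: the bound of the piece times the length outside it, the error of the interval,
  and the oscillation. The last two sum to at most \<open>2 * e\<close> over a division. For the
  first, the gauge keeps an interval tagged in \<open>T n\<close> inside an open set
  \<open>U n\<close> that exceeds \<open>E n\<close> by very little.\<close>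

lemma ex_oscillation_bound:
  assumes \<epsilon>: "\<epsilon> > 0"
  obtains E :: "real \<Rightarrow> real set" and bnd :: "real \<Rightarrow> real set \<Rightarrow> real" and \<gamma> where
    "gauge \<gamma>"
    "\<And>p. p tagged_division_of {0..1} \<Longrightarrow> \<gamma> fine p \<Longrightarrow> (\<Sum>(t, I)\<in>p. bnd t I) \<le> \<epsilon>"
    "\<And>t I. t \<in> {0..1} \<Longrightarrow> I \<in> closed_subintervals \<Longrightarrow> 0 \<le> bnd t I"
    "\<And>t. E t \<in> sets lebesgue"
    "\<And>s t. t \<in> {0..1} \<Longrightarrow> s \<in> E t \<Longrightarrow> s \<in> {0..1} \<and> hausdorff_dist (\<Gamma> s) (\<Gamma> t) \<le> \<epsilon>"
    "\<And>t a b. 0 \<le> a \<Longrightarrow> a \<le> t \<Longrightarrow> t \<le> b \<Longrightarrow> b \<le> 1 \<Longrightarrow> osc_le (E t) (bnd t {a..b}) t a b"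
proof -
  define e where "e = \<epsilon> / 3"
  have e: "e > 0" using \<epsilon> by (simp add: e_def)
  obtain k :: "real \<Rightarrow> nat" and E M where Em: "\<And>n. E n \<in> sets lebesgue"
    and Ek: "\<And>n. E n \<subseteq> {t \<in> {0..1}. k t = n}"
    and En: "\<And>n. negligible ({t \<in> {0..1}. k t = n} - E n)"
    and M: "\<And>t x. t \<in> {0..1} \<Longrightarrow> x \<in> \<Gamma> t \<Longrightarrow> norm x \<le> M (k t)" and M0: "\<And>n. M n \<ge> (0::real)"
    and osc: "\<And>s t. t \<in> {0..1} \<Longrightarrow> s \<in> E (k t) \<Longrightarrow> hausdorff_dist (\<Gamma> s) (\<Gamma> t) \<le> e \<and> norm (f s - f t) \<le> e"
    by (rule ex_pieces[OF e]) blast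
  define T where "T n = {t \<in> {0..1}. k t = n}" for n
  have TE: "T n = E n \<union> (T n - E n)" for n using Ek by (auto simp: T_def)
  have Tm: "T n \<in> sets lebesgue" for n
    using TE[of n] Em[of n] negligible_imp_sets[OF En[of n, folded T_def]] by (metis sets.Un)
  \<comment> \<open>The measures of \<open>U n - E n\<close> get multiplied by \<open>M n\<close>;
    with this choice the products are at most \<open>e / 2 ^ Suc n\<close> and sum to at most
    \<open>e\<close>. Adding 1 guards against \<open>M n = 0\<close>.\<close>
  define \<eta> where "\<eta> n = e * (1/2) ^ Suc n / (M n + 1)" for n
  have \<eta>0: "\<eta> n > 0" for n using e M0[of n] by (auto simp: \<eta>_def)
  have "\<exists>U. open U \<and> T n \<subseteq> U \<and> U - E n \<in> lmeasurable \<and> measure lebesgue (U - E n) \<le> \<eta> n" for n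
  proof -
    obtain U where U: "open U" "T n \<subseteq> U" "U - T n \<in> lmeasurable" "emeasure lebesgue (U - T n) < ennreal (\<eta> n)"
      using sets_lebesgue_outer_open[OF Tm \<eta>0] by metis
    have eq: "U - E n = (U - T n) \<union> (T n - E n)" using U(2) TE by blast
    have "measure lebesgue (U - E n) = measure lebesgue (U - T n)"
      unfolding eq by (rule measure_Un_null_set[OF fmeasurableD[OF U(3)]])
        (use En[of n] in \<open>simp add: T_def negligible_iff_null_sets\<close>)
    also have "\<dots> \<le> \<eta> n" using U(3,4) \<eta>0[of n] by (simp add: emeasure_eq_measure2 ennreal_less_iff)
    finally have "measure lebesgue (U - E n) \<le> \<eta> n" .
    moreover have "U - E n \<in> lmeasurable"
      unfolding eq by (rule fmeasurable.Un[OF U(3) negligible_imp_measurable[OF En[of n, folded T_def]]])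
    ultimately show ?thesis using U by blast
  qed
  then obtain U where U: "\<And>n. open (U n)" "\<And>n. T n \<subseteq> U n" "\<And>n. U n - E n \<in> lmeasurable"
    "\<And>n. measure lebesgue (U n - E n) \<le> \<eta> n" by metis
  obtain \<gamma>0 where \<gamma>0: "gauge \<gamma>0"
    "\<And>p. p tagged_partial_division_of {0..1} \<Longrightarrow> \<gamma>0 fine p \<Longrightarrow> (\<Sum>(t, I)\<in>p. err t I) < e"
    using variational_partial[OF e] by blast
  define \<gamma> where "\<gamma> t = \<gamma>0 t \<inter> (if t \<in> {0..1} then U (k t) else UNIV)" for t
  define bnd where "bnd t I = M (k t) * measure lebesgue (I - E (k t)) + err t I + e * len I" for t I
  show ?thesis
  proof (rule that[of \<gamma> bnd "\<lambda>t. E (k t)"])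
    show "gauge \<gamma>"
      using \<gamma>0(1) U(1) U(2) by (auto simp: gauge_def \<gamma>_def T_def)
    show "E (k t) \<in> sets lebesgue" for t by (rule Em)
    show "s \<in> {0..1} \<and> hausdorff_dist (\<Gamma> s) (\<Gamma> t) \<le> \<epsilon>" if "t \<in> {0..1}" "s \<in> E (k t)" for s t
      using osc[OF that] Ek[of "k t"] that e by (auto simp: e_def)
    show "0 \<le> bnd t I" if "t \<in> {0..1}" "I \<in> closed_subintervals" for t I
      unfolding bnd_def using err_nonneg[OF that] M0 e by (intro add_nonneg_nonneg mult_nonneg_nonneg) auto
  next
    fix p assume p: "p tagged_division_of {0..1}" "\<gamma> fine p"
    have fp: "finite p" using p(1) by blast
    define A where "A = (\<lambda>z. k (fst z)) ` p"
    \<comment> \<open>Intervals are grouped by the piece of their tag, since within a group the sets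
      \<open>I - E n\<close> are nonoverlapping parts of \<open>U n - E n\<close>.\<close>
    have "(\<Sum>(t, I)\<in>p. M (k t) * measure lebesgue (I - E (k t))) =
        (\<Sum>n\<in>A. \<Sum>(t, I)\<in>{z \<in> p. k (fst z) = n}. M (k t) * measure lebesgue (I - E (k t)))"
      by (rule sum.group[symmetric]) (use fp in \<open>auto simp: A_def\<close>)
    also have "\<dots> \<le> (\<Sum>n\<in>A. e * (1/2) ^ Suc n)"
    proof (rule sum_mono)
      fix n assume "n \<in> A"
      let ?q = "{z \<in> p. k (fst z) = n}"
      have "(\<Sum>(t, I)\<in>?q. M (k t) * measure lebesgue (I - E (k t))) = M n * (\<Sum>(t, I)\<in>?q. measure lebesgue (I - E n))"
        unfolding sum_distrib_left by (intro sum.cong) auto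
      also have "\<dots> \<le> M n * measure lebesgue (U n - E n)"
      proof (intro mult_left_mono M0 sum_measure_Int_tagged_division_le[OF p(1) U(3)])
        fix t I assume tI: "(t, I) \<in> ?q"
        then have tIp: "(t, I) \<in> p" "k t = n" by simp_all
        obtain c d where cd: "I = {c..d}"
          using tagged_divisionD01[OF p(1) order_refl tIp(1)] by metis
        have t01: "t \<in> {0..1}" by (rule tag_in_interval[OF p(1) tIp(1)])
        have "I \<subseteq> U n" using fineD[OF p(2) tIp(1)] t01 tIp(2) by (simp add: \<gamma>_def)
        then show "I - E n \<in> sets lebesgue \<and> I - E n \<subseteq> I \<inter> (U n - E n)" using Em cd by auto
      qed auto
      also have "\<dots> \<le> M n * \<eta> n" using U(4) M0 by (intro mult_left_mono)
      also have "\<dots> = (M n / (M n + 1)) * (e * (1/2) ^ Suc n)" by (simp add: \<eta>_def)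
      also have "\<dots> \<le> 1 * (e * (1/2) ^ Suc n)" using M0[of n] e by (intro mult_right_mono) auto
      finally show "(\<Sum>(t, I)\<in>?q. M (k t) * measure lebesgue (I - E (k t))) \<le> e * (1/2) ^ Suc n" by simp
    qed
    also have "\<dots> = e * (\<Sum>n\<in>A. (1/2) ^ Suc n)" by (simp add: sum_distrib_left)
    also have "\<dots> \<le> e * 1"
    proof (rule mult_left_mono)
      have "(\<Sum>n\<in>A. (1/2 :: real) ^ Suc n) \<le> (\<Sum>n. (1/2) ^ Suc n)"
        by (rule sum_le_suminf) (use fp sums_summable[OF power_half_series] in \<open>auto simp: A_def\<close>)
      then show "(\<Sum>n\<in>A. (1/2 :: real) ^ Suc n) \<le> 1" using sums_unique[OF power_half_series] by simp
    qed (use e in auto)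
    finally have 1: "(\<Sum>(t, I)\<in>p. M (k t) * measure lebesgue (I - E (k t))) \<le> e" by simp
    have 2: "(\<Sum>(t, I)\<in>p. err t I) < e"
    proof (rule \<gamma>0(2))
      show "p tagged_partial_division_of {0..1}" using p(1) by (simp add: tagged_division_of_def)
      show "\<gamma>0 fine p" using p(2) by (auto simp: fine_def \<gamma>_def)
    qed
    have 3: "(\<Sum>(t, I)\<in>p. e * len I) = e"
      using sum_content_tagged_division[OF p(1)]
      by (simp add: case_prod_beta sum_distrib_left[symmetric])
    show "(\<Sum>(t, I)\<in>p. bnd t I) \<le> \<epsilon>"
      using 1 2 3 unfolding bnd_def by (simp add: case_prod_beta sum.distrib e_def)
  next
    fix t a b :: real assume ab: "0 \<le> a" "a \<le> t" "t \<le> b" "b \<le> 1"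
    show "osc_le (E (k t)) (bnd t {a..b}) t a b"
      unfolding osc_le_def
    proof (intro allI impI)
      fix \<tau> :: real assume \<tau>: "\<tau> > 0"
      from ab have t: "t \<in> {0..1}" and a_le_b: "a \<le> b" by auto
      define m where "m = M (k t)"
      define F where "F = E (k t)"
      have m0: "m \<ge> 0" by (simp add: m_def M0)
      \<comment> \<open>Budget: \<open>\<tau>/4\<close> for the length tagged outside
        \<open>F\<close>, which is multiplied by \<open>m\<close>, and \<open>\<tau>/4\<close> for
        the errors on \<open>q\<close> give the \<open>\<tau>/2\<close> in \<open>main\<close>; the
        multiple of \<open>f t\<close> takes another \<open>\<tau>/4\<close>.\<close>
      obtain \<tau>' where \<tau>': "\<tau>' > 0" and m\<tau>': "m * \<tau>' \<le> \<tau> / 4"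
        using ex_small_factor[of "\<tau>/4" m] \<tau> by auto
      have cF: "- F \<in> sets lebesgue" unfolding F_def using Em[of "k t"] by (simp add: Compl_in_sets_lebesgue)
      obtain \<rho>1 where \<rho>1: "gauge \<rho>1" "\<And>q. q tagged_division_of {a..b} \<Longrightarrow> \<rho>1 fine q \<Longrightarrow>
        \<bar>(\<Sum>(s, K)\<in>q. if s \<in> - F then len K else 0) - measure lebesgue (- F \<inter> {a..b})\<bar> < \<tau>'"
        using ex_gauge_tags[OF cF \<tau>', of a b] by blast
      obtain \<rho>2 where \<rho>2: "gauge \<rho>2"
        "\<And>p. p tagged_partial_division_of {0..1} \<Longrightarrow> \<rho>2 fine p \<Longrightarrow> (\<Sum>(t, I)\<in>p. err t I) < \<tau>/4"
        using variational_partial[of "\<tau>/4"] \<tau> by auto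
      show "\<exists>\<rho>. gauge \<rho> \<and> (\<forall>q. q tagged_division_of {a..b} \<longrightarrow> \<rho> fine q \<longrightarrow>
          (\<forall>g. (\<forall>(s, K)\<in>q. g s K \<in> \<Gamma> s) \<longrightarrow>
            norm (rsum_off (E (k t)) q g) \<le> bnd t {a..b} + \<tau>) \<and>
          norm ((rsum q f) - (b - a) *\<^sub>R f t) \<le> 2 * bnd t {a..b} + \<tau>)"
        unfolding F_def[symmetric]
      proof (intro exI[of _ "\<lambda>x. \<rho>1 x \<inter> \<rho>2 x"] conjI gauge_Int \<rho>1(1) \<rho>2(1), intro allI impI)
        fix q assume q: "q tagged_division_of {a..b}" and fine: "(\<lambda>x. \<rho>1 x \<inter> \<rho>2 x) fine q"
        define \<beta> where "\<beta> = (\<Sum>(s, K)\<in>q. if s \<in> F then 0 else len K)"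
        have fineq: "\<rho>1 fine q" "\<rho>2 fine q" using fine by (simp_all add: fine_Int)
        have sub: "{a..b} \<subseteq> {0..1}" using ab by auto
        have \<beta>0: "\<beta> \<ge> 0" unfolding \<beta>_def by (intro sum_nonneg) auto
        have "(\<Sum>(s, K)\<in>q. if s \<in> - F then len K else 0) = \<beta>"
          unfolding \<beta>_def by (intro sum.cong) auto
        moreover have "- F \<inter> {a..b} = {a..b} - F" by auto
        ultimately have "\<beta> \<le> measure lebesgue ({a..b} - F) + \<tau>'"
          using \<rho>1(2)[OF q fineq(1)] by simp
        then have "m * \<beta> \<le> m * (measure lebesgue ({a..b} - F) + \<tau>')" using m0 by (rule mult_left_mono)
        then have m\<beta>: "m * \<beta> \<le> m * measure lebesgue ({a..b} - F) + \<tau>/4"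
          using m\<tau>' by (simp add: algebra_simps)
        have errq: "(\<Sum>(s, K)\<in>q. err s K) < \<tau>/4"
          by (rule \<rho>2(2)[OF tagged_division_imp_partial_superset[OF q sub] fineq(2)])
        have bnd: "bnd t {a..b} = m * measure lebesgue ({a..b} - F) + err t {a..b} + e * (b - a)"
          using a_le_b by (simp add: bnd_def m_def F_def)
        have main: "norm (rsum_off F q g) \<le> bnd t {a..b} + \<tau>/2"
          if g: "\<And>s K. (s, K) \<in> q \<Longrightarrow> g s K \<in> \<Gamma> s" for g
        proof -
          have "norm (rsum_off F q g) \<le>
            m * \<beta> + err t {a..b} + (\<Sum>(s, K)\<in>q. err s K) + e * (b - a)"
            unfolding \<beta>_def
            by (rule norm_sum_outside_le[OF ab(1) a_le_b ab(4) t q])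
              (use osc[OF t] e M[OF t] g in \<open>auto simp: F_def m_def\<close>)
          then show ?thesis using m\<beta> errq unfolding bnd by simp
        qed
        have "norm ((rsum q f) - (b - a) *\<^sub>R f t) \<le> 2 * bnd t {a..b} + \<tau>"
        proof -
          let ?w = "\<Sum>(s, K)\<in>q. if s \<in> F then 0 else len K *\<^sub>R f s"
          let ?v = "\<Sum>(s, K)\<in>q. if s \<in> F then len K *\<^sub>R (f s - f t) else 0"
          have a: "(b - a) *\<^sub>R f t = (\<Sum>(s, K)\<in>q. len K *\<^sub>R f t)"
            unfolding sum_content_tagged_division[OF q a_le_b, symmetric] scaleR_sum_left
            by (simp add: case_prod_beta)
          have b: "\<beta> *\<^sub>R f t = (\<Sum>(s, K)\<in>q. if s \<in> F then 0 else len K *\<^sub>R f t)"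
            unfolding \<beta>_def scaleR_sum_left by (intro sum.cong) auto
          have eq: "(rsum q f) - (b - a) *\<^sub>R f t = ?v + ?w - \<beta> *\<^sub>R f t"
            unfolding a b sum_subtractf[symmetric] sum.distrib[symmetric]
            by (intro sum.cong) (auto simp: scaleR_diff_right)
          have "norm ?v \<le> (\<Sum>(s, K)\<in>q. e * len K)"
          proof (rule order_trans[OF norm_sum sum_mono], clarify)
            fix s K assume "(s, K) \<in> q"
            have "len K * norm (f s - f t) \<le> len K * e" if "s \<in> F"
              using osc[OF t, of s] that by (intro mult_left_mono) (auto simp: F_def)
            then show "norm (if s \<in> F then len K *\<^sub>R (f s - f t) else 0) \<le> e * len K"
              using e by (simp add: mult.commute)
          qed
          also have "\<dots> = e * (b - a)"
            using sum_content_tagged_division[OF q a_le_b] by (simp add: case_prod_beta sum_distrib_left[symmetric])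
          finally have v: "norm ?v \<le> e * (b - a)" .
          have w: "norm ?w \<le> bnd t {a..b} + \<tau>/2"
            by (rule main) (use tag_in_interval[OF q] sub selection in blast)
          have "norm (\<beta> *\<^sub>R f t) \<le> \<beta> * m"
            using \<beta>0 M[OF t selection[OF t]] by (simp add: m_def mult_left_mono)
          then have b: "norm (\<beta> *\<^sub>R f t) \<le> m * measure lebesgue ({a..b} - F) + \<tau>/4"
            using m\<beta> by (simp add: mult.commute)
          have "err t {a..b} \<ge> 0" using ab t by (intro err_nonneg) (auto simp: closed_subintervals_iff)
          then have "e * (b - a) + m * measure lebesgue ({a..b} - F) \<le> bnd t {a..b}" unfolding bnd by simp
          moreover have "norm (?v + ?w - \<beta> *\<^sub>R f t) \<le> norm ?v + norm ?w + norm (\<beta> *\<^sub>R f t)"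
            by (rule order_trans[OF norm_triangle_ineq4]) (simp add: norm_triangle_ineq)
          ultimately show ?thesis unfolding eq using v w b \<tau> by linarith
        qed
        with main show "(\<forall>g. (\<forall>(s, K)\<in>q. g s K \<in> \<Gamma> s) \<longrightarrow>
            norm (rsum_off F q g) \<le> bnd t {a..b} + \<tau>) \<and>
          norm ((rsum q f) - (b - a) *\<^sub>R f t) \<le> 2 * bnd t {a..b} + \<tau>"
          using \<tau> by fastforce
      qed
    qed
  qed
qed

end

section \<open>Tagged divisions that refine a given one\<close>

lemma content_Int_additive:
  fixes c d :: real
  shows "interval_additive (\<lambda>I. len ({c..d} \<inter> I))"
proof (rule interval_additiveI)
  fix I J :: "real set" assume IJ: "I \<in> closed_subintervals" "J \<in> closed_subintervals" and "negligible (I \<inter> J)"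
  then have "negligible ({c..d} \<inter> I \<inter> ({c..d} \<inter> J))" by (elim negligible_subset) auto
  then have "len ({c..d} \<inter> I \<inter> ({c..d} \<inter> J)) = 0"
    using IJ by (subst measure_completion[symmetric]) (auto simp: closed_subintervals_def negligible_imp_measure0)
  moreover have fm: "{c..d} \<inter> I \<in> fmeasurable lborel" "{c..d} \<inter> J \<in> fmeasurable lborel"
    using IJ by (auto simp: closed_subintervals_def intro!: fmeasurable_compact)
  ultimately show "len ({c..d} \<inter> (I \<union> J)) = len ({c..d} \<inter> I) + len ({c..d} \<inter> J)"
    unfolding Int_Un_distrib measure_Un3[OF fm] by simp
qed

text \<open>A sufficiently fine tagged division is, up to cutting the intervals that straddle a division
  point of \<open>p\<close> (such intervals are tagged by that point), a refinement of \<open>p\<close>.\<close>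

lemma ex_gauge_refining:
  fixes p :: "(real \<times> real set) set"
  assumes p: "p tagged_division_of {0..1}" and \<rho>: "\<And>z. z \<in> p \<Longrightarrow> gauge (\<rho> z)"
  obtains \<eta> where "gauge \<eta>" "\<And>q. q tagged_division_of {0..1} \<Longrightarrow> \<eta> fine q \<Longrightarrow>
    \<exists>Q. (\<forall>z\<in>p. Q z tagged_division_of snd z \<and> \<rho> z fine Q z) \<and>
      (\<forall>f :: real \<Rightarrow> 'a::real_normed_vector. (rsum q f) =
         (\<Sum>z\<in>p. \<Sum>(s, K)\<in>Q z. len K *\<^sub>R f s))"
proof -
  have fp: "finite p" using p by blast
  have ivl: "\<exists>c d. snd z = {c..d} \<and> 0 \<le> c \<and> c \<le> d \<and> d \<le> 1" if "z \<in> p" for z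
    using tagged_divisionD01[OF p order_refl, of "fst z" "snd z"] that by (metis order_trans prod.collapse)
  \<comment> \<open>An interval that meets \<open>snd z\<close> cannot have its tag outside, as it
    would then lie in \<open>- snd z\<close>. Hence \<open>K \<inter> snd z\<close> keeps its tag
    and is fine for \<open>\<rho> z\<close>.\<close>
  define \<eta> where "\<eta> x = (\<Inter>z\<in>p. if x \<in> snd z then \<rho> z x else - snd z)" for x
  have "gauge \<eta>"
    unfolding gauge_def
  proof (intro allI conjI)
    fix x
    show "x \<in> \<eta> x" using \<rho> by (auto simp: \<eta>_def gauge_def)
    show "open (\<eta> x)"
      unfolding \<eta>_def
    proof (intro open_INT fp ballI)
      fix z assume z: "z \<in> p"
      obtain c d where "snd z = {c..d}" using ivl[OF z] by blast
      then show "open (if x \<in> snd z then \<rho> z x else - snd z)"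
        using \<rho>[OF z] by (auto simp: gauge_def)
    qed
  qed
  moreover have "\<exists>Q. (\<forall>z\<in>p. Q z tagged_division_of snd z \<and> \<rho> z fine Q z) \<and>
      (\<forall>f :: real \<Rightarrow> 'a. (rsum q f) =
         (\<Sum>z\<in>p. \<Sum>(s, K)\<in>Q z. len K *\<^sub>R f s))"
    if q: "q tagged_division_of {0..1}" and fine: "\<eta> fine q" for q
  proof -
    have fq: "finite q" using q by blast
    have tag: "s \<in> snd z" "K \<subseteq> \<rho> z s" if "(s, K) \<in> q" "z \<in> p" "K \<inter> snd z \<noteq> {}" for s K z
    proof -
      have K: "K \<subseteq> (if s \<in> snd z then \<rho> z s else - snd z)"
        using fineD[OF fine that(1)] that(2) unfolding \<eta>_def by blast
      with that(3) show "s \<in> snd z" by (auto split: if_splits)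
      with K show "K \<subseteq> \<rho> z s" by simp
    qed
    have ivq: "\<exists>c d. K = {c..d} \<and> 0 \<le> c \<and> c \<le> d \<and> d \<le> 1" if "(s, K) \<in> q" for s K
      using tagged_divisionD01[OF q order_refl that] by (metis order_trans)
    define P where "P z = {(s, K) \<in> q. K \<inter> snd z \<noteq> {}}" for z :: "real \<times> real set"
    define Q where "Q z = (\<lambda>(s, K). (s, K \<inter> snd z)) ` P z" for z :: "real \<times> real set"
    have fP: "finite (P z)" for z unfolding P_def by (rule finite_subset[OF _ fq]) auto
    have int0: "interior (K \<inter> A) \<inter> interior (K' \<inter> A) = {}"
      if "(s, K) \<in> q" "(s', K') \<in> q" "(s, K) \<noteq> (s', K')" for s K s' K' A
      using tagged_division_ofD(5)[OF q that] interior_mono[of "K \<inter> A" K] interior_mono[of "K' \<inter> A" K'] by blast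
    have Qdiv: "Q z tagged_division_of snd z" if z: "z \<in> p" for z
    proof (rule tagged_division_ofI)
      show "finite (Q z)" unfolding Q_def using fP by simp
      fix s L assume "(s, L) \<in> Q z"
      then obtain K where K: "(s, K) \<in> q" "K \<inter> snd z \<noteq> {}" "L = K \<inter> snd z" by (auto simp: Q_def P_def)
      show "s \<in> L" using tag(1)[OF K(1) z K(2)] tagged_division_ofD(2)[OF q K(1)] K(3) by blast
      show "L \<subseteq> snd z" using K(3) by blast
      obtain a b c d where "K = {a..b}" "snd z = {c..d}" using ivl[OF z] ivq[OF K(1)] by blast
      then show "\<exists>a b. L = cbox a b" unfolding K(3) by (auto simp: Int_atLeastAtMost box_real)
      fix s' L' assume "(s', L') \<in> Q z" and ne: "(s, L) \<noteq> (s', L')"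
      then obtain K' where K': "(s', K') \<in> q" "L' = K' \<inter> snd z" by (auto simp: Q_def P_def)
      with K ne show "interior L \<inter> interior L' = {}" using int0[OF K(1) K'(1)] by auto
    next
      show "\<Union>{L. \<exists>s. (s, L) \<in> Q z} = snd z"
      proof
        show "\<Union>{L. \<exists>s. (s, L) \<in> Q z} \<subseteq> snd z" by (auto simp: Q_def)
        show "snd z \<subseteq> \<Union>{L. \<exists>s. (s, L) \<in> Q z}"
        proof
          fix x assume x: "x \<in> snd z"
          then have "x \<in> {0..1}" using ivl[OF z] by auto
          then obtain s K where "(s, K) \<in> q" "x \<in> K" using tagged_division_ofD(6)[OF q] by blast
          then have "(s, K \<inter> snd z) \<in> Q z" "x \<in> K \<inter> snd z" using x by (force simp: Q_def P_def)+
          then show "x \<in> \<Union>{L. \<exists>s. (s, L) \<in> Q z}" by blast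
        qed
      qed
    qed
    have Qfine: "\<rho> z fine Q z" if z: "z \<in> p" for z
      by (rule fineI) (use tag(2)[OF _ z] in \<open>fastforce simp: Q_def P_def\<close>)
    have sum: "(rsum q f) = (\<Sum>z\<in>p. \<Sum>(s, K)\<in>Q z. len K *\<^sub>R f s)"
      for f :: "real \<Rightarrow> 'a"
    proof -
      have "(rsum (Q z) f) = (\<Sum>(s, K)\<in>q. len (K \<inter> snd z) *\<^sub>R f s)"
        if z: "z \<in> p" for z
      proof -
        have "(rsum (Q z) f) =
            (\<Sum>y\<in>P z. (case y of (s, K) \<Rightarrow> len (K \<inter> snd z) *\<^sub>R f s))"
          unfolding Q_def
        \<comment> \<open>Different entries of \<open>q\<close> can leave the same trace on
          \<open>snd z\<close> only if it is degenerate, and then it contributes 0.\<close>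
        proof (subst sum.reindex_nontrivial[OF fP])
          fix y y' assume y: "y \<in> P z" "y' \<in> P z" "y \<noteq> y'"
            and eq: "(\<lambda>(s, K). (s, K \<inter> snd z)) y = (\<lambda>(s, K). (s, K \<inter> snd z)) y'"
          obtain s K s' K' where yy: "y = (s, K)" "y' = (s', K')" by (cases y, cases y')
          have in_q: "(s, K) \<in> q" "(s', K') \<in> q" "(s, K) \<noteq> (s', K')" using y yy by (auto simp: P_def)
          have "K \<inter> snd z = K' \<inter> snd z" using eq yy by simp
          then have "interior (K \<inter> snd z) = {}"
            using int0[OF in_q, of "snd z"] by (simp only: Int_absorb)
          moreover obtain a b c d where "K = {a..b}" "snd z = {c..d}" using ivl[OF z] ivq[OF in_q(1)] by blast
          ultimately have "K \<inter> snd z = {max a c..min b d}" "min b d \<le> max a c"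
            by (simp_all add: Int_atLeastAtMost)
          then have "len (K \<inter> snd z) = 0" by (simp only: content_real_eq_0)
          then show "(case (\<lambda>(s, K). (s, K \<inter> snd z)) y of (s, K) \<Rightarrow> len K *\<^sub>R f s) = 0"
            by (simp add: yy)
        qed (simp add: case_prod_beta comp_def)
        also have "\<dots> = (\<Sum>(s, K)\<in>q. len (K \<inter> snd z) *\<^sub>R f s)"
          by (rule sum.mono_neutral_left) (use fq in \<open>auto simp: P_def\<close>)
        finally show ?thesis .
      qed
      then have "(\<Sum>z\<in>p. \<Sum>(s, K)\<in>Q z. len K *\<^sub>R f s) =
          (\<Sum>z\<in>p. \<Sum>(s, K)\<in>q. len (K \<inter> snd z) *\<^sub>R f s)" by (rule sum.cong[OF refl])
      also have "\<dots> = (\<Sum>y\<in>q. \<Sum>z\<in>p. len (snd y \<inter> snd z) *\<^sub>R f (fst y))"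
        unfolding case_prod_beta by (rule sum.swap)
      also have "\<dots> = (rsum q f)"
      proof (rule sum.cong[OF refl], clarify)
        fix s K assume sK: "(s, K) \<in> q"
        obtain c d where K: "K = {c..d}" "0 \<le> c" "c \<le> d" "d \<le> 1" using ivq[OF sK] by blast
        \<comment> \<open>\<open>p\<close> covers the unit interval without overlap, so the traces
          of \<open>K\<close> on its intervals add up to \<open>len K\<close>.\<close>
        have "(\<Sum>(t, I)\<in>p. len ({c..d} \<inter> I)) = len ({c..d} \<inter> {0..1})"
          by (rule interval_additive_sum_tagged_division[OF content_Int_additive _ _ _ _ p])
            (auto simp: Int_insert_right)
        also have "{c..d} \<inter> {0..1} = K" using K by auto
        finally show "(\<Sum>z\<in>p. len (snd (s, K) \<inter> snd z) *\<^sub>R f (fst (s, K))) = len K *\<^sub>R f s"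
          by (simp add: K(1) scaleR_sum_left[symmetric] case_prod_beta)
      qed
      finally show ?thesis ..
    qed
    show ?thesis using Qdiv Qfine sum by blast
  qed
  ultimately show ?thesis using that by blast
qed

section \<open>Integrability of the selection\<close>

context vH_selection
begin

text \<open>One fixed fine division \<open>p\<close> is the reference. A fine enough
  \<open>q\<close> refines it, and on each \<open>snd z\<close> its sum differs from the term of
  \<open>p\<close> by at most \<open>2 * bnd + \<tau>\<close>. With \<open>\<epsilon>/8\<close> for
  the sum of the bounds and for \<open>card p * \<tau>\<close>, all such sums lie within
  \<open>\<epsilon>/2\<close> of \<open>S\<close>.\<close>

lemma selection_integrable: "f integrable_on {0..1}"
proof -
  have "f integrable_on cbox 0 (1::real)"
    unfolding integrable_Cauchy
  proof (intro allI impI)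
    fix \<epsilon> :: real assume \<epsilon>: "\<epsilon> > 0"
    have pos: "\<epsilon>/8 > 0" using \<epsilon> by simp
  obtain E bnd \<gamma> where \<gamma>: "gauge \<gamma>"
      and bnd: "\<And>p. p tagged_division_of {0..1} \<Longrightarrow> \<gamma> fine p \<Longrightarrow> (\<Sum>(t, I)\<in>p. bnd t I) \<le> \<epsilon>/8"
      and osc: "\<And>t a b. 0 \<le> a \<Longrightarrow> a \<le> t \<Longrightarrow> t \<le> b \<Longrightarrow> b \<le> 1 \<Longrightarrow> osc_le (E t) (bnd t {a..b}) t a b"
    by (rule ex_oscillation_bound[OF pos]) blast
    obtain p where p: "p tagged_division_of {0..1}" "\<gamma> fine p"
      using fine_division_exists_real[OF \<gamma>] .
    have fp: "finite p" using p(1) by blast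
    obtain \<tau> where \<tau>: "\<tau> > 0" "real (card p) * \<tau> \<le> \<epsilon>/8"
      by (rule ex_small_factor[OF pos])
    define S where "S = (rsum p f)"
    have "\<exists>\<rho>. gauge \<rho> \<and> (\<forall>q. q tagged_division_of snd z \<longrightarrow> \<rho> fine q \<longrightarrow>
        norm ((rsum q f) - len (snd z) *\<^sub>R f (fst z)) \<le> 2 * bnd (fst z) (snd z) + \<tau>)"
      if z: "z \<in> p" for z
    proof -
      have "(fst z, snd z) \<in> p" using z by simp
      then obtain c d where "snd z = {c..d}" "0 \<le> c" "c \<le> fst z" "fst z \<le> d" "d \<le> 1" "len (snd z) = d - c"
        using tagged_divisionD01[OF p(1) order_refl] by metis
      with osc_le_selectionD[OF osc[OF this(2-5)] \<tau>(1)] show ?thesis by metis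
    qed
    then obtain \<rho> where \<rho>: "\<And>z. z \<in> p \<Longrightarrow> gauge (\<rho> z)"
      "\<And>z q. z \<in> p \<Longrightarrow> q tagged_division_of snd z \<Longrightarrow> \<rho> z fine q \<Longrightarrow>
        norm ((rsum q f) - len (snd z) *\<^sub>R f (fst z)) \<le> 2 * bnd (fst z) (snd z) + \<tau>"
      by metis
    define good where "good q Q \<longleftrightarrow> (\<forall>z\<in>p. Q z tagged_division_of snd z \<and> \<rho> z fine Q z) \<and>
      (\<forall>f :: real \<Rightarrow> 'a. (rsum q f) = (\<Sum>z\<in>p. \<Sum>(s, K)\<in>Q z. len K *\<^sub>R f s))"
      for q :: "(real \<times> real set) set" and Q
    obtain \<eta> where \<eta>: "gauge \<eta>" "\<And>q. q tagged_division_of {0..1} \<Longrightarrow> \<eta> fine q \<Longrightarrow> \<exists>Q. good q Q"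
    proof (rule ex_gauge_refining[OF p(1) \<rho>(1), where 'a = 'a], assumption, goal_cases)
      case (1 \<eta>)
      show ?case by (rule 1(1)[OF 1(2)]) (unfold good_def, rule 1(3))
    qed
    have near: "norm ((rsum q f) - S) < \<epsilon>/2"
      if q: "q tagged_division_of {0..1}" "\<eta> fine q" for q
    proof -
      obtain Q where Q: "good q Q" using \<eta>(2)[OF q] ..
      have "norm ((rsum q f) - S)
          = norm (\<Sum>z\<in>p. (rsum (Q z) f) - len (snd z) *\<^sub>R f (fst z))"
        using Q by (simp add: good_def S_def case_prod_beta sum_subtractf)
      also have "\<dots> \<le> (\<Sum>z\<in>p. 2 * bnd (fst z) (snd z) + \<tau>)"
        by (rule order_trans[OF norm_sum sum_mono]) (use Q \<rho>(2) in \<open>simp add: good_def\<close>)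
      also have "\<dots> = 2 * (\<Sum>(t, I)\<in>p. bnd t I) + card p * \<tau>"
        by (simp add: sum.distrib sum_distrib_left case_prod_beta)
      finally show ?thesis using bnd[OF p] \<tau>(2) \<epsilon> by simp
    qed
    show "\<exists>\<gamma>. gauge \<gamma> \<and> (\<forall>\<D>1 \<D>2. \<D>1 tagged_division_of cbox 0 1 \<and> \<gamma> fine \<D>1 \<and>
            \<D>2 tagged_division_of cbox 0 1 \<and> \<gamma> fine \<D>2 \<longrightarrow>
            norm ((\<Sum>(x,K)\<in>\<D>1. len K *\<^sub>R f x) - (\<Sum>(x,K)\<in>\<D>2. len K *\<^sub>R f x)) < \<epsilon>)"
    proof (rule exI[of _ \<eta>], rule conjI[OF \<eta>(1)], intro allI impI)
      fix q1 q2 assume "q1 tagged_division_of cbox 0 1 \<and> \<eta> fine q1 \<and> q2 tagged_division_of cbox 0 1 \<and> \<eta> fine q2"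
      then show "norm ((rsum q1 f) - (rsum q2 f)) < \<epsilon>"
        using norm_triangle_half_l[OF near[of q1], of "\<Sum>(x,K)\<in>q2. len K *\<^sub>R f x"] near[of q2]
        by simp
    qed
  qed
  then show ?thesis by simp
qed

lemma integral_interval_additive: "interval_additive (\<lambda>I. integral I f)"
proof (rule interval_additiveI)
  fix I J assume *: "I \<in> closed_subintervals" "J \<in> closed_subintervals" "negligible (I \<inter> J)"
  have "f integrable_on I" if "I \<in> closed_subintervals" for I
    using integrable_on_subinterval[OF selection_integrable] that by (force simp: closed_subintervals_def)
  with * show "integral (I \<union> J) f = integral I f + integral J f" by simp
qed

text \<open>On a fixed interval the divisions in \<open>osc_le\<close> can be made arbitrarily fine:
  the Riemann sum becomes the integral and \<tau> disappears, so \<open>2 * bnd\<close> bounds each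
  term.\<close>

lemma selection_variational:
  assumes \<epsilon>: "\<epsilon> > 0"
  shows "\<exists>\<gamma>. gauge \<gamma> \<and> (\<forall>p. p tagged_division_of {0..1} \<longrightarrow> \<gamma> fine p \<longrightarrow>
      (\<Sum>(t, I)\<in>p. norm (integral I f - len I *\<^sub>R f t)) < \<epsilon>)"
proof -
  have pos: "\<epsilon>/3 > 0" using \<epsilon> by simp
  obtain E bnd \<gamma> where \<gamma>: "gauge \<gamma>"
    and bnd: "\<And>p. p tagged_division_of {0..1} \<Longrightarrow> \<gamma> fine p \<Longrightarrow> (\<Sum>(t, I)\<in>p. bnd t I) \<le> \<epsilon>/3"
    and osc: "\<And>t a b. 0 \<le> a \<Longrightarrow> a \<le> t \<Longrightarrow> t \<le> b \<Longrightarrow> b \<le> 1 \<Longrightarrow> osc_le (E t) (bnd t {a..b}) t a b"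
    by (rule ex_oscillation_bound[OF pos]) blast
  have "(\<Sum>(t, I)\<in>p. norm (integral I f - len I *\<^sub>R f t)) < \<epsilon>"
    if p: "p tagged_division_of {0..1}" "\<gamma> fine p" for p
  proof -
    have "(\<Sum>(t, I)\<in>p. norm (integral I f - len I *\<^sub>R f t)) \<le> (\<Sum>(t, I)\<in>p. 2 * bnd t I)"
    proof (rule sum_mono, clarify)
      fix t I assume tI: "(t, I) \<in> p"
      obtain a b where ab: "I = {a..b}" "0 \<le> a" "a \<le> t" "t \<le> b" "b \<le> 1" "len I = b - a"
        using tagged_divisionD01[OF p(1) order_refl tI] by metis
      have "f integrable_on {a..b}"
        by (rule integrable_on_subinterval[OF selection_integrable]) (use ab in auto)
      then have hi: "(f has_integral integral I f) (cbox a b)" using ab by (simp add: integrable_integral)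
      show "norm (integral I f - len I *\<^sub>R f t) \<le> 2 * bnd t I"
      proof (rule field_le_epsilon)
        fix \<tau> :: real assume \<tau>: "\<tau> > 0"
        then have \<tau>2: "\<tau>/2 > 0" by simp
        obtain \<rho> where \<rho>: "gauge \<rho>" "\<And>q. q tagged_division_of {a..b} \<Longrightarrow> \<rho> fine q \<Longrightarrow>
          norm ((rsum q f) - (b - a) *\<^sub>R f t) \<le> 2 * bnd t {a..b} + \<tau>/2"
          using osc_le_selectionD[OF osc[OF ab(2-5)] \<tau>2] by blast
        obtain \<rho>' where \<rho>': "gauge \<rho>'" "\<And>q. q tagged_division_of {a..b} \<Longrightarrow> \<rho>' fine q \<Longrightarrow>
          norm ((rsum q f) - integral I f) < \<tau>/2"
          using hi[unfolded has_integral, rule_format, OF \<tau>2] by auto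
        obtain q where q: "q tagged_division_of {a..b}" "(\<lambda>x. \<rho> x \<inter> \<rho>' x) fine q"
          using fine_division_exists_real[OF gauge_Int[OF \<rho>(1) \<rho>'(1)]] .
        have "norm (integral I f - (b - a) *\<^sub>R f t) \<le>
          norm ((rsum q f) - (b - a) *\<^sub>R f t) +
          norm ((rsum q f) - integral I f)"
          by (rule order_trans[OF eq_refl norm_triangle_ineq4]) simp
        then show "norm (integral I f - len I *\<^sub>R f t) \<le> 2 * bnd t I + \<tau>"
          using \<rho>(2)[OF q(1)] \<rho>'(2)[OF q(1)] q(2) ab(1,6) unfolding fine_Int by auto
      qed
    qed
    also have "\<dots> = 2 * (\<Sum>(t, I)\<in>p. bnd t I)" by (simp add: sum_distrib_left case_prod_beta)
    also have "\<dots> < \<epsilon>" using bnd[OF p] \<epsilon> by simp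
    finally show ?thesis .
  qed
  with \<gamma> show ?thesis by blast
qed

lemma vH_integrable_selection: "vH_integrable f"
  unfolding vH_integrable_def ex_fine_perron_iff
  using integral_interval_additive selection_variational by blast

end

section \<open>Uniform smallness of the values outside a set where they are bounded\<close>

text \<open>Divisions of different members can share only entries with a degenerate interval, on
  which \<open>h\<close> vanishes.\<close>

lemma sum_tagged_Union:
  fixes h :: "real \<Rightarrow> real set \<Rightarrow> 'b::ab_group_add"
  assumes "finite \<I>" and div: "\<And>I. I \<in> \<I> \<Longrightarrow> pfn I tagged_division_of I"
    and dis: "\<And>I J. I \<in> \<I> \<Longrightarrow> J \<in> \<I> \<Longrightarrow> I \<noteq> J \<Longrightarrow> interior I \<inter> interior J = {}"
    and h: "\<And>s a. h s {a} = 0"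
  shows "(\<Sum>(s, K)\<in>\<Union>(pfn ` \<I>). h s K) = (\<Sum>I\<in>\<I>. \<Sum>(s, K)\<in>pfn I. h s K)"
  using assms(1) div dis
proof (induction \<I>)
  case (insert I \<I>)
  let ?A = "pfn I" and ?B = "\<Union>(pfn ` \<I>)"
  have fin: "finite ?A" "finite ?B" using insert by (auto intro: tagged_division_of_finite)
  have "(\<Sum>(s, K)\<in>?A \<inter> ?B. h s K) = 0"
  proof (rule sum.neutral, clarify)
    fix s K J assume K: "(s, K) \<in> pfn I" "(s, K) \<in> pfn J" "J \<in> \<I>"
    have I: "pfn I tagged_division_of I" and J: "pfn J tagged_division_of J" using insert.prems(1) K by auto
    obtain a b where ab: "K = {a..b}" using tagged_division_ofD(4)[OF I K(1)] by (auto simp: box_real)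
    have "s \<in> K" "K \<subseteq> I" "K \<subseteq> J"
      using tagged_division_ofD(2,3)[OF I K(1)] tagged_division_ofD(3)[OF J K(2)] by auto
    moreover have "interior I \<inter> interior J = {}" using insert.prems(2)[of I J] K insert.hyps by auto
    ultimately have "interior K = {}" using interior_mono by blast
    then have "K = {a}" using ab \<open>s \<in> K\<close> by auto
    then show "h s K = 0" using h by simp
  qed
  then have "(\<Sum>(s, K)\<in>?A \<union> ?B. h s K) = (\<Sum>(s, K)\<in>?A. h s K) + (\<Sum>(s, K)\<in>?B. h s K)"
    using sum.union_inter[OF fin, of "\<lambda>(s, K). h s K"] by simp
  moreover have "(\<Sum>(s, K)\<in>?B. h s K) = (\<Sum>I\<in>\<I>. \<Sum>(s, K)\<in>pfn I. h s K)"
    using insert by (intro insert.IH) auto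
  ultimately show ?case using insert.hyps by simp
qed simp

context vH_selection
begin

text \<open>\<open>B\<close> is the union of the pieces belonging to the finitely many intervals of
  one fine \<open>p\<close>, and \<Gamma> is bounded on each piece. The estimate on an interval
  leaves out only the tags in its own piece; those in the rest of \<open>B\<close> receive the value
  0, which \<open>zero\<close> admits. Only some fine \<open>q\<close> is promised because
  \<open>q\<close> is assembled from divisions of the intervals of \<open>p\<close>.\<close>

lemma uniformly_small_outside:
  assumes zero: "\<And>t. t \<in> {0..1} \<Longrightarrow> 0 \<in> \<Gamma> t" and \<epsilon>: "\<epsilon> > 0"
  obtains B M where "B \<in> sets lebesgue" "M \<ge> 0" "\<And>t x. t \<in> B \<Longrightarrow> x \<in> \<Gamma> t \<Longrightarrow> norm x \<le> M"
    "\<And>\<gamma>. gauge \<gamma> \<Longrightarrow> \<exists>q. q tagged_division_of {0..1} \<and> \<gamma> fine q \<and>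
       (\<forall>g. (\<forall>(s, K)\<in>q. g s K \<in> \<Gamma> s) \<longrightarrow>
          norm (rsum_off B q g) \<le> \<epsilon>)"
proof -
  have "\<epsilon>/2 > 0" using \<epsilon> by simp
  obtain E bnd \<gamma> where \<gamma>: "gauge \<gamma>"
    and bnd: "\<And>p. p tagged_division_of {0..1} \<Longrightarrow> \<gamma> fine p \<Longrightarrow> (\<Sum>(t, I)\<in>p. bnd t I) \<le> \<epsilon>/2"
    and bnd0: "\<And>t I. t \<in> {0..1} \<Longrightarrow> I \<in> closed_subintervals \<Longrightarrow> 0 \<le> bnd t I"
    and Em: "\<And>t. E t \<in> sets lebesgue"
    and Eosc: "\<And>s t. t \<in> {0..1} \<Longrightarrow> s \<in> E t \<Longrightarrow> s \<in> {0..1} \<and> hausdorff_dist (\<Gamma> s) (\<Gamma> t) \<le> \<epsilon>/2"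
    and osc: "\<And>t a b. 0 \<le> a \<Longrightarrow> a \<le> t \<Longrightarrow> t \<le> b \<Longrightarrow> b \<le> 1 \<Longrightarrow> osc_le (E t) (bnd t {a..b}) t a b"
    by (rule ex_oscillation_bound[OF \<open>\<epsilon>/2 > 0\<close>]) blast
  obtain p where p: "p tagged_division_of {0..1}" "\<gamma> fine p"
    using fine_division_exists_real[OF \<gamma>] .
  have fp: "finite p" using p(1) by blast
  define \<I> where "\<I> = snd ` p"
  have f\<I>: "finite \<I>" using fp by (simp add: \<I>_def)
  \<comment> \<open>An interval occurring with several tags is degenerate. One tag is kept, and the
    entries left out only lower the sum of the nonnegative \<open>bnd\<close>.\<close>
  have "\<exists>t. (t, I) \<in> p" if "I \<in> \<I>" for I using that by (auto simp: \<I>_def)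
  then obtain tg where tg: "\<And>I. I \<in> \<I> \<Longrightarrow> (tg I, I) \<in> p" by metis
  have ivl: "\<exists>a b. I = {a..b} \<and> 0 \<le> a \<and> a \<le> tg I \<and> tg I \<le> b \<and> b \<le> 1" "tg I \<in> {0..1}" "I \<in> closed_subintervals"
    if I: "I \<in> \<I>" for I
  proof -
    obtain a b where "I = {a..b}" "0 \<le> a" "a \<le> tg I" "tg I \<le> b" "b \<le> 1" "I \<in> closed_subintervals"
      using tagged_divisionD01[OF p(1) order_refl tg[OF I]] by metis
    then show "\<exists>a b. I = {a..b} \<and> 0 \<le> a \<and> a \<le> tg I \<and> tg I \<le> b \<and> b \<le> 1" "tg I \<in> {0..1}" "I \<in> closed_subintervals"
      by auto
  qed
  have dis: "interior I \<inter> interior J = {}" if "I \<in> \<I>" "J \<in> \<I>" "I \<noteq> J" for I J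
    using tagged_division_ofD(5)[OF p(1) tg[OF that(1)] tg[OF that(2)]] that(3) by blast
  define B where "B = (\<Union>I\<in>\<I>. E (tg I))"
  have Bm: "B \<in> sets lebesgue" unfolding B_def using f\<I> Em by (intro sets.finite_UN) auto
  have "\<exists>M. \<forall>s\<in>E t. \<forall>x\<in>\<Gamma> s. norm x \<le> M" if t: "t \<in> {0..1}" for t
  proof -
    obtain M where M: "\<And>x. x \<in> \<Gamma> t \<Longrightarrow> norm x \<le> M" using nebd_\<Gamma>[OF t] by (auto simp: nebd_def bounded_iff)
    have "norm x \<le> M + \<epsilon>" if s: "s \<in> E t" and x: "x \<in> \<Gamma> s" for s x
    proof -
      have s01: "s \<in> {0..1}" "hausdorff_dist (\<Gamma> s) (\<Gamma> t) < \<epsilon>" using Eosc[OF t s] \<epsilon> by auto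
      obtain y where "y \<in> \<Gamma> t" "dist x y < \<epsilon>"
        using hausdorff_dist_ex[OF nebd_\<Gamma>[OF s01(1)] nebd_\<Gamma>[OF t] x s01(2)] by blast
      then show ?thesis using M[of y] norm_triangle_sub[of x y] by (simp add: dist_norm)
    qed
    then show ?thesis by blast
  qed
  then obtain MM where MM: "\<And>t s x. t \<in> {0..1} \<Longrightarrow> s \<in> E t \<Longrightarrow> x \<in> \<Gamma> s \<Longrightarrow> norm x \<le> MM t" by metis
  define M where "M = (\<Sum>I\<in>\<I>. \<bar>MM (tg I)\<bar>)"
  obtain \<tau> where \<tau>: "\<tau> > 0" "real (card \<I>) * \<tau> \<le> \<epsilon>/2"
    by (rule ex_small_factor[OF \<open>\<epsilon>/2 > 0\<close>])
  define good where "good I \<rho> \<longleftrightarrow> gauge \<rho> \<and> (\<forall>q. q tagged_division_of I \<longrightarrow> \<rho> fine q \<longrightarrow> (\<forall>g. (\<forall>(s, K)\<in>q. g s K \<in> \<Gamma> s) \<longrightarrow>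
          norm (rsum_off (E (tg I)) q g) \<le> bnd (tg I) I + \<tau>))"
    for I \<rho>
  have "\<exists>\<rho>. good I \<rho>" if I: "I \<in> \<I>" for I
  proof -
    obtain a b where ab: "I = {a..b}" "0 \<le> a" "a \<le> tg I" "tg I \<le> b" "b \<le> 1" using ivl(1)[OF I] by blast
    have "osc_le (E (tg I)) (bnd (tg I) I) (tg I) a b" using osc[OF ab(2-5)] by (simp only: ab(1)[symmetric])
    then show ?thesis
    proof (rule osc_le_outsideD[OF _ \<tau>(1)], goal_cases)
      case (1 \<rho>)
      then show ?case unfolding good_def ab(1)[symmetric] by (intro exI[of _ \<rho>] conjI allI impI)
    qed
  qed
  then obtain \<rho> where good: "\<And>I. I \<in> \<I> \<Longrightarrow> good I (\<rho> I)" by metis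
  have \<rho>: "gauge (\<rho> I)" if "I \<in> \<I>" for I using good[OF that] by (simp add: good_def)
  have \<rho>_le: "norm (rsum_off (E (tg I)) q g) \<le> bnd (tg I) I + \<tau>"
    if "I \<in> \<I>" "q tagged_division_of I" "\<rho> I fine q" "\<forall>(s, K)\<in>q. g s K \<in> \<Gamma> s" for I q g
    using good[OF that(1), unfolded good_def, THEN conjunct2, rule_format, of q g] that(2-4) by simp
  show ?thesis
  proof (rule that[of B M])
    show "B \<in> sets lebesgue" by (rule Bm)
    show "M \<ge> 0" unfolding M_def by (intro sum_nonneg) auto
    fix t x assume "t \<in> B" and x: "x \<in> \<Gamma> t"
    then obtain I where I: "I \<in> \<I>" "t \<in> E (tg I)" by (auto simp: B_def)
    have "norm x \<le> \<bar>MM (tg I)\<bar>" using MM[OF ivl(2)[OF I(1)] I(2) x] by simp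
    also have "\<dots> \<le> M" unfolding M_def by (rule member_le_sum[OF I(1)]) (use f\<I> in auto)
    finally show "norm x \<le> M" .
  next
    fix \<gamma>' :: "real \<Rightarrow> real set" assume \<gamma>': "gauge \<gamma>'"
    have "\<exists>q. q tagged_division_of I \<and> (\<lambda>x. \<rho> I x \<inter> \<gamma>' x) fine q" if I: "I \<in> \<I>" for I
    proof -
      obtain a b where "I = {a..b}" using ivl(1)[OF I] by blast
      then show ?thesis using fine_division_exists_real[OF gauge_Int[OF \<rho>[OF I] \<gamma>']] by metis
    qed
    then obtain pfn where pfn: "\<And>I. I \<in> \<I> \<Longrightarrow> pfn I tagged_division_of I"
      "\<And>I. I \<in> \<I> \<Longrightarrow> \<rho> I fine pfn I" "\<And>I. I \<in> \<I> \<Longrightarrow> \<gamma>' fine pfn I" unfolding fine_Int by metis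
    let ?q = "\<Union>(pfn ` \<I>)"
    have "\<Union>\<I> = {0..1}" using tagged_division_ofD(6)[OF p(1)] by (force simp: \<I>_def)
    then have q: "?q tagged_division_of {0..1}"
      using tagged_division_Union[OF f\<I> pfn(1) dis] by simp
    have "\<gamma>' fine ?q" using pfn(3) by (intro fine_Union) auto
    moreover have "norm (rsum_off B ?q g) \<le> \<epsilon>"
      if g: "\<forall>(s, K)\<in>?q. g s K \<in> \<Gamma> s" for g
    proof -
      define g' where "g' s K = (if s \<in> B then 0 else g s K)" for s K
      have sm: "(rsum_off B (pfn I) g) =
          (rsum_off (E (tg I)) (pfn I) g')" if "I \<in> \<I>" for I
        by (intro sum.cong) (use that in \<open>auto simp: g'_def B_def\<close>)
      have g': "\<forall>(s, K)\<in>pfn I. g' s K \<in> \<Gamma> s" if I: "I \<in> \<I>" for I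
      proof clarify
        fix s K assume sK: "(s, K) \<in> pfn I"
        then have "(s, K) \<in> ?q" using I by blast
        then show "g' s K \<in> \<Gamma> s" using g zero[OF tag_in_interval[OF q]] by (auto simp: g'_def)
      qed
      have "norm (rsum_off B ?q g) =
          norm (\<Sum>I\<in>\<I>. \<Sum>(s, K)\<in>pfn I. if s \<in> B then 0 else len K *\<^sub>R g s K)"
        by (subst sum_tagged_Union[OF f\<I> pfn(1) dis]) auto
      also have "\<dots> \<le> (\<Sum>I\<in>\<I>. bnd (tg I) I + \<tau>)"
        by (rule order_trans[OF norm_sum sum_mono]) (use \<rho>_le[OF _ pfn(1,2) g'] sm in simp)
      also have "\<dots> = (\<Sum>I\<in>\<I>. bnd (tg I) I) + card \<I> * \<tau>" by (simp add: sum.distrib)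
      also have "(\<Sum>I\<in>\<I>. bnd (tg I) I) = (\<Sum>(t, I)\<in>(\<lambda>I. (tg I, I)) ` \<I>. bnd t I)"
        by (subst sum.reindex) (auto intro: inj_onI)
      also have "\<dots> \<le> (\<Sum>(t, I)\<in>p. bnd t I)"
      proof (rule sum_mono2[OF fp])
        fix z assume "z \<in> p - (\<lambda>I. (tg I, I)) ` \<I>"
        then have "(fst z, snd z) \<in> p" by simp
        then have "fst z \<in> {0..1}" "snd z \<in> closed_subintervals"
          using tag_in_interval[OF p(1)] tagged_divisionD01[OF p(1) order_refl] by blast+
        then show "0 \<le> (case z of (t, I) \<Rightarrow> bnd t I)" using bnd0 by (simp add: case_prod_beta)
      qed (use tg in auto)
      finally show ?thesis using bnd[OF p] \<tau>(2) by simp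
    qed
    ultimately show "\<exists>q. q tagged_division_of {0..1} \<and> \<gamma>' fine q \<and>
       (\<forall>g. (\<forall>(s, K)\<in>q. g s K \<in> \<Gamma> s) \<longrightarrow>
          norm (rsum_off B q g) \<le> \<epsilon>)"
      using q by blast
  qed
qed

end

section \<open>Unconditionally convergent series of sets\<close>

text \<open>Quantifying over all finite \<open>F\<close> beyond \<open>n0\<close>, with one
  \<open>n0\<close> for all selections \<open>y\<close>, makes the condition survive permutations
  and gives the uniformity that carries weak continuity over to infinite sums.\<close>

definition uniformly_small_tails :: "(nat \<Rightarrow> 'a::real_normed_vector set) \<Rightarrow> bool" where
  "uniformly_small_tails K \<longleftrightarrow> (\<forall>\<eta>>0. \<exists>n0. \<forall>F y. finite F \<longrightarrow> F \<subseteq> {n0..} \<longrightarrow> (\<forall>n. y n \<in> K n) \<longrightarrow> norm (sum y F) \<le> \<eta>)"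

text \<open>Beyond \<open>m0\<close> the permutation takes no value below \<open>n0\<close>.\<close>

lemma uniformly_small_tails_permute:
  assumes "uniformly_small_tails K" "bij \<pi>"
  shows "uniformly_small_tails (K \<circ> \<pi>)"
  unfolding uniformly_small_tails_def
proof (intro allI impI)
  fix \<eta> :: real assume "\<eta> > 0"
  then obtain n0 where n0: "\<And>F y. finite F \<Longrightarrow> F \<subseteq> {n0..} \<Longrightarrow> (\<And>n. y n \<in> K n) \<Longrightarrow> norm (sum y F) \<le> \<eta>"
    using assms(1) unfolding uniformly_small_tails_def by meson
  have inj: "inj \<pi>" and surj: "surj \<pi>" using assms(2) by (auto simp: bij_def)
  obtain m0 where m0: "\<And>m. m \<in> inv \<pi> ` {..<n0} \<Longrightarrow> m < m0"
    using finite_nat_set_iff_bounded[of "inv \<pi> ` {..<n0}"] by auto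
  have "norm (sum y F) \<le> \<eta>" if F: "finite F" "F \<subseteq> {m0..}" and y: "\<forall>n. y n \<in> (K \<circ> \<pi>) n" for F y
  proof -
    have "sum y F = sum (\<lambda>n. y (inv \<pi> n)) (\<pi> ` F)"
      using inj by (subst sum.reindex) (auto intro: inj_on_subset)
    also have "norm \<dots> \<le> \<eta>"
    proof (rule n0)
      show "finite (\<pi> ` F)" using F by simp
      show "\<pi> ` F \<subseteq> {n0..}"
      proof clarify
        fix m assume m: "m \<in> F"
        show "n0 \<le> \<pi> m"
        proof (rule ccontr)
          assume "\<not> n0 \<le> \<pi> m"
          then have "inv \<pi> (\<pi> m) \<in> inv \<pi> ` {..<n0}" by (intro imageI) simp
          then show False using m0[of m] m F(2) inj by auto
        qed
      qed
      show "y (inv \<pi> n) \<in> K n" for n using y surj_f_inv_f[OF surj, of n] by (metis comp_apply)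
    qed
    finally show ?thesis .
  qed
  then show "\<exists>n0. \<forall>F y. finite F \<longrightarrow> F \<subseteq> {n0..} \<longrightarrow> (\<forall>n. y n \<in> (K \<circ> \<pi>) n) \<longrightarrow> norm (sum y F) \<le> \<eta>"
    by blast
qed

definition series_set :: "(nat \<Rightarrow> 'a::real_normed_vector set) \<Rightarrow> 'a set" where
  "series_set K = suminf ` (PiE UNIV K)"

context
  fixes K :: "nat \<Rightarrow> 'a::banach set"
  assumes cwk: "\<And>n. K n \<in> cwk" and zero: "\<And>n. 0 \<in> K n" and tails: "uniformly_small_tails K"
begin

lemma summable_selection:
  assumes "\<And>n. y n \<in> K n"
  shows "summable y"
  unfolding summable_Cauchy
proof (intro allI impI)
  fix e :: real assume "e > 0"
  then have "e/2 > 0" by simp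
  then obtain n0 where n0: "\<And>F y. finite F \<Longrightarrow> F \<subseteq> {n0..} \<Longrightarrow> (\<And>n. y n \<in> K n) \<Longrightarrow> norm (sum y F) \<le> e/2"
    using tails unfolding uniformly_small_tails_def by meson
  have "norm (sum y {m..<n}) < e" if "m \<ge> n0" for m n
    using n0[of "{m..<n}" y] that assms \<open>e > 0\<close> by force
  then show "\<exists>N. \<forall>m\<ge>N. \<forall>n. norm (sum y {m..<n}) < e" by blast
qed

lemma suminf_tail_le:
  assumes "\<eta> > 0"
  obtains N where "\<And>y n. (\<And>i. y i \<in> K i) \<Longrightarrow> n \<ge> N \<Longrightarrow> norm (suminf y - sum y {..<n}) \<le> \<eta>"
proof -
  obtain n0 where n0: "\<And>F y. finite F \<Longrightarrow> F \<subseteq> {n0..} \<Longrightarrow> (\<And>n. y n \<in> K n) \<Longrightarrow> norm (sum y F) \<le> \<eta>"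
    using tails assms unfolding uniformly_small_tails_def by meson
  have "norm (suminf y - sum y {..<n}) \<le> \<eta>" if y: "\<And>i. y i \<in> K i" and n: "n \<ge> n0" for y n
  proof -
    have "(\<lambda>m. sum y {..<m}) \<longlonglongrightarrow> suminf y"
      using summable_selection[OF y] by (rule summable_LIMSEQ)
    then have "(\<lambda>m. norm (sum y {..<m} - sum y {..<n})) \<longlonglongrightarrow> norm (suminf y - sum y {..<n})"
      by (intro tendsto_intros)
    then show ?thesis
    proof (rule LIMSEQ_le_const2)
      have "norm (sum y {..<m} - sum y {..<n}) \<le> \<eta>" if "m \<ge> n" for m
      proof -
        have "sum y {..<m} - sum y {..<n} = sum y {n..<m}"
          using sum_diff_nat_ivl[of 0 n m y] that by (simp add: atLeast0LessThan)
        then show ?thesis using n0[of "{n..<m}" y] y n by (auto simp: subset_iff)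
      qed
      then show "\<exists>M. \<forall>m\<ge>M. norm (sum y {..<m} - sum y {..<n}) \<le> \<eta>" by blast
    qed
  qed
  then show ?thesis using that by blast
qed

lemma in_series_setI: "(\<And>n. y n \<in> K n) \<Longrightarrow> suminf y \<in> series_set K"
  unfolding series_set_def by (rule imageI) auto

lemma in_series_setE:
  assumes "x \<in> series_set K"
  obtains y where "\<And>n. y n \<in> K n" "x = suminf y"
  using assms unfolding series_set_def by (auto simp: PiE_iff)

lemma finite_sum_in_series_set:
  assumes "finite F" "\<And>n. n \<in> F \<Longrightarrow> y n \<in> K n"
  shows "sum y F \<in> series_set K"
proof -
  let ?y = "\<lambda>n. if n \<in> F then y n else 0"
  have "suminf ?y = sum ?y F" using assms(1) by (intro suminf_finite) auto
  also have "\<dots> = sum y F" by (intro sum.cong) auto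
  finally show ?thesis using in_series_setI[of ?y] assms(2) zero by force
qed

text \<open>Composed with a functional, \<open>suminf\<close> is on the product a uniform limit of
  finite sums of continuous coordinate functions: by \<open>suminf_tail_le\<close> the remainder is
  small for all selections at once.\<close>

lemma compactin_series_set: "compactin weak_topology (series_set K)"
proof -
  define T where "T = subtopology (product_topology (\<lambda>_ :: nat. weak_topology :: 'a topology) UNIV) (PiE UNIV K)"
  have top: "y n \<in> K n" if "y \<in> topspace T" for y n
    using that by (auto simp: T_def PiE_iff)
  have "compactin (product_topology (\<lambda>_ :: nat. weak_topology :: 'a topology) UNIV) (PiE UNIV K)"
    using cwkD(3)[OF cwk] by (simp add: compactin_PiE)
  then have "compactin T (PiE UNIV K)" by (simp add: T_def compactin_subtopology)
  moreover have "continuous_map T weak_topology suminf"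
  proof (rule continuous_map_into_weak)
    fix \<phi> :: "'a \<Rightarrow> real" assume \<phi>: "bounded_linear \<phi>"
    then interpret \<phi>: bounded_linear \<phi> .
    obtain C where C: "C > 0" "\<And>x. \<bar>\<phi> x\<bar> \<le> norm x * C" using \<phi>.pos_bounded by auto
    have "continuous_map T Met_TC.mtopology (\<phi> \<circ> suminf)"
    proof (rule Met_TC.continuous_map_uniform_limit[where F = sequentially and f = "\<lambda>n y. \<Sum>i<n. \<phi> (y i)"])
      have "continuous_map T euclidean (\<lambda>y. \<phi> (y i))" for i
      proof -
        have "continuous_map T weak_topology (\<lambda>y. y i)"
          unfolding T_def by (intro continuous_map_from_subtopology continuous_map_product_projection) simp
        from continuous_map_compose[OF this continuous_map_weak_functional[OF \<phi>]]
        show ?thesis by (simp add: comp_def)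
      qed
      then show "\<forall>\<^sub>F n in sequentially. continuous_map T Met_TC.mtopology (\<lambda>y. \<Sum>i<n. \<phi> (y i))"
        by (intro always_eventually allI) (auto intro!: continuous_map_sum)
      show "\<forall>\<^sub>F n in sequentially. \<forall>y\<in>topspace T. (\<phi> \<circ> suminf) y \<in> UNIV \<and> dist (\<Sum>i<n. \<phi> (y i)) ((\<phi> \<circ> suminf) y) < \<epsilon>"
        if \<epsilon>: "\<epsilon> > 0" for \<epsilon> :: real
      proof -
        have "\<epsilon> / (2 * C) > 0" using \<epsilon> C(1) by simp
        then obtain N where N: "\<And>y n. (\<And>i. y i \<in> K i) \<Longrightarrow> n \<ge> N \<Longrightarrow> norm (suminf y - sum y {..<n}) \<le> \<epsilon> / (2 * C)"
          using suminf_tail_le by blast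
        have "dist (\<Sum>i<n. \<phi> (y i)) ((\<phi> \<circ> suminf) y) < \<epsilon>" if "n \<ge> N" "y \<in> topspace T" for n y
        proof -
          have "dist (\<Sum>i<n. \<phi> (y i)) ((\<phi> \<circ> suminf) y) = \<bar>\<phi> (suminf y - sum y {..<n})\<bar>"
            by (simp add: \<phi>.diff \<phi>.sum dist_real_def abs_minus_commute)
          also have "\<dots> \<le> norm (suminf y - sum y {..<n}) * C" by (rule C(2))
          also have "\<dots> \<le> \<epsilon> / (2 * C) * C"
            using N[of y n] that top[OF that(2)] C(1) by (intro mult_right_mono) auto
          also have "\<dots> < \<epsilon>" using \<epsilon> C(1) by simp
          finally show ?thesis .
        qed
        then show ?thesis by (auto simp: eventually_sequentially)
      qed
    qed simp
    then show "continuous_map T euclidean (\<phi> \<circ> suminf)" by simp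
  qed
  ultimately show ?thesis unfolding series_set_def by (rule image_compactin)
qed

lemma series_set_cwk: "series_set K \<in> cwk"
proof -
  have "convex (series_set K)"
  proof (rule convexI)
    fix x x' and u v :: real assume uv: "0 \<le> u" "0 \<le> v" "u + v = 1"
      and "x \<in> series_set K" "x' \<in> series_set K"
    then obtain y y' where y: "\<And>n. y n \<in> K n" "x = suminf y" and y': "\<And>n. y' n \<in> K n" "x' = suminf y'"
      by (metis in_series_setE)
    have "u *\<^sub>R x + v *\<^sub>R x' = suminf (\<lambda>n. u *\<^sub>R y n + v *\<^sub>R y' n)"
      unfolding y(2) y'(2)
      using summable_selection[OF y(1)] summable_selection[OF y'(1)]
      by (simp add: suminf_add[symmetric] suminf_scaleR_right summable_scaleR_right)
    also have "\<dots> \<in> series_set K"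
      by (rule in_series_setI) (use convexD[OF cwkD(2)[OF cwk]] y y' uv in blast)
    finally show "u *\<^sub>R x + v *\<^sub>R x' \<in> series_set K" .
  qed
  moreover have "series_set K \<noteq> {}" using in_series_setI[of "\<lambda>_. 0"] zero by blast
  ultimately show ?thesis using compactin_series_set by (simp add: cwk_def)
qed

text \<open>Partial sums lie inside the series set, as a finite selection can be continued by zeros;
  conversely, a series differs from its own partial sum by a uniformly small tail.\<close>

lemma hausdorff_sums_series_set: "hausdorff_sums K (series_set K)"
  unfolding hausdorff_sums_def
proof (rule LIMSEQ_I)
  fix \<epsilon> :: real assume \<epsilon>: "\<epsilon> > 0"
  then have "\<epsilon>/2 > 0" by simp
  then obtain N where N: "\<And>y n. (\<And>i. y i \<in> K i) \<Longrightarrow> n \<ge> N \<Longrightarrow> norm (suminf y - sum y {..<n}) \<le> \<epsilon>/2"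
    using suminf_tail_le by blast
  have "norm (hausdorff_dist (\<Sum>i<n. K i) (series_set K) - 0) < \<epsilon>" if n: "n \<ge> N" for n
  proof -
    have alt: "(\<Sum>i<n. K i) = {sum y {..<n} |y. \<forall>i\<in>{..<n}. y i \<in> K i}"
      by (rule set_sum_alt) simp
    have sub: "(\<Sum>i<n. K i) \<subseteq> series_set K"
      unfolding alt using finite_sum_in_series_set[of "{..<n}"] by blast
    have "sum (\<lambda>_. 0) {..<n} \<in> (\<Sum>i<n. K i)" unfolding alt using zero by (intro CollectI exI[of _ "\<lambda>_. 0"]) auto
    then have ne: "(\<Sum>i<n. K i) \<noteq> {}" by blast
    have nb: "nebd (series_set K)" by (rule cwk_nebd[OF series_set_cwk])
    have "nebd (\<Sum>i<n. K i)" using ne sub nb unfolding nebd_def by (blast intro: bounded_subset)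
    then have "hausdorff_dist (\<Sum>i<n. K i) (series_set K) \<ge> 0" using nb by (rule hausdorff_dist_nonneg)
    moreover have "hausdorff_dist (\<Sum>i<n. K i) (series_set K) \<le> \<epsilon>/2"
    proof (rule hausdorff_dist_leI_ex)
      show "(\<Sum>i<n. K i) \<noteq> {}" by (rule ne)
      show "series_set K \<noteq> {}" using nb by (simp add: nebd_def)
      show "\<exists>b\<in>series_set K. dist a b \<le> \<epsilon>/2" if "a \<in> (\<Sum>i<n. K i)" for a
        using sub that \<epsilon> by (intro bexI[of _ a]) auto
      fix b assume "b \<in> series_set K"
      then obtain y where y: "\<And>i. y i \<in> K i" "b = suminf y" using in_series_setE by blast
      have "sum y {..<n} \<in> (\<Sum>i<n. K i)" unfolding alt using y(1) by blast
      moreover have "dist (sum y {..<n}) b \<le> \<epsilon>/2"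
        using N[OF y(1) n] y(2) by (simp add: dist_norm norm_minus_commute)
      ultimately show "\<exists>a\<in>\<Sum>i<n. K i. dist a b \<le> \<epsilon>/2" by blast
    qed
    ultimately show ?thesis using \<epsilon> by simp
  qed
  then show "\<exists>no. \<forall>n\<ge>no. norm (hausdorff_dist (\<Sum>i<n. K i) (series_set K) - 0) < \<epsilon>" by blast
qed

end

lemma unconditionally_convergentI:
  fixes K :: "nat \<Rightarrow> 'a::banach set"
  assumes "\<And>n. K n \<in> cwk" "\<And>n. 0 \<in> K n" "uniformly_small_tails K"
  shows "unconditionally_convergent K"
  unfolding unconditionally_convergent_def
proof (intro allI impI)
  fix \<pi> :: "nat \<Rightarrow> nat" assume "bij \<pi>"
  with assms(3) have tails: "uniformly_small_tails (K \<circ> \<pi>)" by (rule uniformly_small_tails_permute)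
  have K: "(K \<circ> \<pi>) n \<in> cwk" "0 \<in> (K \<circ> \<pi>) n" for n using assms by auto
  show "\<exists>S\<in>cwk. hausdorff_sums (K \<circ> \<pi>) S"
    using series_set_cwk[OF K tails] hausdorff_sums_series_set[OF K tails] by blast
qed

section \<open>Birkhoff sums\<close>

text \<open>Oscillation is controlled only on members of positive measure. The others may lie in the
  null set where \<Gamma> is arbitrary, but their terms are the singleton of 0.\<close>

locale birkhoff_partition = vH_selection \<Gamma> \<Phi> "\<lambda>_. 0"
  for \<Gamma> :: "real \<Rightarrow> 'a::banach set" and \<Phi> +
  fixes A :: "nat \<Rightarrow> real set" and t :: "nat \<Rightarrow> real" and e :: real
  assumes e: "e > 0" and partition: "measurable_partition A"
    and tags: "A n \<noteq> {} \<Longrightarrow> t n \<in> A n"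
    and osc: "measure lebesgue (A n) > 0 \<Longrightarrow> s \<in> A n \<Longrightarrow> hausdorff_dist (\<Gamma> s) (\<Gamma> (t n)) \<le> e"
begin

definition w :: "nat \<Rightarrow> real" where "w n = measure lebesgue (A n)"

abbreviation K :: "nat \<Rightarrow> 'a set" where "K \<equiv> birkhoff_term \<Gamma> A t"

definition tagged_weight :: "(real \<times> real set) set \<Rightarrow> nat \<Rightarrow> real" where
  "tagged_weight q n = (\<Sum>(s, I)\<in>q. if s \<in> A n then len I else 0)"

lemma A_measurable: "A n \<in> sets lebesgue" and A_sub: "A n \<subseteq> {0..1}"
  and A_disjoint: "s \<in> A m \<Longrightarrow> s \<in> A n \<Longrightarrow> m = n"
  using partition unfolding measurable_partition_def disjoint_family_on_def by blast+

lemma w_nonneg: "w n \<ge> 0"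
  by (simp add: w_def)

lemma w_sums: "w sums 1"
proof -
  have "(\<lambda>n. measure lebesgue (A n)) sums measure lebesgue (\<Union>n. A n)"
    by (rule measure_UNION) (use partition in \<open>auto simp: measurable_partition_def\<close>)
  then show ?thesis using partition by (simp add: measurable_partition_def w_def[abs_def])
qed

lemma sum_w_le: "finite F \<Longrightarrow> sum w F \<le> 1"
  using sum_le_suminf[OF sums_summable[OF w_sums], of F] w_nonneg sums_unique[OF w_sums] by simp

lemma w_tail:
  assumes "\<theta> > 0"
  obtains n0 where "sum w {..<n0} \<ge> 1 - \<theta>" "\<forall>F. finite F \<longrightarrow> F \<subseteq> {n0..} \<longrightarrow> sum w F \<le> \<theta>"
proof -
  have "(\<lambda>n. sum w {..<n}) \<longlonglongrightarrow> 1" using w_sums by (simp add: sums_def)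
  then have "eventually (\<lambda>n. sum w {..<n} > 1 - \<theta>) sequentially"
    using assms by (intro order_tendstoD(1)) auto
  then obtain n0 where n0: "sum w {..<n0} > 1 - \<theta>" by (meson eventually_happens sequentially_bot)
  have "sum w F \<le> \<theta>" if "finite F" "F \<subseteq> {n0..}" for F
  proof -
    have "sum w ({..<n0} \<union> F) = sum w {..<n0} + sum w F" using that by (intro sum.union_disjoint) auto
    then show ?thesis using sum_w_le[of "{..<n0} \<union> F"] that n0 by simp
  qed
  with n0 show ?thesis using that[of n0] by auto
qed

lemma t_in: "w n > 0 \<Longrightarrow> t n \<in> {0..1}"
proof -
  assume "w n > 0"
  then have "A n \<noteq> {}" by (auto simp: w_def)
  then show "t n \<in> {0..1}" using tags A_sub by blast
qed

lemma K_eq: "K n = (if w n > 0 then (*\<^sub>R) (w n) ` \<Gamma> (t n) else {0})"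
proof (cases "A n = {}")
  case False
  then have "\<Gamma> (t n) \<noteq> {}" using cwkD(1)[OF cwk] tags A_sub by blast
  then have "w n = 0 \<Longrightarrow> (*\<^sub>R) (w n) ` \<Gamma> (t n) = {0}" by auto
  then show ?thesis using False w_nonneg[of n] unfolding birkhoff_term_def w_def[symmetric] by force
qed (simp add: birkhoff_term_def w_def)

lemma zero_in: "s \<in> {0..1} \<Longrightarrow> 0 \<in> \<Gamma> s"
  by (rule selection)

lemma zero_in_K: "0 \<in> K n"
  using zero_in[OF t_in[of n]] by (auto simp: K_eq image_iff intro!: bexI[of _ 0])

lemma K_cwk: "K n \<in> cwk"
  using cwk_affine_image[OF cwk[OF t_in[of n]], of 0 "w n"] by (auto simp: K_eq singleton_cwk)

text \<open>Doubling makes the inequality strict, so that \<open>hausdorff_dist_ex\<close> yields an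
  actual point within \<open>2 * e\<close>.\<close>

lemma osc': "w n > 0 \<Longrightarrow> s \<in> A n \<Longrightarrow> hausdorff_dist (\<Gamma> s) (\<Gamma> (t n)) < 2 * e"
  using osc[of n s] e by (simp add: w_def)

lemma sum_union_A:
  fixes h :: "real \<Rightarrow> real set \<Rightarrow> 'c::comm_monoid_add"
  assumes "finite F"
  shows "(\<Sum>(s, I)\<in>q. if s \<in> (\<Union>n\<in>F. A n) then h s I else 0) = (\<Sum>n\<in>F. \<Sum>(s, I)\<in>q. if s \<in> A n then h s I else 0)"
proof -
  have "(if s \<in> (\<Union>n\<in>F. A n) then h s I else 0) = (\<Sum>n\<in>F. if s \<in> A n then h s I else 0)" for s I
  proof (cases "s \<in> (\<Union>n\<in>F. A n)")
    case True
    then obtain m where m: "m \<in> F" "s \<in> A m" by blast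
    have "(\<Sum>n\<in>F. if s \<in> A n then h s I else 0) = (\<Sum>n\<in>F. if n = m then h s I else 0)"
      by (intro sum.cong) (use A_disjoint m in auto)
    then show ?thesis using True m assms by simp
  qed (auto intro!: sum.neutral[symmetric])
  then have "(\<Sum>(s, I)\<in>q. if s \<in> (\<Union>n\<in>F. A n) then h s I else 0) = (\<Sum>(s, I)\<in>q. \<Sum>n\<in>F. if s \<in> A n then h s I else 0)"
    by (simp only:)
  also have "\<dots> = (\<Sum>n\<in>F. \<Sum>(s, I)\<in>q. if s \<in> A n then h s I else 0)"
    unfolding case_prod_beta by (rule sum.swap)
  finally show ?thesis .
qed

lemma tagged_weight_nonneg: "tagged_weight q n \<ge> 0"
  unfolding tagged_weight_def by (intro sum_nonneg) auto

lemma sum_tagged_weight_le: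
  assumes "q tagged_division_of {0..1}" "finite F"
  shows "(\<Sum>n\<in>F. tagged_weight q n) \<le> 1"
proof -
  have "(\<Sum>n\<in>F. tagged_weight q n) = (\<Sum>(s, I)\<in>q. if s \<in> (\<Union>n\<in>F. A n) then len I else 0)"
    unfolding sum_union_A[OF assms(2)] tagged_weight_def ..
  also have "\<dots> \<le> (\<Sum>(s, I)\<in>q. len I)" by (intro sum_mono) auto
  also have "\<dots> = 1" using sum_content_tagged_division[OF assms(1)] by simp
  finally show ?thesis .
qed

lemma ex_gauge_tagged_weight:
  assumes "finite F" "\<tau> > 0"
  obtains \<gamma> where "gauge \<gamma>"
    "\<And>q n. q tagged_division_of {0..1} \<Longrightarrow> \<gamma> fine q \<Longrightarrow> n \<in> F \<Longrightarrow> \<bar>tagged_weight q n - w n\<bar> < \<tau>"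
proof -
  have "\<exists>\<gamma>. gauge \<gamma> \<and> (\<forall>q. q tagged_division_of {0..1} \<longrightarrow> \<gamma> fine q \<longrightarrow> \<bar>tagged_weight q n - w n\<bar> < \<tau>)" for n
  proof -
    have "A n \<inter> {0..1} = A n" using A_sub by blast
    with ex_gauge_tags[OF A_measurable[of n] assms(2), of 0 1] show ?thesis
      unfolding tagged_weight_def w_def by metis
  qed
  then obtain \<gamma> where \<gamma>: "\<And>n. gauge (\<gamma> n)"
    "\<And>n q. q tagged_division_of {0..1} \<Longrightarrow> \<gamma> n fine q \<Longrightarrow> \<bar>tagged_weight q n - w n\<bar> < \<tau>" by metis
  define \<gamma>' where "\<gamma>' x = (\<Inter>n\<in>F. \<gamma> n x)" for x
  have "gauge \<gamma>'"
    using \<gamma>(1) assms(1) unfolding gauge_def \<gamma>'_def by (auto intro!: open_INT)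
  moreover have "\<gamma> n fine q" if "\<gamma>' fine q" "n \<in> F" for n q
    using that unfolding fine_def \<gamma>'_def by blast
  ultimately show ?thesis using that \<gamma>(2) by metis
qed

text \<open>Two replacements: \<open>g\<close> by \<open>v\<close> costs \<open>2 * e\<close> times
  the tagged length, and the tagged length by \<open>w n\<close> costs \<tau> times the bound of
  \<open>x n\<close>. The hypothesis \<open>x\<close> makes \<open>x n\<close> a weighted mean of
  the points \<open>v n z\<close>: a constant \<open>v\<close> serves to pass from a Birkhoff sum to
  Riemann sums, a varying one to return.\<close>

lemma norm_sum_pieces_le:
  fixes g :: "real \<times> real set \<Rightarrow> 'a"
  assumes F: "finite F" and \<tau>: "\<And>n. n \<in> F \<Longrightarrow> \<bar>tagged_weight q n - w n\<bar> \<le> \<tau>"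
    and X: "\<And>n. n \<in> F \<Longrightarrow> norm (x n) \<le> X n"
    and near: "\<And>n z. n \<in> F \<Longrightarrow> z \<in> q \<Longrightarrow> fst z \<in> A n \<Longrightarrow> dist (g z) (v n z) < 2 * e"
    and x: "\<And>n. n \<in> F \<Longrightarrow> tagged_weight q n *\<^sub>R x n = (\<Sum>(s, I)\<in>q. if s \<in> A n then len I *\<^sub>R v n (s, I) else 0)"
  shows "norm ((\<Sum>(s, I)\<in>q. if s \<in> (\<Union>n\<in>F. A n) then len I *\<^sub>R g (s, I) else 0) - (\<Sum>n\<in>F. w n *\<^sub>R x n))
    \<le> 2 * e * (\<Sum>n\<in>F. tagged_weight q n) + \<tau> * sum X F"
proof -
  have "norm ((\<Sum>(s, I)\<in>q. if s \<in> A n then len I *\<^sub>R g (s, I) else 0) - w n *\<^sub>R x n)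
      \<le> 2 * e * tagged_weight q n + \<tau> * X n" if n: "n \<in> F" for n
  proof -
    let ?v = "\<Sum>(s, I)\<in>q. if s \<in> A n then len I *\<^sub>R (g (s, I) - v n (s, I)) else 0"
    have "(\<Sum>(s, I)\<in>q. if s \<in> A n then len I *\<^sub>R g (s, I) else 0) = ?v + tagged_weight q n *\<^sub>R x n"
      unfolding x[OF n] sum.distrib[symmetric] by (intro sum.cong) (auto simp: scaleR_diff_right)
    then have "(\<Sum>(s, I)\<in>q. if s \<in> A n then len I *\<^sub>R g (s, I) else 0) - w n *\<^sub>R x n
        = ?v + (tagged_weight q n - w n) *\<^sub>R x n"
      by (simp add: scaleR_diff_left)
    moreover have "norm ?v \<le> 2 * e * tagged_weight q n"
      unfolding tagged_weight_def sum_distrib_left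
    proof (rule order_trans[OF norm_sum sum_mono], clarify)
      fix s I assume sI: "(s, I) \<in> q"
      have "len I * norm (g (s, I) - v n (s, I)) \<le> len I * (2 * e)" if "s \<in> A n"
        using near[OF n sI] that by (intro mult_left_mono) (auto simp: dist_norm)
      then show "norm (if s \<in> A n then len I *\<^sub>R (g (s, I) - v n (s, I)) else 0)
          \<le> 2 * e * (if s \<in> A n then len I else 0)" by (auto simp: mult.commute)
    qed
    moreover have "norm ((tagged_weight q n - w n) *\<^sub>R x n) \<le> \<tau> * X n"
      using mult_mono[OF \<tau>[OF n] X[OF n]] \<tau>[OF n] by simp
    ultimately show ?thesis
      using norm_triangle_ineq[of ?v "(tagged_weight q n - w n) *\<^sub>R x n"] by simp
  qed
  then show ?thesis
    unfolding sum_union_A[OF F] sum_subtractf[symmetric] sum_distrib_left sum.distrib[symmetric]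
    by (intro order_trans[OF norm_sum sum_mono])
qed

text \<open>The partial Birkhoff sums are compared with Riemann sums over fine tagged divisions of the unit
  interval, in which the tags in \<open>A n\<close> carry a total length close to \<open>w n\<close>.\<close>

lemma birkhoff_riemann:
  assumes F: "finite F" and y: "\<And>n. n \<in> F \<Longrightarrow> y n \<in> K n" and \<eta>: "\<eta> > 0"
  obtains g \<gamma> where "gauge \<gamma>" "\<forall>s\<in>{0..1}. g s \<in> \<Gamma> s"
    "\<forall>q. q tagged_division_of {0..1} \<longrightarrow> \<gamma> fine q \<longrightarrow>
      norm ((rsum q g) - sum y F) \<le> 2 * e * sum w F + \<eta>"
    "\<forall>q B M. q tagged_division_of {0..1} \<longrightarrow> \<gamma> fine q \<longrightarrow> M \<ge> 0 \<longrightarrow> (\<forall>s\<in>B. \<forall>x\<in>\<Gamma> s. norm x \<le> M) \<longrightarrow>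
      norm (\<Sum>(s, I)\<in>q. if s \<in> B then len I *\<^sub>R g s else 0) \<le> M * (sum w F + \<eta>)"
proof -
  \<comment> \<open>Members of measure 0 contribute nothing to \<open>sum y F\<close> and
    \<open>sum w F\<close>, and on them the oscillation is not controlled.\<close>
  define F' where "F' = {n \<in> F. w n > 0}"
  have F': "finite F'" "F' \<subseteq> F" "\<And>n. n \<in> F' \<Longrightarrow> w n > 0" "\<And>n. n \<in> F' \<Longrightarrow> n \<in> F" using F by (auto simp: F'_def)
  have "\<exists>x. x \<in> \<Gamma> (t n) \<and> y n = w n *\<^sub>R x" if n: "n \<in> F'" for n
    using y[OF F'(4)[OF n]] F'(3)[OF n] by (auto simp: K_eq)
  then obtain x where x: "\<And>n. n \<in> F' \<Longrightarrow> x n \<in> \<Gamma> (t n)" "\<And>n. n \<in> F' \<Longrightarrow> y n = w n *\<^sub>R x n" by metis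
  have sumy: "sum y F = (\<Sum>n\<in>F'. w n *\<^sub>R x n)"
  proof -
    have "sum y F = sum y F'"
      by (rule sum.mono_neutral_right[OF F F'(2)]) (use y in \<open>force simp: F'_def K_eq split: if_splits\<close>)
    also have "\<dots> = (\<Sum>n\<in>F'. w n *\<^sub>R x n)" by (intro sum.cong x(2)) auto
    finally show ?thesis .
  qed
  have sumw: "sum w F = sum w F'"
    by (rule sum.mono_neutral_right[OF F F'(2)]) (use w_nonneg in \<open>force simp: F'_def not_less intro: antisym\<close>)
  let ?A = "\<Union>n\<in>F'. A n"
  have near: "\<exists>z\<in>\<Gamma> s. dist (x n) z < 2 * e" if "n \<in> F'" "s \<in> A n" for n s
  proof (rule hausdorff_dist_ex[OF nebd_\<Gamma> nebd_\<Gamma> x(1)])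
    show "hausdorff_dist (\<Gamma> (t n)) (\<Gamma> s) < 2 * e"
      using osc'[OF F'(3) that(2)] that(1) by (simp add: hausdorff_dist_commute)
    show "s \<in> {0..1}" using that(2) A_sub by blast
  qed (use that t_in F' in auto)
  \<comment> \<open>Disjointness of the members leaves at most one \<open>n\<close> for which
    \<open>z\<close> has to be close to \<open>x n\<close>. Off \<open>?A\<close> the value is 0, so
    the Riemann sums of \<open>g\<close> see only tags in \<open>?A\<close>.\<close>
  have "\<exists>z. (s \<in> {0..1} \<longrightarrow> z \<in> \<Gamma> s) \<and> (\<forall>n\<in>F'. s \<in> A n \<longrightarrow> dist (x n) z < 2 * e) \<and> (s \<notin> ?A \<longrightarrow> z = 0)" for s
  proof (cases "s \<in> ?A")
    case True
    then obtain n where n: "n \<in> F'" "s \<in> A n" by blast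
    from near[OF this] obtain z where "z \<in> \<Gamma> s" "dist (x n) z < 2 * e" by blast
    then show ?thesis using A_disjoint n by (intro exI[of _ z]) blast
  qed (use zero_in in auto)
  then obtain g where g: "\<And>s. s \<in> {0..1} \<Longrightarrow> g s \<in> \<Gamma> s"
    "\<And>s n. n \<in> F' \<Longrightarrow> s \<in> A n \<Longrightarrow> dist (x n) (g s) < 2 * e" "\<And>s. s \<notin> ?A \<Longrightarrow> g s = 0" by metis
  \<comment> \<open>Dominates the factors of \<tau> in both estimates below:
    \<open>card F' * (2 * e)\<close> plus the norms in the first, \<open>card F'\<close> in the
    second.\<close>
  define c where "c = card F' * (1 + 2 * e) + (\<Sum>n\<in>F'. norm (x n)) + 1"
  obtain \<tau> where \<tau>: "\<tau> > 0" and \<tau>c: "c * \<tau> \<le> \<eta>" by (rule ex_small_factor[OF \<eta>])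
  obtain \<gamma> where \<gamma>: "gauge \<gamma>"
    "\<And>q n. q tagged_division_of {0..1} \<Longrightarrow> \<gamma> fine q \<Longrightarrow> n \<in> F' \<Longrightarrow> \<bar>tagged_weight q n - w n\<bar> < \<tau>"
    using ex_gauge_tagged_weight[OF F'(1) \<tau>] by blast
  show ?thesis
  proof (rule that[of \<gamma> g], goal_cases)
    case 1 show ?case by (rule \<gamma>(1))
  next
    case 2 show ?case using g(1) by blast
  next
    case 3 show ?case
    proof (intro allI impI)
      fix q assume q: "q tagged_division_of {0..1}" "\<gamma> fine q"
      have tw: "\<bar>tagged_weight q n - w n\<bar> \<le> \<tau>" if "n \<in> F'" for n using \<gamma>(2)[OF q that] by simp
      have "rsum q g = (\<Sum>(s, I)\<in>q. if s \<in> ?A then len I *\<^sub>R g (fst (s, I)) else 0)"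
        by (intro sum.cong) (use g(3) in auto)
      then have "norm (rsum q g - sum y F) \<le> 2 * e * (\<Sum>n\<in>F'. tagged_weight q n) + \<tau> * (\<Sum>n\<in>F'. norm (x n))"
        unfolding sumy
      proof (simp only:, intro norm_sum_pieces_le[where v = "\<lambda>n _. x n"] F'(1) tw order_refl)
        show "dist (g (fst z)) (x n) < 2 * e" if "n \<in> F'" "fst z \<in> A n" for n z
          using g(2)[OF that] by (simp add: dist_commute)
        show "tagged_weight q n *\<^sub>R x n = (\<Sum>(s, I)\<in>q. if s \<in> A n then len I *\<^sub>R x n else 0)" for n
          unfolding tagged_weight_def scaleR_sum_left by (intro sum.cong) auto
      qed
      also have "\<dots> \<le> 2 * e * (\<Sum>n\<in>F'. w n + \<tau>) + \<tau> * (\<Sum>n\<in>F'. norm (x n))"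
      proof (intro add_right_mono mult_left_mono sum_mono)
        show "tagged_weight q n \<le> w n + \<tau>" if "n \<in> F'" for n using tw[OF that] by linarith
      qed (use e in auto)
      also have "\<dots> = 2 * e * sum w F + \<tau> * (card F' * (2 * e) + (\<Sum>n\<in>F'. norm (x n)))"
        unfolding sumw by (simp add: sum.distrib algebra_simps)
      also have "\<dots> \<le> 2 * e * sum w F + \<tau> * c"
        unfolding c_def using \<tau> by (intro add_left_mono mult_left_mono) (auto simp: algebra_simps)
      finally show "norm (rsum q g - sum y F) \<le> 2 * e * sum w F + \<eta>"
        using \<tau>c by (simp add: mult.commute)
    qed
  next
    case 4 show ?case
    proof (intro allI impI)
      fix q B and M :: real assume q: "q tagged_division_of {0..1}" "\<gamma> fine q"
        and M: "M \<ge> 0" "\<forall>s\<in>B. \<forall>x\<in>\<Gamma> s. norm x \<le> M"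
      have tw: "tagged_weight q n \<le> w n + \<tau>" if "n \<in> F'" for n using \<gamma>(2)[OF q that] by linarith
      have "norm (\<Sum>(s, I)\<in>q. if s \<in> B then len I *\<^sub>R g s else 0) \<le>
          (\<Sum>(s, I)\<in>q. if s \<in> ?A then M * len I else 0)"
      proof (rule order_trans[OF norm_sum sum_mono], clarify)
        fix s I assume "(s, I) \<in> q"
        then have "s \<in> {0..1}" by (rule tag_in_interval[OF q(1)])
        then have "norm (g s) \<le> M" if "s \<in> B" using M(2) that g(1) by blast
        then have "len I * norm (g s) \<le> len I * M" if "s \<in> B"
          using that by (intro mult_left_mono) auto
        then show "norm (if s \<in> B then len I *\<^sub>R g s else 0) \<le> (if s \<in> ?A then M * len I else 0)"
          using g(3)[of s] M(1) by (auto simp: mult.commute)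
      qed
      also have "\<dots> = (\<Sum>n\<in>F'. M * tagged_weight q n)"
        unfolding sum_union_A[OF F'(1)] tagged_weight_def sum_distrib_left by (intro sum.cong) auto
      also have "\<dots> \<le> (\<Sum>n\<in>F'. M * (w n + \<tau>))"
        using tw M(1) by (intro sum_mono mult_left_mono) auto
      also have "\<dots> = M * (sum w F + \<tau> * card F')"
        unfolding sumw by (simp add: sum.distrib sum_distrib_left distrib_left)
      also have "\<dots> \<le> M * (sum w F + \<tau> * c)"
        using M(1) \<tau> e unfolding c_def
        by (intro mult_left_mono add_left_mono) (auto simp: algebra_simps intro!: add_nonneg_nonneg sum_nonneg)
      finally show "norm (\<Sum>(s, I)\<in>q. if s \<in> B then len I *\<^sub>R g s else 0) \<le> M * (sum w F + \<eta>)"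
        using mult_left_mono[OF \<tau>c M(1)] by (simp add: algebra_simps)
    qed
  qed
qed

text \<open>With \<open>B\<close> and \<open>M\<close> fixed before \<open>F\<close>, a sum over
  members of total weight at most \<theta> is compared with a Riemann sum supported on them. Tags
  outside \<open>B\<close> contribute at most \<open>\<eta>/4\<close> whatever the values; tags in
  \<open>B\<close> have values of norm at most \<open>M\<close>, on a total length of about
  \<theta>.\<close>

lemma uniformly_small_tails_K: "uniformly_small_tails K"
  unfolding uniformly_small_tails_def
proof (intro allI impI)
  fix \<eta> :: real assume \<eta>: "\<eta> > 0"
  then have "\<eta>/4 > 0" by simp
  obtain B M where B: "B \<in> sets lebesgue" and M: "M \<ge> 0" "\<And>s x. s \<in> B \<Longrightarrow> x \<in> \<Gamma> s \<Longrightarrow> norm x \<le> M"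
    and out: "\<And>\<gamma>. gauge \<gamma> \<Longrightarrow> \<exists>q. q tagged_division_of {0..1} \<and> \<gamma> fine q \<and>
       (\<forall>g. (\<forall>(s, K)\<in>q. g s K \<in> \<Gamma> s) \<longrightarrow>
          norm (rsum_off B q g) \<le> \<eta>/4)"
    by (rule uniformly_small_outside[OF zero_in \<open>\<eta>/4 > 0\<close>]) blast+
  \<comment> \<open>The coefficient gathers \<open>M * (\<theta> + \<theta>)\<close> from the tags
    in \<open>B\<close> and \<open>2 * e * \<theta> + \<theta>\<close> from the comparison with the
    Birkhoff sum.\<close>
  obtain \<theta> where \<theta>: "\<theta> > 0" and \<theta>d: "(2 * e + 2 * M + 1) * \<theta> \<le> \<eta>/4"
    by (rule ex_small_factor[OF \<open>\<eta>/4 > 0\<close>])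
  obtain n0 where n0: "\<forall>F. finite F \<longrightarrow> F \<subseteq> {n0..} \<longrightarrow> sum w F \<le> \<theta>" by (rule w_tail[OF \<theta>])
  have "norm (sum y F) \<le> \<eta>" if F: "finite F" "F \<subseteq> {n0..}" and y: "\<forall>n. y n \<in> K n" for F y
  proof -
    obtain g \<gamma> where \<gamma>: "gauge \<gamma>" and g: "\<forall>s\<in>{0..1}. g s \<in> \<Gamma> s"
      and near: "\<forall>q. q tagged_division_of {0..1} \<longrightarrow> \<gamma> fine q \<longrightarrow>
        norm ((rsum q g) - sum y F) \<le> 2 * e * sum w F + \<theta>"
      and small: "\<forall>q B M. q tagged_division_of {0..1} \<longrightarrow> \<gamma> fine q \<longrightarrow> M \<ge> 0 \<longrightarrow> (\<forall>s\<in>B. \<forall>x\<in>\<Gamma> s. norm x \<le> M) \<longrightarrow>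
        norm (\<Sum>(s, I)\<in>q. if s \<in> B then len I *\<^sub>R g s else 0) \<le> M * (sum w F + \<theta>)"
      by (rule birkhoff_riemann[OF F(1) spec[OF y] \<theta>])
    obtain q where q: "q tagged_division_of {0..1}" "\<gamma> fine q"
      and qout: "\<And>g. \<forall>(s, K)\<in>q. g s K \<in> \<Gamma> s \<Longrightarrow> norm (rsum_off B q g) \<le> \<eta>/4"
      using out[OF \<gamma>] by blast
    have o1: "norm (\<Sum>(s, I)\<in>q. if s \<in> B then 0 else len I *\<^sub>R g s) \<le> \<eta>/4"
      by (rule qout) (use g tag_in_interval[OF q(1)] in blast)
    have o2: "norm (\<Sum>(s, I)\<in>q. if s \<in> B then len I *\<^sub>R g s else 0) \<le> M * (sum w F + \<theta>)"
      using small q M by blast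
    have o3: "(rsum q g) =
        (\<Sum>(s, I)\<in>q. if s \<in> B then 0 else len I *\<^sub>R g s) + (\<Sum>(s, I)\<in>q. if s \<in> B then len I *\<^sub>R g s else 0)"
      unfolding sum_if_neg by simp
    have "norm (rsum q g) \<le> \<eta>/4 + M * (sum w F + \<theta>)"
      unfolding o3 by (rule norm_triangle_mono[OF o1 o2])
    then have "norm (sum y F) \<le> \<eta>/4 + M * (sum w F + \<theta>) + (2 * e * sum w F + \<theta>)"
      using near[rule_format, OF q] norm_triangle_sub[of "sum y F" "\<Sum>(s, I)\<in>q. len I *\<^sub>R g s"]
      by (simp add: norm_minus_commute)
    also have "\<dots> \<le> \<eta>/4 + M * (\<theta> + \<theta>) + (2 * e * \<theta> + \<theta>)"
      using n0[rule_format, OF F] M(1) e by (intro add_mono mult_left_mono order_refl) auto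
    also have "\<dots> = \<eta>/4 + (2 * e + 2 * M + 1) * \<theta>" by (simp add: algebra_simps)
    finally show ?thesis using \<theta>d \<eta> by simp
  qed
  then show "\<exists>n0. \<forall>F y. finite F \<longrightarrow> F \<subseteq> {n0..} \<longrightarrow> (\<forall>n. y n \<in> K n) \<longrightarrow> norm (sum y F) \<le> \<eta>" by blast
qed

lemmas series_K = K_cwk zero_in_K uniformly_small_tails_K

section \<open>Comparison of Birkhoff sums with the primitive\<close>

lemma \<Phi>_sum:
  assumes "q tagged_division_of {0..1}"
  shows "\<Phi> {0..1} = {sum j q |j. \<forall>z\<in>q. j z \<in> \<Phi> (snd z)}"
proof -
  have "(\<Sum>(s, I)\<in>q. \<Phi> I) = \<Phi> {0..1}"
    by (rule interval_additive_sum_tagged_division[OF _ _ _ _ _ assms])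
      (use multimeasure multimeasure_singleton[OF multimeasure] in \<open>auto simp: interval_multimeasure_def\<close>)
  then have "\<Phi> {0..1} = (\<Sum>z\<in>q. \<Phi> (snd z))" by (simp add: case_prod_beta)
  also have "\<dots> = {sum j q |j. \<forall>z\<in>q. j z \<in> \<Phi> (snd z)}"
    by (rule set_sum_alt) (use assms in blast)
  finally show ?thesis .
qed

text \<open>Minkowski additivity of \<Phi> reduces both approximations to the single intervals of
  \<open>q\<close>. There points can be matched within \<open>err + \<tau>\<close>, the \<tau>
  giving the strict inequality that yields a point; the errors sum to less than \<open>e\<close>,
  and \<open>card q * \<tau>\<close> is at most \<open>e\<close>.\<close>

lemma riemann_sums_near_\<Phi>:
  obtains \<gamma> where "gauge \<gamma>"
    "\<And>q g. q tagged_division_of {0..1} \<Longrightarrow> \<gamma> fine q \<Longrightarrow> \<forall>z\<in>q. g z \<in> \<Gamma> (fst z) \<Longrightarrow>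
      \<exists>j\<in>\<Phi> {0..1}. norm (j - (\<Sum>z\<in>q. len (snd z) *\<^sub>R g z)) \<le> 2 * e"
    "\<And>q j. q tagged_division_of {0..1} \<Longrightarrow> \<gamma> fine q \<Longrightarrow> j \<in> \<Phi> {0..1} \<Longrightarrow>
      \<exists>g. (\<forall>z\<in>q. g z \<in> \<Gamma> (fst z)) \<and> norm (j - (\<Sum>z\<in>q. len (snd z) *\<^sub>R g z)) \<le> 2 * e"
proof -
  obtain \<gamma> where \<gamma>: "gauge \<gamma>"
    "\<And>p. p tagged_partial_division_of {0..1} \<Longrightarrow> \<gamma> fine p \<Longrightarrow> (\<Sum>(t, I)\<in>p. err t I) < e"
    using variational_partial[OF e] by blast
  have *: "(\<forall>g. (\<forall>z\<in>q. g z \<in> \<Gamma> (fst z)) \<longrightarrow> (\<exists>j\<in>\<Phi> {0..1}. norm (j - (\<Sum>z\<in>q. len (snd z) *\<^sub>R g z)) \<le> 2 * e)) \<and>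
      (\<forall>j\<in>\<Phi> {0..1}. \<exists>g. (\<forall>z\<in>q. g z \<in> \<Gamma> (fst z)) \<and> norm (j - (\<Sum>z\<in>q. len (snd z) *\<^sub>R g z)) \<le> 2 * e)"
    if q: "q tagged_division_of {0..1}" "\<gamma> fine q" for q
  proof -
    obtain \<tau> where \<tau>: "\<tau> > 0" "real (card q) * \<tau> \<le> e" by (rule ex_small_factor[OF e])
    have errq: "(\<Sum>(s, I)\<in>q. err s I) < e"
      by (rule \<gamma>(2)[OF tagged_division_imp_partial_superset[OF q(1) order_refl] q(2)])
    have near: "(\<forall>x\<in>\<Gamma> (fst z). \<exists>y\<in>\<Phi> (snd z). norm (y - len (snd z) *\<^sub>R x) \<le> err (fst z) (snd z) + \<tau>) \<and>
        (\<forall>y\<in>\<Phi> (snd z). \<exists>x\<in>\<Gamma> (fst z). norm (y - len (snd z) *\<^sub>R x) \<le> err (fst z) (snd z) + \<tau>)"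
      if z: "z \<in> q" for z
    proof -
      have zq: "(fst z, snd z) \<in> q" using z by simp
      have nb: "nebd ((*\<^sub>R) (len (snd z)) ` \<Gamma> (fst z))"
        by (intro nebd_scaleR nebd_\<Gamma> tag_in_interval[OF q(1) zq])
      have nb': "nebd (\<Phi> (snd z))"
        using tagged_divisionD01[OF q(1) order_refl zq] nebd_\<Phi> by metis
      have lt: "hausdorff_dist (\<Phi> (snd z)) ((*\<^sub>R) (len (snd z)) ` \<Gamma> (fst z)) < err (fst z) (snd z) + \<tau>"
        using \<tau>(1) unfolding err_def by simp
      show ?thesis
        using hausdorff_dist_ex[OF nb' nb _ lt] hausdorff_dist_ex[OF nb nb' _ lt[unfolded hausdorff_dist_commute[of "\<Phi> (snd z)"]]]
        by (fastforce simp: dist_norm norm_minus_commute intro: less_imp_le)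
    qed
    have le: "norm (sum j q - (\<Sum>z\<in>q. len (snd z) *\<^sub>R g z)) \<le> 2 * e"
      if "\<And>z. z \<in> q \<Longrightarrow> norm (j z - len (snd z) *\<^sub>R g z) \<le> err (fst z) (snd z) + \<tau>" for j g
    proof -
      have "norm (sum j q - (\<Sum>z\<in>q. len (snd z) *\<^sub>R g z)) \<le> (\<Sum>z\<in>q. err (fst z) (snd z) + \<tau>)"
        unfolding sum_subtractf[symmetric] by (intro order_trans[OF norm_sum sum_mono] that)
      also have "\<dots> = (\<Sum>(s, I)\<in>q. err s I) + card q * \<tau>" by (simp add: sum.distrib case_prod_beta)
      finally show ?thesis using errq \<tau>(2) by simp
    qed
    show ?thesis
    proof (intro conjI allI impI ballI)
      fix g assume "\<forall>z\<in>q. g z \<in> \<Gamma> (fst z)"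
      then have "\<forall>z\<in>q. \<exists>y. y \<in> \<Phi> (snd z) \<and> norm (y - len (snd z) *\<^sub>R g z) \<le> err (fst z) (snd z) + \<tau>"
        using near by blast
      then obtain j where "\<forall>z\<in>q. j z \<in> \<Phi> (snd z) \<and> norm (j z - len (snd z) *\<^sub>R g z) \<le> err (fst z) (snd z) + \<tau>"
        by (rule bchoice[THEN exE])
      then show "\<exists>j\<in>\<Phi> {0..1}. norm (j - (\<Sum>z\<in>q. len (snd z) *\<^sub>R g z)) \<le> 2 * e"
        unfolding \<Phi>_sum[OF q(1)] using le[of j g] by blast
    next
      fix j assume "j \<in> \<Phi> {0..1}"
      then obtain jj where jj: "\<forall>z\<in>q. jj z \<in> \<Phi> (snd z)" "j = sum jj q"
        unfolding \<Phi>_sum[OF q(1)] by blast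
      then have "\<forall>z\<in>q. \<exists>x. x \<in> \<Gamma> (fst z) \<and> norm (jj z - len (snd z) *\<^sub>R x) \<le> err (fst z) (snd z) + \<tau>"
        using near by blast
      then obtain g where "\<forall>z\<in>q. g z \<in> \<Gamma> (fst z) \<and> norm (jj z - len (snd z) *\<^sub>R g z) \<le> err (fst z) (snd z) + \<tau>"
        by (rule bchoice[THEN exE])
      then show "\<exists>g. (\<forall>z\<in>q. g z \<in> \<Gamma> (fst z)) \<and> norm (j - (\<Sum>z\<in>q. len (snd z) *\<^sub>R g z)) \<le> 2 * e"
        using le[of jj g] jj(2) by blast
    qed
  qed
  show ?thesis
  proof (rule that[OF \<gamma>(1)], goal_cases)
    case (1 q g) then show ?case using * by blast
  next
    case (2 q j) then show ?case using * by blast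
  qed
qed

text \<open>Via a Riemann sum fine for both gauges: \<open>3 * e\<close> from
  \<open>birkhoff_riemann\<close>, as the weights sum to at most 1, and \<open>2 * e\<close> from
  \<open>riemann_sums_near_\<Phi>\<close>.\<close>

lemma birkhoff_sum_near_\<Phi>:
  assumes F: "finite F" and y: "\<And>n. n \<in> F \<Longrightarrow> y n \<in> K n"
  shows "\<exists>j\<in>\<Phi> {0..1}. norm (sum y F - j) \<le> 5 * e"
proof -
  obtain g \<gamma> where \<gamma>: "gauge \<gamma>" and g: "\<forall>s\<in>{0..1}. g s \<in> \<Gamma> s"
    and near: "\<forall>q. q tagged_division_of {0..1} \<longrightarrow> \<gamma> fine q \<longrightarrow>
      norm (rsum q g - sum y F) \<le> 2 * e * sum w F + e"
    by (rule birkhoff_riemann[OF F y e])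
  obtain \<gamma>' where \<gamma>': "gauge \<gamma>'"
    "\<And>q g. q tagged_division_of {0..1} \<Longrightarrow> \<gamma>' fine q \<Longrightarrow> \<forall>z\<in>q. g z \<in> \<Gamma> (fst z) \<Longrightarrow>
      \<exists>j\<in>\<Phi> {0..1}. norm (j - (\<Sum>z\<in>q. len (snd z) *\<^sub>R g z)) \<le> 2 * e"
    by (rule riemann_sums_near_\<Phi>) blast
  obtain q where q: "q tagged_division_of {0..1}" "(\<lambda>x. \<gamma> x \<inter> \<gamma>' x) fine q"
    using fine_division_exists_real[OF gauge_Int[OF \<gamma> \<gamma>'(1)]] .
  have fine: "\<gamma> fine q" "\<gamma>' fine q" using q(2) by (simp_all add: fine_Int)
  have "\<forall>z\<in>q. g (fst z) \<in> \<Gamma> (fst z)" using g tag_in_interval[OF q(1)] by force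
  from \<gamma>'(2)[OF q(1) fine(2) this]
  obtain j where j: "j \<in> \<Phi> {0..1}" "norm (j - rsum q g) \<le> 2 * e" by (auto simp: case_prod_beta)
  have "2 * e * sum w F \<le> 2 * e * 1" using sum_w_le[OF F] e by (intro mult_left_mono) auto
  then have "norm (rsum q g - sum y F) \<le> 3 * e" using near[rule_format, OF q(1) fine(1)] by simp
  from norm_triangle_mono[OF j(2) this] have "norm (sum y F - j) \<le> 5 * e"
    by (simp add: norm_minus_commute)
  with j(1) show ?thesis by blast
qed

end

text \<open>\<open>j\<close> is within \<open>2 * e\<close> of a Riemann sum. Its values tagged in
  \<open>A n\<close> are moved into \<open>\<Gamma> (t n)\<close> and averaged there, which
  convexity permits, and the means form a finite Birkhoff sum (\<open>3 * e\<close>). Tags off the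
  members in \<open>F\<close> contribute little outside \<open>B\<close> and have small total length
  inside it (another \<open>3 * e\<close>). The division comes from
  \<open>uniformly_small_outside\<close>, which promises only some \<open>q\<close>, while the other
  two requirements hold for every fine one.\<close>

lemma (in birkhoff_partition) \<Phi>_near_birkhoff_sum:
  assumes j: "j \<in> \<Phi> {0..1}"
  shows "\<exists>x\<in>series_set K. norm (j - x) \<le> 8 * e"
proof -
  obtain B M where B: "B \<in> sets lebesgue" and M: "M \<ge> 0" "\<And>s x. s \<in> B \<Longrightarrow> x \<in> \<Gamma> s \<Longrightarrow> norm x \<le> M"
    and out: "\<And>\<gamma>. gauge \<gamma> \<Longrightarrow> \<exists>q. q tagged_division_of {0..1} \<and> \<gamma> fine q \<and>
       (\<forall>g. (\<forall>(s, K)\<in>q. g s K \<in> \<Gamma> s) \<longrightarrow>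
          norm (rsum_off B q g) \<le> e)"
    by (rule uniformly_small_outside[OF zero_in e]) blast+
  obtain \<theta> where \<theta>: "\<theta> > 0" and M\<theta>: "M * \<theta> \<le> e" by (rule ex_small_factor[OF e])
  obtain n0 where n0: "sum w {..<n0} \<ge> 1 - \<theta>" by (rule w_tail[OF \<theta>])
  define F where "F = {n \<in> {..<n0}. w n > 0}"
  have F: "finite F" "\<And>n. n \<in> F \<Longrightarrow> w n > 0" by (auto simp: F_def)
  have "sum w {..<n0} = sum w F"
    by (rule sum.mono_neutral_right) (use w_nonneg in \<open>force simp: F_def not_less intro: antisym\<close>)+
  then have wF: "sum w F \<ge> 1 - \<theta>" using n0 by simp
  let ?A = "\<Union>n\<in>F. A n"
  have "\<exists>X\<ge>0. \<forall>x\<in>\<Gamma> (t n). norm x \<le> X" if n: "n \<in> F" for n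
  proof -
    obtain b where b: "\<And>x. x \<in> \<Gamma> (t n) \<Longrightarrow> norm x \<le> b"
      using nebd_\<Gamma>[OF t_in[OF F(2)[OF n]]] by (auto simp: nebd_def bounded_iff)
    then show ?thesis by (intro exI[of _ "max b 0"]) (auto simp: le_max_iff_disj)
  qed
  then obtain X where X: "\<And>n. n \<in> F \<Longrightarrow> X n \<ge> 0" "\<And>n x. n \<in> F \<Longrightarrow> x \<in> \<Gamma> (t n) \<Longrightarrow> norm x \<le> X n" by metis
  have sX: "sum X F \<ge> 0" by (intro sum_nonneg X)
  obtain \<tau> where \<tau>: "\<tau> > 0" and "(sum X F + M * card F) * \<tau> \<le> e" by (rule ex_small_factor[OF e])
  moreover have "sum X F * \<tau> \<ge> 0" "M * card F * \<tau> \<ge> 0" using sX M(1) \<tau> by auto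
  ultimately have \<tau>X: "\<tau> * sum X F \<le> e" and M\<tau>: "M * (card F * \<tau>) \<le> e"
    by (simp_all add: algebra_simps)
  obtain \<gamma>1 where \<gamma>1: "gauge \<gamma>1"
    "\<And>q n. q tagged_division_of {0..1} \<Longrightarrow> \<gamma>1 fine q \<Longrightarrow> n \<in> F \<Longrightarrow> \<bar>tagged_weight q n - w n\<bar> < \<tau>"
    using ex_gauge_tagged_weight[OF F(1) \<tau>] by blast
  obtain \<gamma>2 where \<gamma>2: "gauge \<gamma>2"
    "\<And>q j. q tagged_division_of {0..1} \<Longrightarrow> \<gamma>2 fine q \<Longrightarrow> j \<in> \<Phi> {0..1} \<Longrightarrow>
      \<exists>g. (\<forall>z\<in>q. g z \<in> \<Gamma> (fst z)) \<and> norm (j - (\<Sum>z\<in>q. len (snd z) *\<^sub>R g z)) \<le> 2 * e"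
    by (rule riemann_sums_near_\<Phi>) blast
  obtain q where q: "q tagged_division_of {0..1}" "(\<lambda>x. \<gamma>1 x \<inter> \<gamma>2 x) fine q"
    and qout: "\<And>g. \<forall>(s, K)\<in>q. g s K \<in> \<Gamma> s \<Longrightarrow> norm (rsum_off B q g) \<le> e"
    using out[OF gauge_Int[OF \<gamma>1(1) \<gamma>2(1)]] by blast
  have fine: "\<gamma>1 fine q" "\<gamma>2 fine q" using q(2) by (simp_all add: fine_Int)
  have fq: "finite q" using q(1) by blast
  have tag01: "fst z \<in> {0..1}" if "z \<in> q" for z
    using tag_in_interval[OF q(1), of "fst z" "snd z"] that by simp
  have tw: "\<bar>tagged_weight q n - w n\<bar> \<le> \<tau>" if "n \<in> F" for n using \<gamma>1(2)[OF q(1) fine(1) that] by simp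
  obtain g where g: "\<And>z. z \<in> q \<Longrightarrow> g z \<in> \<Gamma> (fst z)"
    and jg: "norm (j - (\<Sum>z\<in>q. len (snd z) *\<^sub>R g z)) \<le> 2 * e"
    using \<gamma>2(2)[OF q(1) fine(2) j] by blast
  define R where "R = (\<Sum>(s, I)\<in>q. len I *\<^sub>R g (s, I))"
  have jR: "norm (j - R) \<le> 2 * e" using jg by (simp add: R_def case_prod_beta)
  have "\<exists>v. \<forall>n\<in>F. fst z \<in> A n \<longrightarrow> v \<in> \<Gamma> (t n) \<and> dist (g z) v < 2 * e" if z: "z \<in> q" for z
  proof (cases "fst z \<in> ?A")
    case True
    then obtain n where n: "n \<in> F" "fst z \<in> A n" by blast
    have "\<exists>v\<in>\<Gamma> (t n). dist (g z) v < 2 * e"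
      by (rule hausdorff_dist_ex[OF nebd_\<Gamma>[OF tag01[OF z]] nebd_\<Gamma>[OF t_in[OF F(2)[OF n(1)]]] g[OF z] osc'[OF F(2)[OF n(1)] n(2)]])
    then show ?thesis using A_disjoint n by blast
  qed auto
  then obtain v where v: "\<And>z n. z \<in> q \<Longrightarrow> n \<in> F \<Longrightarrow> fst z \<in> A n \<Longrightarrow> v z \<in> \<Gamma> (t n) \<and> dist (g z) (v z) < 2 * e" by metis
  define V where "V n = (\<Sum>(s, I)\<in>q. if s \<in> A n then len I *\<^sub>R v (s, I) else 0)" for n
  have "\<exists>x\<in>\<Gamma> (t n). tagged_weight q n *\<^sub>R x = V n"
    if n: "n \<in> F" for n
  proof -
    define \<alpha> where "\<alpha> = tagged_weight q n"
    have \<alpha>: "\<alpha> = (\<Sum>z\<in>q. if fst z \<in> A n then len (snd z) else 0)"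
      by (simp add: \<alpha>_def tagged_weight_def case_prod_beta)
    have tn: "t n \<in> {0..1}" by (rule t_in[OF F(2)[OF n]])
    \<comment> \<open>Serves when no length is tagged in \<open>A n\<close>, and as a filler of
      weight 0 in the convex combination below.\<close>
    obtain x0 where x0: "x0 \<in> \<Gamma> (t n)" using zero_in[OF tn] by blast
    show ?thesis
    proof (cases "\<alpha> = 0")
      case True
      then have "\<forall>z\<in>q. (if fst z \<in> A n then len (snd z) else 0) = 0"
        unfolding \<alpha> by (subst (asm) sum_nonneg_eq_0_iff[OF fq]) auto
      then have "V n = 0"
        unfolding V_def by (intro sum.neutral) (force split: if_splits)
      then show ?thesis using x0 True by (auto simp: \<alpha>_def)
    next
      case False
      then have \<alpha>0: "\<alpha> > 0" using tagged_weight_nonneg[of q n] by (simp add: \<alpha>_def)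
      let ?a = "\<lambda>z. (if fst z \<in> A n then len (snd z) else 0) / \<alpha>"
      let ?x = "\<lambda>z. if fst z \<in> A n then v z else x0"
      have "(\<Sum>z\<in>q. ?a z *\<^sub>R ?x z) \<in> \<Gamma> (t n)"
      proof (rule convex_sum[OF fq cwkD(2)[OF cwk[OF tn]]])
        show "sum ?a q = 1" unfolding sum_divide_distrib[symmetric] \<alpha>[symmetric] using False by simp
        show "0 \<le> ?a z" if "z \<in> q" for z using \<alpha>0 by auto
        show "?x z \<in> \<Gamma> (t n)" if "z \<in> q" for z using v[OF that n] x0 by auto
      qed
      moreover have "\<alpha> *\<^sub>R (\<Sum>z\<in>q. ?a z *\<^sub>R ?x z) = V n"
        unfolding V_def scaleR_sum_right by (intro sum.cong) (use \<alpha>0 in \<open>auto simp: case_prod_beta\<close>)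
      ultimately show ?thesis unfolding \<alpha>_def by blast
    qed
  qed
  then obtain x where x: "\<And>n. n \<in> F \<Longrightarrow> x n \<in> \<Gamma> (t n)"
    "\<And>n. n \<in> F \<Longrightarrow> tagged_weight q n *\<^sub>R x n = V n" by metis
  define R1 where "R1 = (\<Sum>(s, I)\<in>q. if s \<in> ?A then len I *\<^sub>R g (s, I) else 0)"
  define R2 where "R2 = (\<Sum>(s, I)\<in>q. if s \<in> ?A then 0 else len I *\<^sub>R g (s, I))"
  have R: "R = R1 + R2" unfolding R_def R1_def R2_def sum_if_neg by simp
  have R1: "norm (R1 - (\<Sum>n\<in>F. w n *\<^sub>R x n)) \<le> 3 * e"
  proof -
    have "norm (R1 - (\<Sum>n\<in>F. w n *\<^sub>R x n)) \<le> 2 * e * (\<Sum>n\<in>F. tagged_weight q n) + \<tau> * sum X F"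
      unfolding R1_def
      by (rule norm_sum_pieces_le[where v = "\<lambda>_. v"]) (use F tw X(2) x v in \<open>auto simp: V_def\<close>)
    also have "\<dots> \<le> 2 * e * 1 + e"
      using sum_tagged_weight_le[OF q(1) F(1)] e \<tau>X by (intro add_mono mult_left_mono) auto
    finally show ?thesis by simp
  qed
  have R2: "norm R2 \<le> 3 * e"
  proof -
    \<comment> \<open>Tags in \<open>?A\<close> are switched to 0, an admissible value, so that the
      bound for tags outside \<open>B\<close> applies to the remaining ones.\<close>
    define g' where "g' s I = (if s \<in> ?A then 0 else g (s, I))" for s I
    have g': "g' s I \<in> \<Gamma> s" if "(s, I) \<in> q" for s I
      using g[OF that] zero_in[OF tag_in_interval[OF q(1) that]] by (auto simp: g'_def)
    have "R2 = (\<Sum>(s, I)\<in>q. len I *\<^sub>R g' s I)"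
      unfolding R2_def by (intro sum.cong) (auto simp: g'_def)
    also have "\<dots> = (rsum_off B q g')
        + (\<Sum>(s, I)\<in>q. if s \<in> B then len I *\<^sub>R g' s I else 0)"
      unfolding sum_if_neg by simp
    finally have R2': "R2 = (rsum_off B q g')
        + (\<Sum>(s, I)\<in>q. if s \<in> B then len I *\<^sub>R g' s I else 0)" .
    have 1: "norm (rsum_off B q g') \<le> e"
      by (rule qout) (use g' in blast)
    \<comment> \<open>Tags in \<open>B\<close> but off \<open>?A\<close> have values bounded by
      \<open>M\<close>, and the length tagged off \<open>?A\<close> is 1 minus the tagged weights,
      hence at most \<open>\<theta> + card F * \<tau>\<close>.\<close>
    have "norm (\<Sum>(s, I)\<in>q. if s \<in> B then len I *\<^sub>R g' s I else 0) \<le>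
        (\<Sum>(s, I)\<in>q. if s \<in> ?A then 0 else M * len I)"
    proof (rule order_trans[OF norm_sum sum_mono], clarify)
      fix s I assume sI: "(s, I) \<in> q"
      have "norm (g' s I) \<le> M" if "s \<in> B" using M(2)[OF that g'[OF sI]] .
      then have "len I * norm (g' s I) \<le> len I * M" if "s \<in> B"
        using that by (intro mult_left_mono) auto
      then show "norm (if s \<in> B then len I *\<^sub>R g' s I else 0) \<le> (if s \<in> ?A then 0 else M * len I)"
        using M(1) by (auto simp: mult.commute g'_def)
    qed
    also have "\<dots> = M * (1 - (\<Sum>n\<in>F. tagged_weight q n))"
      unfolding sum_if_neg sum_union_A[OF F(1)] tagged_weight_def right_diff_distrib sum_distrib_left
      using sum_content_tagged_division[OF q(1)]
      by (simp add: case_prod_beta sum_distrib_left[symmetric] if_distrib[of "(*) M"] cong: if_cong)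
    also have "\<dots> \<le> M * (\<theta> + card F * \<tau>)"
    proof (rule mult_left_mono[OF _ M(1)])
      have "(\<Sum>n\<in>F. w n - \<tau>) \<le> (\<Sum>n\<in>F. tagged_weight q n)"
      proof (rule sum_mono)
        show "w n - \<tau> \<le> tagged_weight q n" if "n \<in> F" for n using tw[OF that] by linarith
      qed
      then show "1 - (\<Sum>n\<in>F. tagged_weight q n) \<le> \<theta> + card F * \<tau>"
        using wF by (simp add: sum_subtractf)
    qed
    also have "\<dots> \<le> 2 * e" using M\<theta> M\<tau> by (simp add: distrib_left)
    finally have 2: "norm (\<Sum>(s, I)\<in>q. if s \<in> B then len I *\<^sub>R g' s I else 0) \<le> 2 * e" .
    show ?thesis unfolding R2' using norm_triangle_mono[OF 1 2] by simp
  qed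
  have "(\<Sum>n\<in>F. w n *\<^sub>R x n) \<in> series_set K"
    by (rule finite_sum_in_series_set[OF series_K F(1)]) (use x(1) F(2) in \<open>simp add: K_eq imageI\<close>)
  moreover have "norm (j - (\<Sum>n\<in>F. w n *\<^sub>R x n)) \<le> 8 * e"
  proof -
    have eq: "j - (\<Sum>n\<in>F. w n *\<^sub>R x n) = (j - R) + ((R1 - (\<Sum>n\<in>F. w n *\<^sub>R x n)) + R2)" by (simp add: R)
    show ?thesis unfolding eq using norm_triangle_mono[OF jR norm_triangle_mono[OF R1 R2]] by linarith
  qed
  ultimately show ?thesis by blast
qed

text \<open>The constant is that of \<open>\<Phi>_near_birkhoff_sum\<close>; in the other direction
  passing to a partial sum costs \<open>e\<close>, and \<open>5 * e\<close> leads from there to a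
  point of \<open>\<Phi> {0..1}\<close>.\<close>

lemma (in birkhoff_partition) hausdorff_dist_birkhoff_sum: "hausdorff_dist (\<Phi> {0..1}) (series_set K) \<le> 8 * e"
proof (rule hausdorff_dist_leI_ex)
  have "nebd (\<Phi> {0..1})" by (rule nebd_\<Phi>) (simp add: closed_subintervals_iff)
  then show "\<Phi> {0..1} \<noteq> {}" by (simp add: nebd_def)
  show "series_set K \<noteq> {}" using cwkD(1)[OF series_set_cwk[OF series_K]] .
  show "\<exists>b\<in>series_set K. dist a b \<le> 8 * e" if "a \<in> \<Phi> {0..1}" for a
    using \<Phi>_near_birkhoff_sum[OF that] by (simp add: dist_norm)
  fix b assume "b \<in> series_set K"
  then obtain y where y: "\<And>n. y n \<in> K n" "b = suminf y" using in_series_setE[OF series_K] by blast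
  have "(\<lambda>n. sum y {..<n}) \<longlonglongrightarrow> b"
    unfolding y(2) by (rule summable_LIMSEQ[OF summable_selection[OF series_K y(1)]])
  then obtain n where "norm (sum y {..<n} - b) < e" using LIMSEQ_D[OF _ e] by blast
  moreover obtain j where "j \<in> \<Phi> {0..1}" "norm (sum y {..<n} - j) \<le> 5 * e"
    using birkhoff_sum_near_\<Phi>[of "{..<n}" y] y(1) by auto
  moreover have "norm (j - b) \<le> norm (sum y {..<n} - b) + norm (sum y {..<n} - j)"
    by (rule order_trans[OF eq_refl norm_triangle_ineq4]) simp
  ultimately show "\<exists>a\<in>\<Phi> {0..1}. dist a b \<le> 8 * e"
    using e by (intro bexI[of _ j]) (auto simp: dist_norm)
qed

lemma birkhoff_integrable_if_zero_selection:
  assumes "vH_selection \<Gamma> \<Phi> (\<lambda>_. 0)"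
  shows "birkhoff_integrable \<Gamma>"
proof -
  interpret vH_selection \<Gamma> \<Phi> "\<lambda>_. 0" by fact
  have "\<Phi> {0..1} \<in> cwk" by (rule \<Phi>_cwk) (simp add: closed_subintervals_iff)
  moreover have "\<exists>P. measurable_partition P \<and>
       (\<forall>A t. measurable_partition A \<longrightarrow> finer_than A P \<longrightarrow> (\<forall>n. A n \<noteq> {} \<longrightarrow> t n \<in> A n) \<longrightarrow>
         unconditionally_convergent (birkhoff_term \<Gamma> A t) \<and>
         (\<exists>S\<in>cwk. hausdorff_sums (birkhoff_term \<Gamma> A t) S \<and> hausdorff_dist (\<Phi> {0..1}) S < \<epsilon>))"
    if \<epsilon>: "\<epsilon> > 0" for \<epsilon>
  proof -
    \<comment> \<open>\<open>8 * e\<close> has to stay strictly below \<epsilon>.\<close>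
    define e where "e = \<epsilon> / 9"
    have e: "e > 0" using \<epsilon> by (simp add: e_def)
    obtain k :: "real \<Rightarrow> nat" and E and M :: "nat \<Rightarrow> real" where Em: "\<And>n. E n \<in> sets lebesgue"
      and Ek: "\<And>n. E n \<subseteq> {t \<in> {0..1}. k t = n}"
      and En: "\<And>n. negligible ({t \<in> {0..1}. k t = n} - E n)"
      and osc: "\<And>s t. t \<in> {0..1} \<Longrightarrow> s \<in> E (k t) \<Longrightarrow> hausdorff_dist (\<Gamma> s) (\<Gamma> t) \<le> e"
      by (rule ex_pieces[OF e]) blast
    \<comment> \<open>Index 0 receives the null remainder. A member of a finer partition that has
      positive measure therefore lies in a single \<open>E m\<close>, where the oscillation is at
      most \<open>e\<close>.\<close>
    define P where "P n = (case n of 0 \<Rightarrow> {0..1} - (\<Union>n. E n) | Suc m \<Rightarrow> E m)" for n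
    have P0: "P 0 = {0..1} - (\<Union>n. E n)" and PS: "P (Suc m) = E m" for m by (simp_all add: P_def)
    have "P 0 \<subseteq> (\<Union>n. {t \<in> {0..1}. k t = n} - E n)" unfolding P0 by blast
    then have neg: "negligible (P 0)"
      using negligible_Union_nat[OF En] negligible_subset by blast
    have "measurable_partition P"
      unfolding measurable_partition_def
    proof (intro conjI)
      have "P n \<in> sets lebesgue" for n
        by (cases n) (use negligible_imp_sets[OF neg] Em PS in auto)
      then show "range P \<subseteq> sets lebesgue" by blast
      show "disjoint_family P"
        unfolding disjoint_family_on_def
      proof (intro ballI impI)
        fix m n :: nat assume "m \<noteq> n"
        then show "P m \<inter> P n = {}" using Ek by (cases m; cases n) (auto simp: P0 PS)
      qed
      show "(\<Union>n. P n) = {0..1}"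
      proof
        have "E n \<subseteq> {0..1}" for n using Ek[of n] by blast
        then have "P n \<subseteq> {0..1}" for n by (cases n) (auto simp: P0 PS)
        then show "(\<Union>n. P n) \<subseteq> {0..1}" by blast
        show "{0..1} \<subseteq> (\<Union>n. P n)"
        proof
          fix x :: real assume "x \<in> {0..1}"
          then have "x \<in> P 0 \<or> (\<exists>m. x \<in> P (Suc m))" by (auto simp: P0 PS)
          then show "x \<in> (\<Union>n. P n)" by blast
        qed
      qed
    qed
    moreover have "unconditionally_convergent (birkhoff_term \<Gamma> A t) \<and>
         (\<exists>S\<in>cwk. hausdorff_sums (birkhoff_term \<Gamma> A t) S \<and> hausdorff_dist (\<Phi> {0..1}) S < \<epsilon>)"
      if A: "measurable_partition A" "finer_than A P" "\<forall>n. A n \<noteq> {} \<longrightarrow> t n \<in> A n" for A t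
    proof -
      interpret birkhoff_partition \<Gamma> \<Phi> A t e
      proof
        fix n s assume w: "measure lebesgue (A n) > 0" and s: "s \<in> A n"
        obtain m where m: "A n \<subseteq> P m" using A(2) by (auto simp: finer_than_def)
        show "hausdorff_dist (\<Gamma> s) (\<Gamma> (t n)) \<le> e"
        proof (cases m)
          case 0
          then have "negligible (A n)" using m neg negligible_subset by blast
          then show ?thesis using w negligible_imp_measure0 by force
        next
          case (Suc m')
          then have "s \<in> E m'" "t n \<in> E m'" using m s A(3) by (auto simp: PS)
          then show ?thesis using osc[of "t n" s] Ek[of m'] by auto
        qed
      qed (use e A in auto)
      have "hausdorff_dist (\<Phi> {0..1}) (series_set K) < \<epsilon>"
        using hausdorff_dist_birkhoff_sum e by (simp add: e_def)
      then show ?thesis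
        using unconditionally_convergentI[OF series_K] series_set_cwk[OF series_K]
          hausdorff_sums_series_set[OF series_K] by blast
    qed
    ultimately show ?thesis by blast
  qed
  ultimately show ?thesis unfolding birkhoff_integrable_def by blast
qed

section \<open>Subtracting the selection\<close>

text \<open>The variational errors of \<Gamma> and \<open>f\<close> add up, which is why
  \<open>selection_variational\<close> is used beyond mere integrability of \<open>f\<close>. The
  old pieces serve for the translate because \<open>ess_const\<close> bounds the oscillations of
  \<Gamma> and \<open>f\<close> together, by \<open>e/2\<close> each.\<close>

lemma vH_selection_translate:
  assumes "vH_selection \<Gamma> \<Phi> f"
  shows "vH_selection (\<lambda>t. (\<lambda>x. x - f t) ` \<Gamma> t) (\<lambda>I. (\<lambda>x. x - integral I f) ` \<Phi> I) (\<lambda>_. 0)"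
proof -
  interpret vH_selection \<Gamma> \<Phi> f by fact
  let ?G = "\<lambda>t. (\<lambda>x. x - f t) ` \<Gamma> t" and ?\<Psi> = "\<lambda>I. (\<lambda>x. x - integral I f) ` \<Phi> I"
  have tr: "(\<lambda>x. x - a) ` A \<in> cwk" if "A \<in> cwk" for a :: 'a and A
    using cwk_affine_image[OF that, of "- a" 1] by (simp add: add.commute)
  show ?thesis
  proof
    show "?G t \<in> cwk" if "t \<in> {0..1}" for t using tr[OF cwk[OF that]] .
    show "interval_multimeasure ?\<Psi>"
      unfolding interval_multimeasure_def
    proof (intro conjI interval_additiveI)
      show "?\<Psi> \<in> closed_subintervals \<rightarrow> cwk" using tr \<Phi>_cwk by auto
      fix I J assume "I \<in> closed_subintervals" "J \<in> closed_subintervals"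
        "interior I \<inter> interior J = {}" "I \<union> J \<in> closed_subintervals"
      then have 1: "\<Phi> (I \<union> J) = \<Phi> I + \<Phi> J" and 2: "integral (I \<union> J) f = integral I f + integral J f"
        using multimeasure integral_interval_additive
        by (auto simp: interval_multimeasure_def interval_additive_def)
      show "?\<Psi> (I \<union> J) = ?\<Psi> I + ?\<Psi> J"
        unfolding 1 2 set_plus_image by (force simp: image_iff algebra_simps)
    qed
    show "\<exists>\<gamma>. gauge \<gamma> \<and> (\<forall>p. p tagged_division_of {0..1} \<longrightarrow> \<gamma> fine p \<longrightarrow>
      (\<Sum>(t, I)\<in>p. hausdorff_dist (?\<Psi> I) ((*\<^sub>R) (len I) ` ?G t)) < \<epsilon>)" if \<epsilon>: "\<epsilon> > 0" for \<epsilon>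
    proof -
      have \<epsilon>2: "\<epsilon>/2 > 0" using \<epsilon> by simp
      obtain \<gamma>1 where \<gamma>1: "gauge \<gamma>1" "\<forall>p. p tagged_division_of {0..1} \<longrightarrow> \<gamma>1 fine p \<longrightarrow>
        (\<Sum>(t, I)\<in>p. err t I) < \<epsilon>/2" using variational[OF \<epsilon>2] unfolding err_def by blast
      obtain \<gamma>2 where \<gamma>2: "gauge \<gamma>2" "\<forall>p. p tagged_division_of {0..1} \<longrightarrow> \<gamma>2 fine p \<longrightarrow>
        (\<Sum>(t, I)\<in>p. norm (integral I f - len I *\<^sub>R f t)) < \<epsilon>/2"
        using selection_variational[OF \<epsilon>2] by blast
      have "(\<Sum>(t, I)\<in>p. hausdorff_dist (?\<Psi> I) ((*\<^sub>R) (len I) ` ?G t)) < \<epsilon>"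
        if p: "p tagged_division_of {0..1}" "(\<lambda>x. \<gamma>1 x \<inter> \<gamma>2 x) fine p" for p
      proof -
        have "(\<Sum>(t, I)\<in>p. hausdorff_dist (?\<Psi> I) ((*\<^sub>R) (len I) ` ?G t)) \<le>
            (\<Sum>(t, I)\<in>p. err t I + norm (integral I f - len I *\<^sub>R f t))"
        proof (rule sum_mono, clarify)
          fix t I assume tI: "(t, I) \<in> p"
          have t: "t \<in> {0..1}" by (rule tag_in_interval[OF p(1) tI])
          have I: "I \<in> closed_subintervals" using tagged_divisionD01[OF p(1) order_refl tI] by metis
          have "(*\<^sub>R) (len I) ` ?G t = (\<lambda>x. x - len I *\<^sub>R f t) ` (*\<^sub>R) (len I) ` \<Gamma> t"
            by (simp add: image_image scaleR_diff_right)
          then show "hausdorff_dist (?\<Psi> I) ((*\<^sub>R) (len I) ` ?G t) \<le>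
              err t I + norm (integral I f - len I *\<^sub>R f t)"
            using hausdorff_dist_translate[OF nebd_\<Phi>[OF I] nebd_scaleR[OF nebd_\<Gamma>[OF t]]]
            by (simp add: err_def)
        qed
        also have "\<dots> = (\<Sum>(t, I)\<in>p. err t I) + (\<Sum>(t, I)\<in>p. norm (integral I f - len I *\<^sub>R f t))"
          by (simp add: sum.distrib case_prod_beta)
        also have "\<dots> < \<epsilon>" using \<gamma>1(2)[rule_format, OF p(1)] \<gamma>2(2)[rule_format, OF p(1)] p(2) by (simp add: fine_Int)
        finally show ?thesis .
      qed
      then show ?thesis using gauge_Int[OF \<gamma>1(1) \<gamma>2(1)] by blast
    qed
    show "0 \<in> ?G t" if "t \<in> {0..1}" for t using selection[OF that] by (auto simp: image_iff)
    show "ess_const e (\<lambda>s t. max (hausdorff_dist (?G s) (?G t)) (norm ((0 :: 'a) - 0)))" if e: "e > 0" for e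
    proof -
      have "e/2 > 0" using e by simp
      from ess_const[OF this] obtain N and i :: "real \<Rightarrow> nat" where N: "negligible N"
        "\<forall>n. {t \<in> {0..1} - N. i t = n} \<in> sets lebesgue"
        and osc: "\<forall>s\<in>{0..1} - N. \<forall>t\<in>{0..1} - N. i s = i t \<longrightarrow> max (hausdorff_dist (\<Gamma> s) (\<Gamma> t)) (norm (f s - f t)) \<le> e/2"
        unfolding ess_const_def by blast
      have "max (hausdorff_dist (?G s) (?G t)) (norm ((0 :: 'a) - 0)) \<le> e"
        if st: "s \<in> {0..1} - N" "t \<in> {0..1} - N" "i s = i t" for s t
      proof -
        have "hausdorff_dist (?G s) (?G t) \<le> hausdorff_dist (\<Gamma> s) (\<Gamma> t) + norm (f s - f t)"
          by (rule hausdorff_dist_translate[OF nebd_\<Gamma> nebd_\<Gamma>]) (use st in auto)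
        moreover have "max (hausdorff_dist (\<Gamma> s) (\<Gamma> t)) (norm (f s - f t)) \<le> e/2" using osc st by blast
        ultimately show ?thesis using e by simp
      qed
      then show ?thesis unfolding ess_const_def using N by blast
    qed
  qed
qed

theorem theorem5p3:
  fixes \<Gamma> :: "real \<Rightarrow> 'a::banach set"
  assumes "\<Gamma> \<in> {0..1} \<rightarrow> cwk"
    and "vH_integrable_multi \<Gamma>"
  shows "\<exists>f G. (\<forall>t\<in>{0..1}. f t \<in> \<Gamma> t) \<and> vH_integrable f \<and>
           G \<in> {0..1} \<rightarrow> cwk \<and> birkhoff_integrable G \<and> vH_integrable_multi G \<and>
           (\<forall>t\<in>{0..1}. \<Gamma> t = G t + {f t})"
proof -
  obtain \<Phi> where \<Phi>: "interval_multimeasure \<Phi>"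
    "\<forall>\<epsilon>>0. \<exists>\<gamma>. gauge \<gamma> \<and> (\<forall>p. p tagged_division_of {0..1} \<longrightarrow> \<gamma> fine p \<longrightarrow>
      (\<Sum>(t, I)\<in>p. hausdorff_dist (\<Phi> I) ((*\<^sub>R) (len I) ` \<Gamma> t)) < \<epsilon>)"
    using assms(2) unfolding vH_integrable_multi_def ex_fine_perron_iff by blast
  interpret vH_multifunction \<Gamma> \<Phi>
    by standard (use assms(1) \<Phi> in auto)
  obtain f where f: "\<And>t. t \<in> {0..1} \<Longrightarrow> f t \<in> \<Gamma> t"
    "\<And>e. e > 0 \<Longrightarrow> ess_const e (\<lambda>s t. max (hausdorff_dist (\<Gamma> s) (\<Gamma> t)) (norm (f s - f t)))"
    using ex_separable_selection by blast
  interpret F: vH_selection \<Gamma> \<Phi> f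
    by standard (use f in auto)
  define G where "G t = (\<lambda>x. x - f t) ` \<Gamma> t" for t
  define \<Psi> where "\<Psi> I = (\<lambda>x. x - integral I f) ` \<Phi> I" for I
  interpret G: vH_selection G \<Psi> "\<lambda>_. 0"
    unfolding G_def[abs_def] \<Psi>_def[abs_def] by (rule vH_selection_translate) unfold_locales
  have "\<Gamma> t = G t + {f t}" for t
    by (force simp: G_def set_plus_def image_iff)
  moreover have "vH_integrable_multi G"
    unfolding vH_integrable_multi_def ex_fine_perron_iff using G.multimeasure G.variational by blast
  moreover have "birkhoff_integrable G"
    by (rule birkhoff_integrable_if_zero_selection) unfold_locales
  ultimately show ?thesis
    using f(1) F.vH_integrable_selection G.cwk by (intro exI[of _ f] exI[of _ G]) auto
qed

end
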